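(* Let $\lambda=\sum_{k=0}^n\lambda_k\epsilon_k\in P$. In the Gelfand-Zetlin basis $\{|\boldsymbol\lambda\rangle\}$ of the Verma module $\mathcal V^\lambda$ over $U_v(\mathfrak{gl}_{n+1})$, the Whittaker vector $\theta^\lambda$ has the representation $$ \theta^\lambda=\sum_{\boldsymbol\lambda}\left(\frac{1}{1-v^2}\right)^{ht(\boldsymbol\lambda)}\prod_{i=1}^n C_i(\lambda^{(i)},\lambda^{(i-1)})\,|\boldsymbol\lambda\rangle , $$ the sum ranging over all Gelfand patterns $\boldsymbol\lambda$ with fixed $\lambda_0,\ldots,\lambda_n$, where $$ ht(\boldsymbol\lambda)=\sum_{0\le k\le i\le n-1}(\lambda_{k,n}-\lambda_{k,i}),\qquad C_i(\lambda^{(i)},\lambda^{(i-1)})=v^{p_i(\lambda^{(i)},\lambda^{(i-1)})}A_i(\lambda^{(i)},\lambda^{(i-1)}), $$ $$ \begin{aligned} p_i(\lambda^{(i)},\lambda^{(i-1)})&=(i-1)\left(\sum_{k=0}^{i-1}\lambda_{k,i-1}\Bigl(\sum_{k=0}^{i-1}\lambda_{k,i-1}-\sum_{k=0}^{i}\lambda_{k,i}\Bigr)-\sum_{0\le k<l\le i-1}\lambda_{k,i-1}\lambda_{l,i-1}+\sum_{0\le k<l\le i}\lambda_{k,i}\lambda_{l,i}\right)\\ &\quad-\sum_{k=1}^{i-1}k(i-k)(\lambda_{k,i-1}-\lambda_{k,i}), \end{aligned} $$ and, for $\mu=(\mu_0,\ldots,\mu_i)$, $\nu=(\nu_0,\ldots,\nu_{i-1})$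 with $\mu_k-\nu_k\in\mathbb{Z}_{\ge0}$, $A_i(\mu,\nu)$ is defined by $$ A_i(\mu,\nu)^2=\frac{1}{\prod_{k=0}^{i-1}[\mu_k-\nu_k]!}\cdot\frac{1}{\prod_{0\le k<l\le i-1}[\nu_k-\nu_l-k+l+1]_{\mu_k-\nu_k}}\cdot\frac{1}{\prod_{0\le k<l\le i}[\nu_k-\mu_l-k+l]_{\mu_k-\nu_k}} . $$
   Context: Notation: $[m]=(v^m-v^{-m})/(v-v^{-1})$, $[m]!=[m][m-1]\cdots[1]$, $[m]_k=[m][m+1]\cdots[m+k-1]$. $\epsilon_0,\ldots,\epsilon_n$ are orthonormal for $(\ ,\ )$, $P=\bigoplus_{i=0}^n\mathbb{Z}\epsilon_i$, $\alpha_i=\epsilon_{i-1}-\epsilon_i$ ($1\le i\le n$), $Q^+=\bigoplus_{i=1}^n\mathbb{Z}_{\ge0}\alpha_i$. $U_v(\mathfrak{gl}_{n+1})$ is the quantum group over $\mathbb{K}=\mathbb{C}(v)$ with generators $E_i,F_i$ ($1\le i\le n$), $v^{\pm\epsilon_i}$ ($0\le i\le n$) and the standard defining relations; $K_i=v^{\epsilon_{i-1}-\epsilon_i}$. $\mathcal V^\lambda$ is the Verma module generated by the highest weight vector $\mathbf{1}^\lambda$ with defining relations $E_i\mathbf{1}^\lambda=0$ ($1\le i\le n$), $v^{\epsilon_i}\mathbf{1}^\lambda=v^{\lambda_i}\mathbf{1}^\lambda$ ($0\le i\le n$). The base field is extended from $\mathbb{K}$ to $\mathcal R$, obtained by adjoining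 all elements $\sqrt f$ ($f\in\mathbb{K}$), and the same symbols denote the algebra and the module after this extension. For $\beta\in Q^+$, $(\mathcal V^\lambda)_\beta=\{w\in\mathcal V^\lambda: K_iw=v^{(\alpha_i,\lambda-\beta)}w,\ 1\le i\le n\}$. The Whittaker vector $\theta^\lambda=\sum_{\beta\in Q^+}\theta^\lambda_\beta\in\prod_{\beta\in Q^+}(\mathcal V^\lambda)_\beta$ is uniquely defined by the conditions $\theta^\lambda_0=\mathbf{1}^\lambda$ and $E_iK_i^{i-1}\theta^\lambda=\frac{1}{1-v^2}\theta^\lambda$ for $1\le i\le n$. A Gelfand pattern is an array $\boldsymbol\lambda=(\lambda^{(n)},\ldots,\lambda^{(0)})$, $\lambda^{(i)}=\lambda_{0,i}\epsilon_0+\cdots+\lambda_{i,i}\epsilon_i$ (identified with $(\lambda_{0,i},\ldots,\lambda_{i,i})$), with $\lambda_{k,i}=\lambda_k-m_{k,i}$, where the $m_{k,i}$ are non-negative integers with $0=m_{k,n}\le m_{k,n-1}\le\cdots\le m_{k,k}$ ($0\le k\le n$); in particular $\lambda_{k,n}=\lambda_k$. The Gelfand-Zetlin basis is the basis of $\mathcal V^\lambda$ relative to the tower of subalgebras $\mathcal A_0\subset\mathcal A_1\subset\cdots\subset\mathcal A_n$, where $\mathcal A_k\simeq U_v(\mathfrak{gl}_{k+1})$ is generated by $E_i,F_i$ ($1\le i\le k$) and $v^{\pm\epsilon_i}$ ($0\le i\le k$): the subspaces jointly invariant under the $\mathcal A_k$'s are one-dimensional and labeled by Gelfand patterns, and an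 appropriate generator $|\boldsymbol\lambda\rangle$ of each is chosen so that $$ v^{\epsilon_i}|\boldsymbol\lambda\rangle=v^{h_i(\boldsymbol\lambda)-h_{i-1}(\boldsymbol\lambda)}|\boldsymbol\lambda\rangle,\quad E_i|\boldsymbol\lambda\rangle=\sum_{k=0}^{i-1}c_{k,i-1}(\boldsymbol\lambda)|\boldsymbol\lambda_+^{(k,i-1)}\rangle,\quad F_i|\boldsymbol\lambda\rangle=\sum_{k=0}^{i-1}c_{k,i-1}(\boldsymbol\lambda_-^{(k,i-1)})|\boldsymbol\lambda_-^{(k,i-1)}\rangle . $$ Here $h_i(\boldsymbol\lambda)=\sum_{k=0}^i\lambda_{k,i}$ (with $h_{-1}=0$), $\boldsymbol\lambda_\pm^{(k,i-1)}$ is obtained from $\boldsymbol\lambda$ by replacing $\lambda_{k,i-1}$ by $\lambda_{k,i-1}\pm1$ and keeping all other entries, and $$ c_{k,i-1}(\boldsymbol\lambda)^2=-\frac{\prod_{0\le l\le i-2}[\lambda_{l,i-2}-\lambda_{k,i-1}-l+k-1]\prod_{0\le l\le i}[\lambda_{l,i}-\lambda_{k,i-1}-l+k]}{\prod_{0\le l\le i-1,\ l\ne k}[\lambda_{l,i-1}-\lambda_{k,i-1}-l+k-1][\lambda_{l,i-1}-\lambda_{k,i-1}-l+k]} . $$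
   Formalization: For integral λ and n≥2 some c² have zero denominators; weights may be generic and the denominators are assumed nonzero. The top vector is taken to be ±1^λ. As c and A_i are fixed only up to sign, the expansion holds, for any choice of A_i, after changing signs of some |λ⟩. *)

theory Defs
  imports
    "HOL-Library.Poly_Mapping"
    "HOL-Computational_Algebra.Polynomial"
    "HOL-Computational_Algebra.Fraction_Field"
begin

section \<open>The ground field and the exponents\<close>

text \<open>
  The ground field \<open>K = C(v)\<close> is \<open>complex poly fract\<close>, with \<open>v = X / 1\<close>.
  The entries of weights live in a commutative ring \<open>'l\<close> of characteristic zero, and
  \<open>vp x\<close> stands for \<open>v\<^sup>x\<close>.  Integral weights (the lattice \<open>P\<close>) are the instance \<open>'l = int\<close>,
  for which necessarily \<open>vp x = v powi x\<close>.  A larger ring \<open>'l\<close> is allowed because the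
  denominators in the Gelfand--Zetlin formulas vanish for some patterns as soon as
  two of \<open>\<lambda>\<^sub>0, \<dots>, \<lambda>\<^bsub>n-1\<^esub>\<close> differ by an integer, so that the basis exists for generic weights only.
\<close>

inductive_set subfield_gen :: "'r::field set \<Rightarrow> 'r set" for S :: "'r set" where
  base: "x \<in> S \<Longrightarrow> x \<in> subfield_gen S"
| one: "1 \<in> subfield_gen S"
| diff: "x \<in> subfield_gen S \<Longrightarrow> y \<in> subfield_gen S \<Longrightarrow> x - y \<in> subfield_gen S"
| mult: "x \<in> subfield_gen S \<Longrightarrow> y \<in> subfield_gen S \<Longrightarrow> x * y \<in> subfield_gen S"
| inverse: "x \<in> subfield_gen S \<Longrightarrow> inverse x \<in> subfield_gen S"

definition field_hom :: "('k::field \<Rightarrow> 'r::field) \<Rightarrow> bool" where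
  "field_hom \<iota> \<longleftrightarrow> \<iota> 1 = 1 \<and> (\<forall>x y. \<iota> (x + y) = \<iota> x + \<iota> y) \<and> (\<forall>x y. \<iota> (x * y) = \<iota> x * \<iota> y)"

definition qvar :: "complex poly fract" where
  "qvar = Fract [:0, 1:] 1"

definition exponential :: "(complex poly fract \<Rightarrow> 'r::field) \<Rightarrow> ('l::comm_ring_1 \<Rightarrow> 'r) \<Rightarrow> bool" where
  "exponential \<iota> vp \<longleftrightarrow> vp 1 = \<iota> qvar \<and> (\<forall>x y. vp (x + y) = vp x * vp y)"

text \<open>The field over which the algebra is defined; it is the image of \<open>C(v)\<close> if \<open>'l = int\<close>.\<close>

definition ground :: "(complex poly fract \<Rightarrow> 'r::field) \<Rightarrow> ('l::comm_ring_1 \<Rightarrow> 'r) \<Rightarrow> 'r set" where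
  "ground \<iota> vp = subfield_gen (range \<iota> \<union> range vp)"

text \<open>The type \<open>'r\<close> is the field obtained from the ground field by adjoining all \<open>\<surd>f\<close>.\<close>

definition sqrt_extension :: "(complex poly fract \<Rightarrow> 'r::field) \<Rightarrow> ('l::comm_ring_1 \<Rightarrow> 'r) \<Rightarrow> bool" where
  "sqrt_extension \<iota> vp \<longleftrightarrow>
     (\<forall>f\<in>ground \<iota> vp. \<exists>s. s^2 = f) \<and> subfield_gen {s. s^2 \<in> ground \<iota> vp} = UNIV"

definition qint :: "('l::comm_ring_1 \<Rightarrow> 'r::field) \<Rightarrow> 'l \<Rightarrow> 'r" where
  "qint vp x = (vp x - vp (- x)) / (vp 1 - vp (- 1))"

definition qfact :: "('l::comm_ring_1 \<Rightarrow> 'r::field) \<Rightarrow> nat \<Rightarrow> 'r" where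
  "qfact vp m = (\<Prod>j=1..m. qint vp (of_nat j))"

definition qpoch :: "('l::comm_ring_1 \<Rightarrow> 'r::field) \<Rightarrow> 'l \<Rightarrow> nat \<Rightarrow> 'r" where
  "qpoch vp x k = (\<Prod>j<k. qint vp (x + of_nat j))"


section \<open>The quantum group by generators and relations\<close>

text \<open>\<open>Vpos i\<close> and \<open>Vneg i\<close> stand for \<open>v\<close> to the power \<open>\<epsilon>\<^sub>i\<close> and \<open>- \<epsilon>\<^sub>i\<close>.\<close>

datatype gen = Egen nat | Fgen nat | Vpos nat | Vneg nat

text \<open>
  The free algebra is the monoid algebra of the words in the generators: elements are
  finitely supported functions on words, with convolution as multiplication.
\<close>

datatype word = Word (letters: "gen list")

instantiation word :: monoid_add
begin

definition zero_word :: word where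
  "0 = Word []"

definition plus_word :: "word \<Rightarrow> word \<Rightarrow> word" where
  "u + w = Word (letters u @ letters w)"

instance
  by standard (simp_all add: zero_word_def plus_word_def)

end

type_synonym 'r falg = "word \<Rightarrow>\<^sub>0 'r"

definition scalar :: "'r \<Rightarrow> 'r::field falg" where
  "scalar a = Poly_Mapping.single 0 a"

definition letter :: "gen \<Rightarrow> 'r::field falg" where
  "letter g = Poly_Mapping.single (Word [g]) 1"

definition K_pos :: "nat \<Rightarrow> 'r::field falg" where
  "K_pos i = letter (Vpos (i - 1)) * letter (Vneg i)"

definition K_neg :: "nat \<Rightarrow> 'r::field falg" where
  "K_neg i = letter (Vneg (i - 1)) * letter (Vpos i)"

definition gens :: "nat \<Rightarrow> gen set" where
  "gens n = Egen ` {1..n} \<union> Fgen ` {1..n} \<union> Vpos ` {0..n} \<union> Vneg ` {0..n}"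

text \<open>The elements involving only the generators of \<open>gl\<^bsub>k+1\<^esub>\<close>; for \<open>k \<le> n\<close> this gives the subalgebra \<open>A\<^sub>k\<close>.\<close>

definition free_alg :: "nat \<Rightarrow> 'r::field falg set" where
  "free_alg k = {p. \<forall>w\<in>Poly_Mapping.keys p. set (letters w) \<subseteq> gens k}"

text \<open>The coordinates of \<open>\<alpha>\<^sub>i = \<epsilon>\<^bsub>i-1\<^esub> - \<epsilon>\<^sub>i\<close>.\<close>

definition alpha :: "nat \<Rightarrow> nat \<Rightarrow> int" where
  "alpha i j = (if j = i - 1 then 1 else if j = i then - 1 else 0)"

definition serre :: "'r::field \<Rightarrow> 'r falg \<Rightarrow> 'r falg \<Rightarrow> 'r falg" where
  "serre v x y = x * x * y - scalar (v + inverse v) * x * y * x + y * x * x"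

definition relators :: "nat \<Rightarrow> 'r::field \<Rightarrow> 'r falg set" where
  "relators n v =
     {letter (Vpos i) * letter (Vneg i) - 1 | i. i \<le> n}
   \<union> {letter (Vneg i) * letter (Vpos i) - 1 | i. i \<le> n}
   \<union> {letter (Vpos i) * letter (Vpos j) - letter (Vpos j) * letter (Vpos i) | i j. i \<le> n \<and> j \<le> n}
   \<union> {letter (Vpos i) * letter (Egen j) * letter (Vneg i) - scalar (v powi alpha j i) * letter (Egen j)
        | i j. i \<le> n \<and> j \<in> {1..n}}
   \<union> {letter (Vpos i) * letter (Fgen j) * letter (Vneg i) - scalar (v powi (- alpha j i)) * letter (Fgen j)
        | i j. i \<le> n \<and> j \<in> {1..n}}
   \<union> {letter (Egen i) * letter (Fgen j) - letter (Fgen j) * letter (Egen i)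
        - (if i = j then scalar (1 / (v - inverse v)) * (K_pos i - K_neg i) else 0)
        | i j. i \<in> {1..n} \<and> j \<in> {1..n}}
   \<union> {letter (g i) * letter (g j) - letter (g j) * letter (g i)
        | g i j. g \<in> {Egen, Fgen} \<and> i \<in> {1..n} \<and> j \<in> {1..n} \<and> i + 1 < j}
   \<union> {serre v (letter (g i)) (letter (g j))
        | g i j. g \<in> {Egen, Fgen} \<and> i \<in> {1..n} \<and> j \<in> {1..n} \<and> (j = i + 1 \<or> i = j + 1)}"


section \<open>Modules, weight spaces, the Verma module\<close>

text \<open>
  A module is a vector space \<open>'m\<close> with scalar multiplication \<open>sc\<close>, together with one operator
  \<open>\<rho> g\<close> for each generator \<open>g\<close>.
\<close>

definition act :: "('r::field \<Rightarrow> 'm::ab_group_add \<Rightarrow> 'm) \<Rightarrow> (gen \<Rightarrow> 'm \<Rightarrow> 'm) \<Rightarrow> 'r falg \<Rightarrow> 'm \<Rightarrow> 'm" where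
  "act sc \<rho> p x = (\<Sum>w\<in>Poly_Mapping.keys p. sc (Poly_Mapping.lookup p w) (foldr \<rho> (letters w) x))"

definition Uv_module ::
  "nat \<Rightarrow> 'r::field \<Rightarrow> ('r \<Rightarrow> 'm::ab_group_add \<Rightarrow> 'm) \<Rightarrow> (gen \<Rightarrow> 'm \<Rightarrow> 'm) \<Rightarrow> bool" where
  "Uv_module n v sc \<rho> \<longleftrightarrow>
     vector_space sc \<and> (\<forall>g\<in>gens n. Vector_Spaces.linear sc sc (\<rho> g)) \<and>
     (\<forall>r\<in>relators n v. \<forall>x. act sc \<rho> r x = 0)"

definition hw_relators :: "nat \<Rightarrow> ('l::comm_ring_1 \<Rightarrow> 'r::field) \<Rightarrow> (nat \<Rightarrow> 'l) \<Rightarrow> 'r falg set" where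
  "hw_relators n vp \<mu> =
     {letter (Egen i) | i. i \<in> {1..n}} \<union> {letter (Vpos i) - scalar (vp (\<mu> i)) | i. i \<le> n}"

text \<open>
  The two-sided ideal of the relations of the algebra plus the left ideal generated by the
  relations of the highest weight vector.
\<close>

inductive_set verma_ideal :: "nat \<Rightarrow> ('l::comm_ring_1 \<Rightarrow> 'r::field) \<Rightarrow> (nat \<Rightarrow> 'l) \<Rightarrow> 'r falg set"
  for n :: nat and vp :: "'l::comm_ring_1 \<Rightarrow> 'r::field" and \<mu> :: "nat \<Rightarrow> 'l" where
  zero: "0 \<in> verma_ideal n vp \<mu>"
| add: "p \<in> verma_ideal n vp \<mu> \<Longrightarrow> q \<in> verma_ideal n vp \<mu> \<Longrightarrow> p + q \<in> verma_ideal n vp \<mu>"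
| rel: "r \<in> relators n (vp 1) \<Longrightarrow> a \<in> free_alg n \<Longrightarrow> b \<in> free_alg n \<Longrightarrow> a * r * b \<in> verma_ideal n vp \<mu>"
| hw: "s \<in> hw_relators n vp \<mu> \<Longrightarrow> a \<in> free_alg n \<Longrightarrow> a * s \<in> verma_ideal n vp \<mu>"

text \<open>
  The module is generated by \<open>u\<close>, and the relations above are defining ones: the module is the
  quotient of the free algebra by \<open>verma_ideal\<close>, with \<open>u\<close> the class of \<open>1\<close>.
\<close>

definition verma_module ::
  "nat \<Rightarrow> ('l::comm_ring_1 \<Rightarrow> 'r::field) \<Rightarrow> (nat \<Rightarrow> 'l) \<Rightarrow>
   ('r \<Rightarrow> 'm::ab_group_add \<Rightarrow> 'm) \<Rightarrow> (gen \<Rightarrow> 'm \<Rightarrow> 'm) \<Rightarrow> 'm \<Rightarrow> bool" where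
  "verma_module n vp \<mu> sc \<rho> u \<longleftrightarrow>
     Uv_module n (vp 1) sc \<rho> \<and>
     (\<forall>x. \<exists>p\<in>free_alg n. act sc \<rho> p u = x) \<and>
     (\<forall>p\<in>free_alg n. act sc \<rho> p u = 0 \<longleftrightarrow> p \<in> verma_ideal n vp \<mu>)"

text \<open>An element \<open>\<Sum>\<^sub>i \<beta>\<^sub>i \<alpha>\<^sub>i\<close> of \<open>Q\<^sup>+\<close> is given by its coefficients \<open>\<beta>\<close>; \<open>qcoord\<close> returns its coordinates.\<close>

definition Qplus :: "nat \<Rightarrow> (nat \<Rightarrow> nat) set" where
  "Qplus n = {\<beta>. \<forall>i. i \<notin> {1..n} \<longrightarrow> \<beta> i = 0}"

definition qcoord :: "nat \<Rightarrow> (nat \<Rightarrow> nat) \<Rightarrow> nat \<Rightarrow> 'l::comm_ring_1" where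
  "qcoord n \<beta> j = (\<Sum>i=1..n. of_nat (\<beta> i) * of_int (alpha i j))"

definition form :: "nat \<Rightarrow> (nat \<Rightarrow> 'l::comm_ring_1) \<Rightarrow> (nat \<Rightarrow> 'l) \<Rightarrow> 'l" where
  "form n x y = (\<Sum>j\<le>n. x j * y j)"

definition weight_space ::
  "nat \<Rightarrow> ('l::comm_ring_1 \<Rightarrow> 'r::field) \<Rightarrow> (nat \<Rightarrow> 'l) \<Rightarrow>
   ('r \<Rightarrow> 'm::ab_group_add \<Rightarrow> 'm) \<Rightarrow> (gen \<Rightarrow> 'm \<Rightarrow> 'm) \<Rightarrow> (nat \<Rightarrow> nat) \<Rightarrow> 'm set" where
  "weight_space n vp lam sc \<rho> \<beta> =
     {w. \<forall>i\<in>{1..n}. act sc \<rho> (K_pos i) w =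
           sc (vp (form n (\<lambda>j. of_int (alpha i j)) (\<lambda>j. lam j - qcoord n \<beta> j))) w}"

text \<open>
  An element of the product of the weight spaces is a family \<open>\<theta>\<close> indexed by \<open>Q\<^sup>+\<close>.  As \<open>E\<^sub>i\<close>
  lowers \<open>\<beta>\<close> by \<open>\<alpha>\<^sub>i\<close>, the component at \<open>\<beta>\<close> of \<open>E\<^sub>i K\<^sub>i\<^bsup>i-1\<^esup> \<theta>\<close> comes from \<open>\<theta>\<close> at \<open>\<beta> + \<alpha>\<^sub>i\<close>.
\<close>

definition whittaker ::
  "nat \<Rightarrow> ('l::comm_ring_1 \<Rightarrow> 'r::field) \<Rightarrow> (nat \<Rightarrow> 'l) \<Rightarrow>
   ('r \<Rightarrow> 'm::ab_group_add \<Rightarrow> 'm) \<Rightarrow> (gen \<Rightarrow> 'm \<Rightarrow> 'm) \<Rightarrow> 'm \<Rightarrow> ((nat \<Rightarrow> nat) \<Rightarrow> 'm) \<Rightarrow> bool" where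
  "whittaker n vp lam sc \<rho> u \<theta> \<longleftrightarrow>
     (\<forall>\<beta>\<in>Qplus n. \<theta> \<beta> \<in> weight_space n vp lam sc \<rho> \<beta>) \<and>
     \<theta> (\<lambda>_. 0) = u \<and>
     (\<forall>i\<in>{1..n}. \<forall>\<beta>\<in>Qplus n.
        act sc \<rho> (letter (Egen i) * K_pos i ^ (i - 1)) (\<theta> (\<beta>(i := \<beta> i + 1)))
          = sc (1 / (1 - (vp 1)^2)) (\<theta> \<beta>))"


section \<open>Gelfand patterns and the Gelfand--Zetlin basis\<close>

text \<open>
  A pattern is stored through the integers \<open>m k i\<close> with \<open>\<lambda>\<^bsub>k,i\<^esub> = \<lambda>\<^sub>k - m k i\<close>, extended by zero
  outside \<open>k \<le> i < n\<close>; in particular \<open>m k n = 0\<close>.  The type is \<open>int\<close> so that raising an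
  entry of a pattern may lead out of the set of patterns.
\<close>

type_synonym pattern = "nat \<Rightarrow> nat \<Rightarrow> int"

definition patterns :: "nat \<Rightarrow> pattern set" where
  "patterns n = {m. (\<forall>k i. \<not> (k \<le> i \<and> i < n) \<longrightarrow> m k i = 0) \<and>
                    (\<forall>k i. k \<le> i \<and> i < n \<longrightarrow> m k (i + 1) \<le> m k i)}"

definition entry :: "(nat \<Rightarrow> 'l::comm_ring_1) \<Rightarrow> pattern \<Rightarrow> nat \<Rightarrow> nat \<Rightarrow> 'l" where
  "entry lam m k i = lam k - of_int (m k i)"

definition row :: "(nat \<Rightarrow> 'l::comm_ring_1) \<Rightarrow> pattern \<Rightarrow> nat \<Rightarrow> nat \<Rightarrow> 'l" where
  "row lam m i = (\<lambda>k. if k \<le> i then entry lam m k i else 0)"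

text \<open>Adding \<open>d\<close> to the entry \<open>\<lambda>\<^bsub>k,i\<^esub>\<close>.\<close>

definition shift :: "int \<Rightarrow> nat \<Rightarrow> nat \<Rightarrow> pattern \<Rightarrow> pattern" where
  "shift d k i m = m(k := (m k)(i := m k i - d))"

definition hsum :: "(nat \<Rightarrow> 'l::comm_ring_1) \<Rightarrow> pattern \<Rightarrow> nat \<Rightarrow> 'l" where
  "hsum lam m i = (\<Sum>k\<le>i. entry lam m k i)"

definition pattern_weight :: "(nat \<Rightarrow> 'l::comm_ring_1) \<Rightarrow> pattern \<Rightarrow> nat \<Rightarrow> 'l" where
  "pattern_weight lam m i = hsum lam m i - (if i = 0 then 0 else hsum lam m (i - 1))"

text \<open>Numerator and denominator of \<open>- c\<^bsub>k,i-1\<^esub>(\<lambda>)\<^sup>2\<close>.\<close>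

definition c_num :: "('l::comm_ring_1 \<Rightarrow> 'r::field) \<Rightarrow> (nat \<Rightarrow> 'l) \<Rightarrow> nat \<Rightarrow> nat \<Rightarrow> pattern \<Rightarrow> 'r" where
  "c_num vp lam k i m =
     (\<Prod>l<i-1. qint vp (entry lam m l (i - 2) - entry lam m k (i - 1) - of_nat l + of_nat k - 1)) *
     (\<Prod>l\<le>i. qint vp (entry lam m l i - entry lam m k (i - 1) - of_nat l + of_nat k))"

definition c_den :: "('l::comm_ring_1 \<Rightarrow> 'r::field) \<Rightarrow> (nat \<Rightarrow> 'l) \<Rightarrow> nat \<Rightarrow> nat \<Rightarrow> pattern \<Rightarrow> 'r" where
  "c_den vp lam k i m =
     (\<Prod>l\<in>{..<i} - {k}.
        qint vp (entry lam m l (i - 1) - entry lam m k (i - 1) - of_nat l + of_nat k - 1) *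
        qint vp (entry lam m l (i - 1) - entry lam m k (i - 1) - of_nat l + of_nat k))"

text \<open>Highest weight vectors of weight \<open>\<mu>\<close> for the subalgebra \<open>A\<^sub>k\<close>.\<close>

definition hw_vectors ::
  "nat \<Rightarrow> ('l::comm_ring_1 \<Rightarrow> 'r::field) \<Rightarrow> (nat \<Rightarrow> 'l) \<Rightarrow>
   ('r \<Rightarrow> 'm::ab_group_add \<Rightarrow> 'm) \<Rightarrow> (gen \<Rightarrow> 'm \<Rightarrow> 'm) \<Rightarrow> 'm set" where
  "hw_vectors k vp \<mu> sc \<rho> = {w. \<forall>s\<in>hw_relators k vp \<mu>. act sc \<rho> s w = 0}"

text \<open>
  The subspace attached to a pattern by the tower \<open>A\<^sub>0 \<subset> \<dots> \<subset> A\<^sub>n\<close>: the intersection over \<open>k\<close>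
  of the sums of all \<open>A\<^sub>k\<close>-submodules generated by highest weight vectors whose weight is row \<open>k\<close>.
\<close>

definition gz_subspace ::
  "nat \<Rightarrow> ('l::comm_ring_1 \<Rightarrow> 'r::field) \<Rightarrow> (nat \<Rightarrow> 'l) \<Rightarrow>
   ('r \<Rightarrow> 'm::ab_group_add \<Rightarrow> 'm) \<Rightarrow> (gen \<Rightarrow> 'm \<Rightarrow> 'm) \<Rightarrow> pattern \<Rightarrow> 'm set" where
  "gz_subspace n vp lam sc \<rho> m =
     (\<Inter>k\<in>{..n}. module.span sc {act sc \<rho> a w | a w. a \<in> free_alg k \<and> w \<in> hw_vectors k vp (row lam m k) sc \<rho>})"

text \<open>A ket whose label is not a pattern is zero: the expression prescribed for the square of its coefficient vanishes.\<close>

definition ket :: "nat \<Rightarrow> (pattern \<Rightarrow> 'm::zero) \<Rightarrow> pattern \<Rightarrow> 'm" where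
  "ket n b m = (if m \<in> patterns n then b m else 0)"

text \<open>
  Besides the defining formulas this records that they make sense (\<open>c_den \<noteq> 0\<close>) and the
  normalization of the top ket, up to sign.  The signs of the roots \<open>c\<close> are not prescribed: replacing
  \<open>b m\<close> by \<open>\<plusminus> b m\<close> leads to another Gelfand--Zetlin basis, with other signs of \<open>c\<close>.
\<close>

definition gz_basis ::
  "nat \<Rightarrow> ('l::comm_ring_1 \<Rightarrow> 'r::field) \<Rightarrow> (nat \<Rightarrow> 'l) \<Rightarrow>
   ('r \<Rightarrow> 'm::ab_group_add \<Rightarrow> 'm) \<Rightarrow> (gen \<Rightarrow> 'm \<Rightarrow> 'm) \<Rightarrow> 'm \<Rightarrow> (pattern \<Rightarrow> 'm) \<Rightarrow> bool" where
  "gz_basis n vp lam sc \<rho> u b \<longleftrightarrow>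
     inj_on b (patterns n) \<and> \<not> module.dependent sc (b ` patterns n) \<and>
     module.span sc (b ` patterns n) = UNIV \<and>
     (b (\<lambda>k i. 0) = u \<or> b (\<lambda>k i. 0) = - u) \<and>
     (\<forall>m\<in>patterns n. gz_subspace n vp lam sc \<rho> m = module.span sc {b m}) \<and>
     (\<exists>c :: nat \<Rightarrow> nat \<Rightarrow> pattern \<Rightarrow> 'r.
        (\<forall>m\<in>patterns n. \<forall>i\<in>{1..n}. \<forall>k<i.
           c_den vp lam k i m \<noteq> 0 \<and> (c k (i - 1) m)^2 = - (c_num vp lam k i m / c_den vp lam k i m)) \<and>
        (\<forall>m\<in>patterns n. \<forall>i\<le>n. \<rho> (Vpos i) (b m) = sc (vp (pattern_weight lam m i)) (b m)) \<and>
        (\<forall>m\<in>patterns n. \<forall>i\<in>{1..n}.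
           \<rho> (Egen i) (b m) = (\<Sum>k<i. sc (c k (i - 1) m) (ket n b (shift 1 k (i - 1) m)))) \<and>
        (\<forall>m\<in>patterns n. \<forall>i\<in>{1..n}.
           \<rho> (Fgen i) (b m) =
             (\<Sum>k<i. sc (c k (i - 1) (shift (- 1) k (i - 1) m)) (ket n b (shift (- 1) k (i - 1) m)))))"


section \<open>The coefficients of the Whittaker vector\<close>

definition ht :: "nat \<Rightarrow> pattern \<Rightarrow> int" where
  "ht n m = (\<Sum>i<n. \<Sum>k\<le>i. m k i - m k n)"

definition p_exp :: "nat \<Rightarrow> (nat \<Rightarrow> 'l::comm_ring_1) \<Rightarrow> (nat \<Rightarrow> 'l) \<Rightarrow> 'l" where
  "p_exp i \<mu> \<nu> =
     (of_nat i - 1) *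
       ((\<Sum>k<i. \<nu> k) * ((\<Sum>k<i. \<nu> k) - (\<Sum>k\<le>i. \<mu> k))
        - (\<Sum>l<i. \<Sum>k<l. \<nu> k * \<nu> l) + (\<Sum>l\<le>i. \<Sum>k<l. \<mu> k * \<mu> l))
     - (\<Sum>k=1..<i. of_nat (k * (i - k)) * (\<nu> k - \<mu> k))"

text \<open>Here \<open>d k\<close> is the non-negative integer \<open>\<mu>\<^sub>k - \<nu>\<^sub>k\<close>.\<close>

definition A_square ::
  "('l::comm_ring_1 \<Rightarrow> 'r::field) \<Rightarrow> nat \<Rightarrow> (nat \<Rightarrow> 'l) \<Rightarrow> (nat \<Rightarrow> 'l) \<Rightarrow> (nat \<Rightarrow> nat) \<Rightarrow> 'r" where
  "A_square vp i \<mu> \<nu> d =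
     1 / (\<Prod>k<i. qfact vp (d k)) *
     (1 / (\<Prod>l<i. \<Prod>k<l. qpoch vp (\<nu> k - \<nu> l - of_nat k + of_nat l + 1) (d k))) *
     (1 / (\<Prod>l\<le>i. \<Prod>k<l. qpoch vp (\<nu> k - \<mu> l - of_nat k + of_nat l) (d k)))"

definition A_roots ::
  "nat \<Rightarrow> ('l::comm_ring_1 \<Rightarrow> 'r::field) \<Rightarrow> (nat \<Rightarrow> (nat \<Rightarrow> 'l) \<Rightarrow> (nat \<Rightarrow> 'l) \<Rightarrow> 'r) \<Rightarrow> bool" where
  "A_roots n vp A \<longleftrightarrow>
     (\<forall>i\<in>{1..n}. \<forall>\<mu> \<nu> d. (\<forall>k<i. \<mu> k - \<nu> k = of_nat (d k)) \<longrightarrow> (A i \<mu> \<nu>)^2 = A_square vp i \<mu> \<nu> d)"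

definition C_coeff ::
  "('l::comm_ring_1 \<Rightarrow> 'r::field) \<Rightarrow> (nat \<Rightarrow> (nat \<Rightarrow> 'l) \<Rightarrow> (nat \<Rightarrow> 'l) \<Rightarrow> 'r) \<Rightarrow>
   nat \<Rightarrow> (nat \<Rightarrow> 'l) \<Rightarrow> (nat \<Rightarrow> 'l) \<Rightarrow> 'r" where
  "C_coeff vp A i \<mu> \<nu> = vp (p_exp i \<mu> \<nu>) * A i \<mu> \<nu>"

definition whittaker_coeff ::
  "nat \<Rightarrow> ('l::comm_ring_1 \<Rightarrow> 'r::field) \<Rightarrow> (nat \<Rightarrow> 'l) \<Rightarrow>
   (nat \<Rightarrow> (nat \<Rightarrow> 'l) \<Rightarrow> (nat \<Rightarrow> 'l) \<Rightarrow> 'r) \<Rightarrow> pattern \<Rightarrow> 'r" where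
  "whittaker_coeff n vp lam A m =
     (1 / (1 - (vp 1)^2)) powi ht n m * (\<Prod>i=1..n. C_coeff vp A i (row lam m i) (row lam m (i - 1)))"

text \<open>
  The patterns whose kets have weight \<open>\<lambda> - \<beta>\<close>.  They are finite in number, so the component at
  \<open>\<beta>\<close> of a formal sum over all patterns is a finite sum over this set.
\<close>

definition patterns_at :: "nat \<Rightarrow> (nat \<Rightarrow> 'l::comm_ring_1) \<Rightarrow> (nat \<Rightarrow> nat) \<Rightarrow> pattern set" where
  "patterns_at n lam \<beta> = {m \<in> patterns n. \<forall>j\<le>n. pattern_weight lam m j = lam j - qcoord n \<beta> j}"

end

theory Submission
  imports Defs
begin

text \<open>
Let \<open>x m\<close> be the coordinate of \<open>\<theta>\<close> at the ket of the pattern \<open>m\<close>.  In a Gelfand--Zetlin basis the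
matrices of \<open>E\<^sub>i\<close> and \<open>F\<^sub>i\<close> are transposes of each other, so the conditions on \<open>\<theta>\<close> say that
the sum over the lowering moves in row \<open>r = i - 1\<close>, \<open>\<Sum>\<^sub>k c\<^sub>k x(m lowered at k)\<close>, is an explicit multiple
of \<open>x m\<close> (\<open>whittaker_recurrence\<close>).  Equivalently, \<open>x\<close> is a linear functional on the module which \<open>F\<^sub>i\<close>
multiplies by a known factor on each weight space; since the module is spanned by monomials in the \<open>F\<^sub>i\<close>
applied to the highest weight vector, the functional is determined by its value there
(\<open>recurrence_vanishes\<close>).  It remains to exhibit one solution and to compare it with the claimed one.

The solution is found one move at a time.  Instead of the sum, each single term is prescribed:
\<open>c\<^sub>k y(m lowered at k)\<close> is the right hand side of the recurrence times a weight \<open>lagrange_weight k r m\<close>.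
The weights are those of Lagrange interpolation, with nodes given by the entries of row \<open>r\<close>, of the polynomial
\<open>\<Prod>(1 - X / B)\<close> with roots \<open>B\<close> given by row \<open>r - 1\<close>, evaluated at \<open>0\<close>; hence they add up to \<open>1\<close>
(\<open>lagrange_sum_eq_1\<close>), and the weight of a move leading out of the set of patterns vanishes.
Two things make this definition of \<open>y\<close> possible.  First, no \<open>c\<^sub>k\<close> by which one has to divide
is zero (\<open>c_nonzero\<close>): a zero would stop \<open>F\<close> monomials from reaching part of the basis.
Second, the result does not depend on the order of the moves: the commutators of \<open>E\<^sub>i\<close> and \<open>F\<^sub>j\<close>
give \<open>c_square_relation\<close>, which fixes the products of the square roots around a square of two moves, and the
remaining rational identity is \<open>move_square_identity\<close>.

Finally, along one move the square of the claimed coefficient changes exactly as \<open>y\<^sup>2\<close> does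
(\<open>coeff_square_step\<close>).  So both agree up to sign, and the signs are absorbed into the basis.
\<close>

section \<open>Quantum integers\<close>

text \<open>
The character \<open>x \<mapsto> v\<^sup>x\<close>, with \<open>v\<close> not a root of unity, so that \<open>[j]\<close> is invertible for every nonzero
integer \<open>j\<close>.
\<close>

locale quantum_exponent =
  fixes vp :: "'l::{comm_ring_1, ring_char_0} \<Rightarrow> 'r::field"
  assumes vp_add: "vp (x + y) = vp x * vp y"
    and vp_1_nonzero: "vp 1 \<noteq> 0"
    and vp_1_not_root_of_unity: "0 < j \<Longrightarrow> vp 1 ^ j \<noteq> 1"
begin

lemma vp_0 [simp]: "vp 0 = 1"
  using vp_add[of 1 0] vp_1_nonzero by simp

lemma vp_nonzero [simp]: "vp x \<noteq> 0"
  using vp_add[of x "- x"] by auto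

lemma vp_minus: "vp (- x) = inverse (vp x)"
  using vp_add[of x "- x"] by (simp add: field_simps inverse_unique)

lemma vp_diff: "vp (x - y) = vp x / vp y"
  using vp_add[of x "- y"] by (simp add: vp_minus divide_inverse)

lemma vp_of_nat_mult: "vp (of_nat j * x) = vp x ^ j"
  by (induction j) (simp_all add: vp_add algebra_simps)

lemma vp_of_nat: "vp (of_nat j) = vp 1 ^ j"
  using vp_of_nat_mult[of j 1] by simp

lemma vp_sum: "vp (\<Sum>i\<in>S. f i) = (\<Prod>i\<in>S. vp (f i))"
  by (induction S rule: infinite_finite_induct) (simp_all add: vp_add)

lemma vp_of_int_eq_1_iff: "vp (of_int j) = 1 \<longleftrightarrow> j = 0"
proof
  assume *: "vp (of_int j) = 1"
  show "j = 0"
  proof (rule ccontr)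
    assume "j \<noteq> 0"
    then have pos: "0 < nat \<bar>j\<bar>" by simp
    have "vp (of_nat (nat \<bar>j\<bar>)) = 1"
      using * by (cases "j \<ge> 0") (simp_all add: vp_minus)
    then show False
      using vp_1_not_root_of_unity[OF pos] by (metis vp_of_nat)
  qed
qed simp

lemma vp_1_minus_inverse_nonzero: "vp 1 - vp (- 1) \<noteq> 0"
proof
  assume "vp 1 - vp (- 1) = 0"
  then have "vp 1 ^ 2 = 1"
    by (simp add: vp_minus power2_eq_square field_simps)
  then show False using vp_1_not_root_of_unity[of 2] by simp
qed

text \<open>
The quantum integer \<open>[x]\<close> up to a constant and a power of \<open>v\<close> (\<open>qint_conv_e'\<close>).  It depends on \<open>x\<close> through \<open>v\<^bsup>2x\<^esup>\<close> only,
so differences become ratios of nodes, as needed for Lagrange interpolation.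
\<close>

definition e :: "'l \<Rightarrow> 'r" where
  "e x = 1 - vp (2 * x)"

lemma vp_double: "vp (2 * x) = vp x * vp x"
  using vp_add[of x x] by (simp only: mult_2)

lemma qint_conv_e: "qint vp x = vp x * e (- x) / (vp 1 - vp (- 1))"
proof -
  have "vp x - vp (- x) = vp x * e (- x)"
    unfolding e_def vp_double by (simp add: vp_minus right_diff_distrib)
  then show ?thesis by (simp add: qint_def)
qed

lemma e_minus: "e x = - vp (2 * x) * e (- x)"
  unfolding e_def vp_double by (simp add: vp_minus field_simps)

lemma qint_eq_0_iff: "qint vp x = 0 \<longleftrightarrow> e x = 0"
  unfolding qint_conv_e using vp_1_minus_inverse_nonzero e_minus[of x] by simp

lemma qint_minus: "qint vp (- x) = - qint vp x"
  by (simp add: qint_def diff_divide_distrib)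

lemma qint_diff_commute: "qint vp (x - y) = - qint vp (y - x)"
  using qint_minus[of "y - x"] by simp

lemma e_0 [simp]: "e 0 = 0"
  by (simp add: e_def)

lemma qint_of_int_eq_0_iff: "qint vp (of_int j) = 0 \<longleftrightarrow> j = 0"
  using vp_of_int_eq_1_iff[of "2 * j"] by (simp add: qint_eq_0_iff e_def)

lemma qpoch_0 [simp]: "qpoch vp x 0 = 1"
  by (simp add: qpoch_def)

lemma qpoch_Suc: "qpoch vp x (Suc k) = qpoch vp x k * qint vp (x + of_nat k)"
  by (simp add: qpoch_def)

lemma qpoch_Suc_left: "qpoch vp x (Suc k) = qint vp x * qpoch vp (x + 1) k"
  unfolding qpoch_def prod.lessThan_Suc_shift by (simp add: algebra_simps)

lemma qfact_Suc: "qfact vp (Suc k) = qfact vp k * qint vp (of_nat (Suc k))"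
  unfolding qfact_def by (simp add: mult.commute)

end

text \<open>
A root of unity \<open>v\<close> would be one already in \<open>C(v)\<close>, by injectivity of \<open>\<iota>\<close>; there the powers of
the variable have different degrees.
\<close>

lemma quantum_exponentI:
  fixes vp :: "'l::{comm_ring_1, ring_char_0} \<Rightarrow> 'r::field"
  assumes hom: "field_hom \<iota>" and exp: "exponential \<iota> vp"
  shows "quantum_exponent vp"
proof
  have one: "\<iota> 1 = 1" and add: "\<iota> (x + y) = \<iota> x + \<iota> y" and mult: "\<iota> (x * y) = \<iota> x * \<iota> y" for x y
    using hom by (auto simp: field_hom_def)
  have zero: "\<iota> 0 = 0" using add[of 0 0] by (metis add_cancel_right_right)
  have pow: "\<iota> (x ^ j) = \<iota> x ^ j" for x j
    by (induction j) (simp_all add: one mult)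
  have inj: "x = y" if "\<iota> x = \<iota> y" for x y
  proof (rule ccontr)
    assume "x \<noteq> y"
    have "\<iota> (x - y) = 0"
      using add[of "x - y" y] that by simp
    then have "\<iota> ((x - y) * inverse (x - y)) = 0" by (simp only: mult) simp
    with \<open>x \<noteq> y\<close> one show False by simp
  qed
  have qpow: "qvar ^ j = Fract ([:0, 1:] ^ j) 1" for j
    by (induction j) (simp_all add: qvar_def One_fract_def)
  have v: "vp 1 = \<iota> qvar" using exp by (simp add: exponential_def)
  have q0: "qvar \<noteq> 0"
    by (simp add: qvar_def Zero_fract_def eq_fract)
  show "vp (x + y) = vp x * vp y" for x y
    using exp by (simp add: exponential_def)
  show "vp 1 \<noteq> 0"
    using q0 inj[of qvar 0] by (auto simp: v zero)
  show "vp 1 ^ j \<noteq> 1" if "0 < j" for j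
  proof
    assume "vp 1 ^ j = 1"
    then have "qvar ^ j = 1" using inj[of "qvar ^ j" 1] by (simp add: v pow one)
    then have "([:0, 1:] :: complex poly) ^ j = 1"
      by (simp add: qpow One_fract_def eq_fract)
    then have "degree (([:0, 1:] :: complex poly) ^ j) = 0" by simp
    then show False using that by (simp add: degree_power_eq)
  qed
qed

section \<open>Lagrange interpolation at zero\<close>

text \<open>
The polynomial \<open>g = \<Prod>(1 - X / B l)\<close> has degree at most \<open>r\<close>, so it agrees with its Lagrange interpolation
at the \<open>r + 1\<close> nodes \<open>A k\<close>; the identity is the equality of the values at \<open>0\<close>, where \<open>g\<close> is \<open>1\<close>.
\<close>

lemma lagrange_sum_eq_1:
  fixes A B :: "nat \<Rightarrow> 'r::field"
  assumes inj: "inj_on A {..r}" and A0: "\<And>k. k \<le> r \<Longrightarrow> A k \<noteq> 0"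
  shows "(\<Sum>k\<le>r. (\<Prod>l<r. 1 - A k / B l) * (\<Prod>l\<in>{..r} - {k}. inverse (1 - A k / A l))) = 1"
proof -
  define g :: "'r poly" where "g = (\<Prod>l<r. [:1, - inverse (B l):])"
  define w where "w k = (\<Prod>l\<in>{..r} - {k}. smult (inverse (A k - A l)) [:- A l, 1:])" for k
  define h where "h = (\<Sum>k\<le>r. smult (poly g (A k)) (w k))"
  have deg_g: "degree g \<le> r"
    unfolding g_def by (rule order_trans[OF degree_prod_sum_le])
      (auto intro: order_trans[OF sum_mono[of _ _ "\<lambda>_. 1"]])
  have deg_w: "degree (w k) \<le> r" if "k \<le> r" for k
  proof -
    have "degree (w k) \<le> (\<Sum>l\<in>{..r} - {k}. degree (smult (inverse (A k - A l)) [:- A l, 1:]))"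
      unfolding w_def by (intro degree_prod_sum_le[unfolded o_def]) auto
    also have "\<dots> \<le> (\<Sum>l\<in>{..r} - {k}. 1)"
      by (intro sum_mono order_trans[OF degree_smult_le]) simp
    finally show ?thesis using that by simp
  qed
  have deg_h: "degree h \<le> r"
    unfolding h_def
    by (intro degree_sum_le) (use deg_w in auto)
  have w_node: "poly (w k) (A j) = (if j = k then 1 else 0)" if "k \<le> r" "j \<le> r" for k j
  proof (cases "j = k")
    case True
    have "poly (smult (inverse (A k - A l)) [:- A l, 1:]) (A k) = 1" if "l \<in> {..r} - {k}" for l
    proof -
      have "A k - A l \<noteq> 0"
        using that \<open>k \<le> r\<close> inj_onD[OF inj, of k l] by auto
      then have "inverse (A k - A l) * (A k - A l) = 1" by (rule left_inverse)
      then show ?thesis by (simp add: algebra_simps)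
    qed
    then have "poly (w k) (A k) = 1"
      unfolding w_def poly_prod by (intro prod.neutral) blast
    then show ?thesis using True by simp
  next
    case False
    then have "poly (w k) (A j) = 0"
      using that unfolding w_def poly_prod by (intro prod_zero) auto
    then show ?thesis using False by simp
  qed
  have "poly h (A j) = poly g (A j)" if "j \<le> r" for j
  proof -
    have "poly h (A j) = (\<Sum>k\<le>r. if j = k then poly g (A k) else 0)"
      unfolding h_def poly_sum using that by (intro sum.cong) (auto simp: w_node)
    also have "\<dots> = poly g (A j)"
      using that by simp
    finally show ?thesis .
  qed
  then have "h = g"
    using deg_g deg_h
    by (intro poly_eqI_degree[of "A ` {..r}"]) (auto simp: card_image[OF inj])
  have "(\<Sum>k\<le>r. (\<Prod>l<r. 1 - A k / B l) * (\<Prod>l\<in>{..r} - {k}. inverse (1 - A k / A l))) = poly h 0"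
    unfolding h_def poly_sum
  proof (intro sum.cong refl)
    fix k assume k: "k \<in> {..r}"
    have "(\<Prod>l\<in>{..r} - {k}. inverse (1 - A k / A l)) = poly (w k) 0"
      unfolding w_def poly_prod
    proof (intro prod.cong refl)
      fix l assume l: "l \<in> {..r} - {k}"
      then have "A k - A l \<noteq> 0" "A l \<noteq> 0"
        using k inj_onD[OF inj, of k l] A0 by auto
      then show "inverse (1 - A k / A l) = poly (smult (inverse (A k - A l)) [:- A l, 1:]) 0"
        by (simp add: divide_simps) (simp add: algebra_simps)
    qed
    moreover have "(\<Prod>l<r. 1 - A k / B l) = poly g (A k)"
      by (simp add: g_def poly_prod divide_inverse)
    ultimately show "(\<Prod>l<r. 1 - A k / B l) * (\<Prod>l\<in>{..r} - {k}. inverse (1 - A k / A l))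
        = poly (smult (poly g (A k)) (w k)) 0"
      by simp
  qed
  also have "\<dots> = 1"
    unfolding \<open>h = g\<close> by (simp add: g_def poly_prod)
  finally show ?thesis .
qed

section \<open>Lowering one entry in the coefficient formulas\<close>

text \<open>
The products in \<open>A_square\<close> run over pairs \<open>k < l\<close>.  Changing a single entry \<open>j\<close> affects only the pairs
that contain \<open>j\<close>.
\<close>

lemma prod_triangle_single_index:
  fixes t :: "nat \<Rightarrow> nat \<Rightarrow> 'a::comm_monoid_mult"
  assumes "\<And>k l. k < l \<Longrightarrow> k \<noteq> j \<Longrightarrow> l \<noteq> j \<Longrightarrow> t k l = 1" and "j < i"
  shows "(\<Prod>l<i. \<Prod>k<l. t k l) = (\<Prod>l\<in>{..<i} - {j}. if l < j then t l j else t j l)"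
proof -
  have outer: "(\<Prod>k<l. t k l) = (if j < l then t j l else 1)" if "l \<noteq> j" for l
  proof -
    have "(\<Prod>k<l. t k l) = (\<Prod>k<l. if k = j then t j l else 1)"
      using assms(1) that by (intro prod.cong) auto
    then show ?thesis by simp
  qed
  have "(\<Prod>l<i. \<Prod>k<l. t k l) = (\<Prod>k<j. t k j) * (\<Prod>l\<in>{..<i} - {j}. \<Prod>k<l. t k l)"
    using \<open>j < i\<close> by (subst prod.remove[of _ j]) auto
  also have "(\<Prod>k<j. t k j) = (\<Prod>l\<in>{..<i} - {j}. if l < j then t l j else 1)"
    using \<open>j < i\<close> by (intro prod.mono_neutral_cong_left) auto
  also have "(\<Prod>l\<in>{..<i} - {j}. \<Prod>k<l. t k l) = (\<Prod>l\<in>{..<i} - {j}. if j < l then t j l else 1)"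
    using outer by (intro prod.cong) auto
  finally show ?thesis
    by (simp add: prod.distrib[symmetric]) (rule prod.cong, auto)
qed

lemma e2_lower:
  fixes x :: "nat \<Rightarrow> 'l::comm_ring_1"
  shows "(\<Sum>l<i. \<Sum>k<l. (x(j := x j - 1)) k * (x(j := x j - 1)) l)
    = (\<Sum>l<i. \<Sum>k<l. x k * x l) - (if j < i then (\<Sum>l<i. x l) - x j else 0)"
proof (induction i)
  case (Suc i)
  have row: "(\<Sum>k<i. (x(j := x j - 1)) k) = (\<Sum>k<i. x k) - (if j < i then 1 else 0)"
  proof -
    have "(\<Sum>k<i. (x(j := x j - 1)) k) = (\<Sum>k<i. x k - (if k = j then 1 else 0))"
      by (intro sum.cong) auto
    then show ?thesis by (simp add: sum_subtractf)
  qed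
  have "(\<Sum>k<i. (x(j := x j - 1)) k * (x(j := x j - 1)) i)
     = (\<Sum>k<i. x k * x i) - (if j < i then x i else if j = i then \<Sum>k<i. x k else 0)"
    unfolding sum_distrib_right[symmetric] row by (auto simp: algebra_simps)
  then show ?case
    unfolding sum.lessThan_Suc[of _ i] Suc.IH
    by (cases j i rule: linorder_cases) (auto simp: algebra_simps)
qed simp

lemma sum_lower:
  fixes x :: "nat \<Rightarrow> 'l::comm_ring_1"
  shows "finite S \<Longrightarrow> (\<Sum>k\<in>S. (x(j := x j - 1)) k) = (\<Sum>k\<in>S. x k) - (if j \<in> S then 1 else 0)"
proof -
  assume "finite S"
  have "(\<Sum>k\<in>S. (x(j := x j - 1)) k) = (\<Sum>k\<in>S. x k - (if k = j then 1 else 0))"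
    by (intro sum.cong) auto
  with \<open>finite S\<close> show ?thesis by (simp add: sum_subtractf)
qed

text \<open>
Lowering the entry \<open>j\<close> of row \<open>r\<close> of a pattern changes two of the exponents \<open>p\<^sub>i\<close>: the one with \<open>i = r + 1\<close>,
where row \<open>r\<close> is the second argument, and the one with \<open>i = r\<close>, where it is the first.
\<close>

lemma p_exp_lower_snd:
  fixes \<mu> \<nu> :: "nat \<Rightarrow> 'l::comm_ring_1"
  assumes "j \<le> r"
  shows "p_exp (Suc r) \<mu> (\<nu>(j := \<nu> j - 1)) = p_exp (Suc r) \<mu> \<nu>
    + of_nat r * ((\<Sum>k\<le>Suc r. \<mu> k) - (\<Sum>k\<le>r. \<nu> k) + 1 - \<nu> j) + of_nat (j * (Suc r - j))"
proof -
  let ?\<nu> = "\<nu>(j := \<nu> j - 1)"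
  have lin: "(\<Sum>k=1..<Suc r. of_nat (k * (Suc r - k)) * (?\<nu> k - \<mu> k))
    = (\<Sum>k=1..<Suc r. of_nat (k * (Suc r - k)) * (\<nu> k - \<mu> k)) - of_nat (j * (Suc r - j))"
  proof -
    have "(\<Sum>k=1..<Suc r. of_nat (k * (Suc r - k)) * (?\<nu> k - \<mu> k))
      = (\<Sum>k=1..<Suc r. of_nat (k * (Suc r - k)) * (\<nu> k - \<mu> k)
           - (if k = j then of_nat (k * (Suc r - k)) else 0))"
      by (intro sum.cong) (auto simp: algebra_simps)
    also have "\<dots> = (\<Sum>k=1..<Suc r. of_nat (k * (Suc r - k)) * (\<nu> k - \<mu> k))
        - (if j \<in> {1..<Suc r} then of_nat (j * (Suc r - j)) else 0)"
      unfolding sum_subtractf by (subst sum.delta) auto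
    finally show ?thesis using assms by (cases "j = 0") auto
  qed
  have s: "(\<Sum>k<Suc r. ?\<nu> k) = (\<Sum>k<Suc r. \<nu> k) - 1"
    using assms sum_lower[of "{..<Suc r}" \<nu> j] by auto
  show ?thesis
    unfolding p_exp_def lin s e2_lower
    using assms by (simp add: algebra_simps lessThan_Suc_atMost del: sum.lessThan_Suc sum.atMost_Suc)
qed

lemma p_exp_lower_fst:
  fixes \<mu> \<nu> :: "nat \<Rightarrow> 'l::comm_ring_1"
  assumes "j \<le> r"
  shows "p_exp r (\<mu>(j := \<mu> j - 1)) \<nu> = p_exp r \<mu> \<nu>
    + (of_nat r - 1) * ((\<Sum>k<r. \<nu> k) - (\<Sum>k\<le>r. \<mu> k) + \<mu> j) - of_nat (j * (r - j))"
proof -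
  let ?\<mu> = "\<mu>(j := \<mu> j - 1)"
  have lin: "(\<Sum>k=1..<r. of_nat (k * (r - k)) * (\<nu> k - ?\<mu> k))
    = (\<Sum>k=1..<r. of_nat (k * (r - k)) * (\<nu> k - \<mu> k)) + of_nat (j * (r - j))"
  proof -
    have "(\<Sum>k=1..<r. of_nat (k * (r - k)) * (\<nu> k - ?\<mu> k))
      = (\<Sum>k=1..<r. of_nat (k * (r - k)) * (\<nu> k - \<mu> k)
           + (if k = j then of_nat (k * (r - k)) else 0))"
      by (intro sum.cong) (auto simp: algebra_simps)
    also have "\<dots> = (\<Sum>k=1..<r. of_nat (k * (r - k)) * (\<nu> k - \<mu> k))
        + (if j \<in> {1..<r} then of_nat (j * (r - j)) else 0)"
      unfolding sum.distrib by (subst sum.delta) auto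
    finally show ?thesis using assms by (cases "j = 0 \<or> j = r") auto
  qed
  have s: "(\<Sum>k\<le>r. ?\<mu> k) = (\<Sum>k\<le>r. \<mu> k) - 1"
    using assms sum_lower[of "{..r}" \<mu> j] by auto
  have e2: "(\<Sum>l\<le>r. \<Sum>k<l. ?\<mu> k * ?\<mu> l) = (\<Sum>l\<le>r. \<Sum>k<l. \<mu> k * \<mu> l) - ((\<Sum>l\<le>r. \<mu> l) - \<mu> j)"
    using e2_lower[where i = "Suc r" and x = \<mu> and j = j] assms by (simp add: lessThan_Suc_atMost del: sum.lessThan_Suc sum.atMost_Suc)
  show ?thesis
    unfolding p_exp_def lin s e2 by (simp add: algebra_simps)
qed

context quantum_exponent
begin

lemma qint_neg: "x = - y \<Longrightarrow> qint vp x = - qint vp y"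
  using qint_minus by simp

lemma qpoch_shift: "qpoch vp (x + 1) k * qint vp x = qpoch vp x k * qint vp (x + of_nat k)"
  by (metis mult.commute qpoch_Suc qpoch_Suc_left)

text \<open>
The same change for \<open>A_square\<close>.  Pairs with \<open>l < j\<close> contribute telescoping quotients of \<open>qpoch\<close>, pairs with
\<open>j < l\<close> a single new factor; this is why the products below treat the two sides of \<open>j\<close> differently.  The
asymmetry disappears only in the product with \<open>A_square_lower_fst\<close>.
\<close>

lemma A_square_lower_snd:
  fixes \<mu> \<nu> :: "nat \<Rightarrow> 'l" and d :: "nat \<Rightarrow> nat" and j r :: nat
  defines "a \<equiv> \<lambda>l. \<nu> l - of_nat l" and "c \<equiv> \<lambda>l. \<mu> l - of_nat l"
  assumes j: "j \<le> r" and d: "\<And>k. k \<le> r \<Longrightarrow> \<mu> k - \<nu> k = of_nat (d k)"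
    and nz: "\<And>l. l < j \<Longrightarrow> qint vp (a l - a j + 1) \<noteq> 0"
            "\<And>l. j < l \<Longrightarrow> l \<le> r \<Longrightarrow> qint vp (a l - a j) \<noteq> 0"
    and nz': "\<And>l. l \<le> Suc r \<Longrightarrow> qint vp (c l - a j + 1) \<noteq> 0"
  shows "A_square vp (Suc r) \<mu> (\<nu>(j := \<nu> j - 1)) (d(j := Suc (d j)))
      * (\<Prod>l\<le>Suc r. qint vp (c l - a j + 1))
      * (\<Prod>l\<in>{..r} - {j}. if l < j then 1 else qint vp (a l - a j))
    = - A_square vp (Suc r) \<mu> \<nu> d * (\<Prod>l\<in>{..r} - {j}. if l < j then qint vp (a l - a j + 1) else 1)"
proof -
  let ?\<nu> = "\<nu>(j := \<nu> j - 1)" and ?d = "d(j := Suc (d j))"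
  define q where "q = qint vp"
  define P1 where "P1 d = (\<Prod>k<Suc r. qfact vp (d k))" for d :: "nat \<Rightarrow> nat"
  define P2 where "P2 \<nu> d = (\<Prod>l<Suc r. \<Prod>k<l. qpoch vp (\<nu> k - \<nu> l - of_nat k + of_nat l + 1) (d k))"
    for \<nu> :: "nat \<Rightarrow> 'l" and d :: "nat \<Rightarrow> nat"
  define P3 where "P3 \<nu> d = (\<Prod>l<Suc (Suc r). \<Prod>k<l. qpoch vp (\<nu> k - \<mu> l - of_nat k + of_nat l) (d k))"
    for \<nu> :: "nat \<Rightarrow> 'l" and d :: "nat \<Rightarrow> nat"
  have A: "A_square vp (Suc r) \<mu> \<nu> d = 1 / P1 d * (1 / P2 \<nu> d) * (1 / P3 \<nu> d)" for \<nu> d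
    unfolding A_square_def P1_def P2_def P3_def by (simp only: lessThan_Suc_atMost)
  have c_a: "c k - a k = of_nat (d k)" if "k \<le> r" for k
    using d[OF that] by (simp add: a_def c_def)
  have "P1 ?d = P1 d * q (of_nat (Suc (d j)))"
  proof -
    have "P1 ?d = (\<Prod>k<Suc r. qfact vp (d k) * (if k = j then q (of_nat (Suc (d j))) else 1))"
      unfolding P1_def q_def by (intro prod.cong) (auto simp: qfact_Suc)
    also have "\<dots> = P1 d * (\<Prod>k<Suc r. if k = j then q (of_nat (Suc (d j))) else 1)"
      unfolding P1_def prod.distrib ..
    finally show ?thesis using j by (subst (asm) prod.delta) auto
  qed
  moreover have "of_nat (Suc (d j)) = c j - a j + 1"
    using c_a[OF j] by simp
  ultimately have P1: "P1 ?d = P1 d * q (c j - a j + 1)" by (simp only:)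
  define s where "s k l = (if l = j then q (a k - a j + 1) else 1)" for k l
  define t where "t k l = (if l = j then q (c k - a j + 1) else if k = j then q (a j - a l) else 1)" for k l
  have "P2 ?\<nu> ?d * (\<Prod>l<Suc r. \<Prod>k<l. s k l) = P2 \<nu> d * (\<Prod>l<Suc r. \<Prod>k<l. t k l)"
    unfolding P2_def prod.distrib[symmetric]
  proof (intro prod.cong refl)
    fix l k assume l: "l \<in> {..<Suc r}" and k: "k \<in> {..<l}"
    consider "l = j" | "k = j" | "l \<noteq> j" "k \<noteq> j" by auto
    then show "qpoch vp (?\<nu> k - ?\<nu> l - of_nat k + of_nat l + 1) (?d k) * s k l
        = qpoch vp (\<nu> k - \<nu> l - of_nat k + of_nat l + 1) (d k) * t k l"
    proof cases
      case 1
      have eq: "\<nu> k - \<nu> l - of_nat k + of_nat l + 1 = a k - a j + 1"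
        using 1 by (simp add: a_def)
      have eq': "c k - a j + 1 = a k - a j + 1 + of_nat (d k)"
        using c_a[of k] l k by (simp add: algebra_simps)
      have eq'': "?\<nu> k - ?\<nu> l - of_nat k + of_nat l + 1 = a k - a j + 1 + 1"
        using 1 k by (simp add: a_def)
      have "?d k = d k" "s k l = q (a k - a j + 1)" "t k l = q (a k - a j + 1 + of_nat (d k))"
        using 1 k by (simp_all add: s_def t_def eq')
      then show ?thesis
        unfolding eq eq'' by (simp only: q_def qpoch_shift)
    next
      case 2
      have eq: "?\<nu> k - ?\<nu> l - of_nat k + of_nat l + 1 = a j - a l"
        using 2 k by (simp add: a_def)
      have eq': "\<nu> k - \<nu> l - of_nat k + of_nat l + 1 = a j - a l + 1"
        using 2 k by (simp add: a_def)
      show ?thesis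
        unfolding eq eq' using 2 k by (simp add: s_def t_def q_def qpoch_Suc_left)
    qed (simp add: s_def t_def)
  qed
  then have P2: "P2 ?\<nu> ?d * (\<Prod>l\<in>{..r} - {j}. if l < j then q (a l - a j + 1) else 1)
     = P2 \<nu> d * (\<Prod>l\<in>{..r} - {j}. if l < j then q (c l - a j + 1) else q (a j - a l))"
  proof (subst (asm) (1 2) prod_triangle_single_index[where j = j])
    assume *: "P2 ?\<nu> ?d * (\<Prod>l\<in>{..<Suc r} - {j}. if l < j then s l j else s j l) =
      P2 \<nu> d * (\<Prod>l\<in>{..<Suc r} - {j}. if l < j then t l j else t j l)"
    have "(\<Prod>l\<in>{..r} - {j}. if l < j then q (a l - a j + 1) else 1)
        = (\<Prod>l\<in>{..<Suc r} - {j}. if l < j then s l j else s j l)"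
      by (intro prod.cong) (auto simp: s_def)
    moreover have "(\<Prod>l\<in>{..r} - {j}. if l < j then q (c l - a j + 1) else q (a j - a l))
        = (\<Prod>l\<in>{..<Suc r} - {j}. if l < j then t l j else t j l)"
      by (intro prod.cong) (auto simp: t_def)
    ultimately show ?thesis using * by simp
  qed (use j in \<open>auto simp: s_def t_def\<close>)
  define w where "w k l = (if k = j then q (a j - 1 - c l) else 1)" for k l
  have "P3 ?\<nu> ?d = P3 \<nu> d * (\<Prod>l<Suc (Suc r). \<Prod>k<l. w k l)"
    unfolding P3_def prod.distrib[symmetric]
  proof (intro prod.cong refl)
    fix l k assume "l \<in> {..<Suc (Suc r)}" and k: "k \<in> {..<l}"
    show "qpoch vp (?\<nu> k - \<mu> l - of_nat k + of_nat l) (?d k)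
        = qpoch vp (\<nu> k - \<mu> l - of_nat k + of_nat l) (d k) * w k l"
    proof (cases "k = j")
      case True
      have eq: "?\<nu> k - \<mu> l - of_nat k + of_nat l = a j - 1 - c l"
        using True by (simp add: a_def c_def)
      have eq': "\<nu> k - \<mu> l - of_nat k + of_nat l = a j - 1 - c l + 1"
        using True by (simp add: a_def c_def)
      show ?thesis unfolding eq eq' using True by (simp add: w_def q_def qpoch_Suc_left)
    qed (simp add: w_def)
  qed
  then have P3: "P3 ?\<nu> ?d = P3 \<nu> d * (\<Prod>l\<in>{..Suc r} - {j}. if l < j then 1 else q (a j - 1 - c l))"
  proof (subst (asm) prod_triangle_single_index[where j = j])
    assume *: "P3 ?\<nu> ?d = P3 \<nu> d * (\<Prod>l\<in>{..<Suc (Suc r)} - {j}. if l < j then w l j else w j l)"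
    have "(\<Prod>l\<in>{..Suc r} - {j}. if l < j then 1 else q (a j - 1 - c l))
        = (\<Prod>l\<in>{..<Suc (Suc r)} - {j}. if l < j then w l j else w j l)"
      by (intro prod.cong) (auto simp: w_def)
    then show ?thesis using * by simp
  qed (use j in \<open>auto simp: w_def\<close>)
  \<comment> \<open>The sign is \<open>- 1\<close>: \<open>r - j\<close> factors are reversed in \<open>P2\<close> and \<open>Suc r - j\<close> in \<open>P3\<close>.\<close>
  have sgn2: "(\<Prod>l\<in>{..r} - {j}. if l < j then q (c l - a j + 1) else q (a j - a l))
    = (- 1) ^ (r - j) * (\<Prod>l\<in>{..r} - {j}. if l < j then q (c l - a j + 1) else 1)
        * (\<Prod>l\<in>{..r} - {j}. if l < j then 1 else q (a l - a j))"
  proof -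
    have "(- 1) ^ (r - j) = (\<Prod>l\<in>{..r} - {j}. if l < j then 1 else - 1 :: 'r)"
    proof -
      have "(\<Prod>l\<in>{..r} - {j}. if l < j then 1 else - 1 :: 'r) = (\<Prod>l\<in>{Suc j..r}. - 1)"
        by (intro prod.mono_neutral_cong_right) auto
      then show ?thesis by simp
    qed
    moreover have "q (a j - a l) = - q (a l - a j)" for l
      unfolding q_def by (rule qint_diff_commute)
    ultimately show ?thesis
      by (simp only: prod.distrib[symmetric]) (rule prod.cong, auto)
  qed
  have sgn3: "q (c j - a j + 1) * (\<Prod>l\<in>{..r} - {j}. if l < j then q (c l - a j + 1) else 1)
       * (\<Prod>l\<in>{..Suc r} - {j}. if l < j then 1 else q (a j - 1 - c l))
    = (- 1) ^ (Suc r - j) * (\<Prod>l\<le>Suc r. q (c l - a j + 1))"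
  proof -
    have "(- 1) ^ (Suc r - j) = (\<Prod>l\<in>{..Suc r} - {j}. if l < j then 1 else - 1 :: 'r)"
    proof -
      have "(\<Prod>l\<in>{..Suc r} - {j}. if l < j then 1 else - 1 :: 'r) = (\<Prod>l\<in>{Suc j..Suc r}. - 1)"
        by (intro prod.mono_neutral_cong_right) auto
      then show ?thesis by simp
    qed
    moreover have "(\<Prod>l\<in>{..r} - {j}. if l < j then q (c l - a j + 1) else 1)
        = (\<Prod>l\<in>{..Suc r} - {j}. if l < j then q (c l - a j + 1) else 1)"
      using j by (intro prod.mono_neutral_left) auto
    moreover have "(\<Prod>l\<le>Suc r. q (c l - a j + 1)) = q (c j - a j + 1) * (\<Prod>l\<in>{..Suc r} - {j}. q (c l - a j + 1))"
      using j by (intro prod.remove) auto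
    moreover have "q (a j - 1 - c l) = - q (c l - a j + 1)" for l
      unfolding q_def by (rule qint_neg) simp
    moreover have "(\<Prod>l\<in>{..Suc r} - {j}. if l < j then q (c l - a j + 1) else 1)
          * (\<Prod>l\<in>{..Suc r} - {j}. if l < j then 1 else - q (c l - a j + 1))
        = (\<Prod>l\<in>{..Suc r} - {j}. if l < j then 1 else - 1 :: 'r) * (\<Prod>l\<in>{..Suc r} - {j}. q (c l - a j + 1))"
      unfolding prod.distrib[symmetric] by (intro prod.cong) auto
    ultimately show ?thesis
      by (simp only: mult_ac)
  qed
  have sgn: "(- 1) ^ (r - j) * (- 1) ^ (Suc r - j) = (- 1 :: 'r)"
    using j by (simp add: Suc_diff_le power_add[symmetric] flip: mult_2)
  define X where "X = (\<Prod>l\<in>{..r} - {j}. if l < j then q (c l - a j + 1) else 1)"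
  define Y where "Y = (\<Prod>l\<in>{..r} - {j}. if l < j then 1 else q (a l - a j))"
  define Z where "Z = (\<Prod>l\<in>{..r} - {j}. if l < j then q (a l - a j + 1) else 1)"
  define C where "C = (\<Prod>l\<le>Suc r. q (c l - a j + 1))"
  define M where "M = (\<Prod>l\<in>{..Suc r} - {j}. if l < j then 1 else q (a j - 1 - c l))"
  have Z0: "Z \<noteq> 0" and C0: "C \<noteq> 0" and Y0: "Y \<noteq> 0"
    using nz nz' by (auto simp: Z_def C_def Y_def q_def)
  have P2': "P2 ?\<nu> ?d = P2 \<nu> d * ((- 1) ^ (r - j) * X * Y) / Z"
    using P2 Z0 unfolding sgn2 X_def[symmetric] Y_def[symmetric] Z_def[symmetric]
    by (simp add: field_simps)
  have "P1 ?d * P2 ?\<nu> ?d * P3 ?\<nu> ?d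
      = P1 d * P2 \<nu> d * P3 \<nu> d * ((- 1) ^ (r - j) * Y * (q (c j - a j + 1) * X * M)) / Z"
    unfolding P1 P2' P3 M_def[symmetric] by (simp add: field_simps)
  also have "q (c j - a j + 1) * X * M = (- 1) ^ (Suc r - j) * C"
    using sgn3 unfolding X_def M_def C_def .
  also have "(- 1) ^ (r - j) * Y * ((- 1) ^ (Suc r - j) * C) = ((- 1) ^ (r - j) * (- 1) ^ (Suc r - j)) * (Y * C)"
    by (simp only: mult_ac)
  finally have P: "P1 ?d * P2 ?\<nu> ?d * P3 ?\<nu> ?d = - (P1 d * P2 \<nu> d * P3 \<nu> d * (Y * C) / Z)"
    unfolding sgn by (simp only: mult_minus_left mult_1 mult_minus_right minus_divide_left)
  have "A_square vp (Suc r) \<mu> ?\<nu> ?d * C * Y = C * Y / (P1 ?d * P2 ?\<nu> ?d * P3 ?\<nu> ?d)"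
    unfolding A by simp
  also have "\<dots> = - (1 / (P1 d * P2 \<nu> d * P3 \<nu> d)) * Z"
    unfolding P using Z0 C0 Y0 by (simp add: divide_simps)
  also have "1 / (P1 d * P2 \<nu> d * P3 \<nu> d) = A_square vp (Suc r) \<mu> \<nu> d"
    unfolding A by simp
  finally show ?thesis unfolding C_def Y_def Z_def q_def .
qed

lemma A_square_lower_fst:
  fixes \<mu> \<nu> :: "nat \<Rightarrow> 'l" and d :: "nat \<Rightarrow> nat" and j r :: nat
  defines "b \<equiv> \<lambda>l. \<nu> l - of_nat l" and "a \<equiv> \<lambda>l. \<mu> l - of_nat l"
  assumes j: "j \<le> r" and d: "\<And>k. k < r \<Longrightarrow> \<mu> k - \<nu> k = of_nat (d k)" and dj: "j < r \<Longrightarrow> 0 < d j"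
    and nz: "\<And>l. l < j \<Longrightarrow> qint vp (a l - a j) \<noteq> 0"
            "\<And>l. j < l \<Longrightarrow> l \<le> r \<Longrightarrow> qint vp (a l - a j + 1) \<noteq> 0"
    and nz': "\<And>l. l < r \<Longrightarrow> qint vp (b l - a j) \<noteq> 0"
  shows "A_square vp r (\<mu>(j := \<mu> j - 1)) \<nu> (d(j := d j - 1))
      * (\<Prod>l\<in>{..r} - {j}. if l < j then qint vp (a l - a j) else 1)
    = A_square vp r \<mu> \<nu> d * (\<Prod>l<r. qint vp (b l - a j))
      * (\<Prod>l\<in>{..r} - {j}. if l < j then 1 else qint vp (a l - a j + 1))"
proof -
  let ?\<mu> = "\<mu>(j := \<mu> j - 1)" and ?d = "d(j := d j - 1)"
  define q where "q = qint vp"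
  define P1 where "P1 d = (\<Prod>k<r. qfact vp (d k))" for d :: "nat \<Rightarrow> nat"
  define P2 where "P2 d = (\<Prod>l<r. \<Prod>k<l. qpoch vp (\<nu> k - \<nu> l - of_nat k + of_nat l + 1) (d k))"
    for d :: "nat \<Rightarrow> nat"
  define P3 where "P3 \<mu> d = (\<Prod>l<Suc r. \<Prod>k<l. qpoch vp (\<nu> k - \<mu> l - of_nat k + of_nat l) (d k))"
    for \<mu> :: "nat \<Rightarrow> 'l" and d :: "nat \<Rightarrow> nat"
  have A: "A_square vp r \<mu> \<nu> d = 1 / P1 d * (1 / P2 d) * (1 / P3 \<mu> d)" for \<mu> d
    unfolding A_square_def P1_def P2_def P3_def by (simp only: lessThan_Suc_atMost)
  have a_b: "a k - b k = of_nat (d k)" if "k < r" for k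
    using d[OF that] by (simp add: a_def b_def)
  have dSuc: "d j = Suc (d j - 1)" if "j < r"
    using dj[OF that] by simp
  have qpoch_dj: "qpoch vp y (d j) = qpoch vp y (d j - 1) * qint vp (y + of_nat (d j - 1))" if "j < r" for y
    by (metis dSuc[OF that] qpoch_Suc)
  have P1: "P1 d = P1 ?d * (\<Prod>l<r. if l = j then q (a j - b l) else 1)"
    unfolding P1_def prod.distrib[symmetric]
  proof (intro prod.cong refl)
    fix k assume k: "k \<in> {..<r}"
    show "qfact vp (d k) = qfact vp (?d k) * (if k = j then q (a j - b k) else 1)"
    proof (cases "k = j")
      case True
      then have "qfact vp (d k) = qfact vp (d j - 1) * qint vp (of_nat (d j))"
        using dSuc k qfact_Suc[of "d j - 1"] by simp
      also have "of_nat (d j) = a j - b j" using a_b[of j] k True by simp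
      finally show ?thesis using True by (simp add: q_def)
    qed simp
  qed
  have P2: "P2 d = P2 ?d * (\<Prod>l<r. if j < l then q (a j - b l) else 1)"
  proof -
    have "P2 d = P2 ?d * (\<Prod>l<r. \<Prod>k<l. if k = j then q (a j - b l) else 1)"
      unfolding P2_def prod.distrib[symmetric]
    proof (intro prod.cong refl)
      fix l k assume l: "l \<in> {..<r}" and k: "k \<in> {..<l}"
      show "qpoch vp (\<nu> k - \<nu> l - of_nat k + of_nat l + 1) (d k)
        = qpoch vp (\<nu> k - \<nu> l - of_nat k + of_nat l + 1) (?d k) * (if k = j then q (a j - b l) else 1)"
      proof (cases "k = j")
        case True
        have jr: "j < r" using l k True by simp
        have "of_nat (Suc (d j - 1)) = a j - b j"
          using a_b[OF jr] dSuc[OF jr] by simp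
        then have "\<nu> k - \<nu> l - of_nat k + of_nat l + 1 + of_nat (d j - 1) = a j - b l"
          using True by (simp add: b_def algebra_simps)
        then show ?thesis
          using True qpoch_dj[OF jr, of "\<nu> k - \<nu> l - of_nat k + of_nat l + 1"] by (simp add: q_def)
      qed simp
    qed
    then show ?thesis by simp
  qed
  define s where "s k l = (if l = j then q (b k - a j) else if k = j then q (a j - 1 - a l) else 1)" for k l
  define t where "t k l = (if l = j then q (a k - a j) else 1)" for k l
  have "P3 \<mu> d * (\<Prod>l<Suc r. \<Prod>k<l. t k l) = P3 ?\<mu> ?d * (\<Prod>l<Suc r. \<Prod>k<l. s k l)"
    unfolding P3_def prod.distrib[symmetric]
  proof (intro prod.cong refl)
    fix l k assume l: "l \<in> {..<Suc r}" and k: "k \<in> {..<l}"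
    consider "l = j" | "k = j" | "l \<noteq> j" "k \<noteq> j" by auto
    then show "qpoch vp (\<nu> k - \<mu> l - of_nat k + of_nat l) (d k) * t k l
        = qpoch vp (\<nu> k - ?\<mu> l - of_nat k + of_nat l) (?d k) * s k l"
    proof cases
      case 1
      have eq: "\<nu> k - \<mu> l - of_nat k + of_nat l = b k - a j"
        using 1 by (simp add: a_def b_def)
      have eq': "\<nu> k - ?\<mu> l - of_nat k + of_nat l = b k - a j + 1"
        using 1 by (simp add: a_def b_def)
      have "a k - a j = b k - a j + of_nat (d k)"
        using a_b[of k] l k by (simp add: algebra_simps)
      then have "?d k = d k" "s k l = q (b k - a j)" "t k l = q (b k - a j + of_nat (d k))"
        using 1 k by (simp_all add: s_def t_def algebra_simps)
      then show ?thesis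
        unfolding eq eq' by (simp only: q_def qpoch_shift)
    next
      case 2
      have jr: "j < r" using l k 2 by simp
      have lj: "l \<noteq> j" using k 2 by simp
      have "of_nat (Suc (d j - 1)) = a j - b j"
        using a_b[OF jr] dSuc[OF jr] by simp
      then have "\<nu> k - \<mu> l - of_nat k + of_nat l + of_nat (d j - 1) = a j - 1 - a l"
        using 2 by (simp add: a_def b_def algebra_simps)
      then show ?thesis
        using 2 lj qpoch_dj[OF jr, of "\<nu> k - \<mu> l - of_nat k + of_nat l"] by (simp add: q_def s_def t_def)
    qed (simp add: s_def t_def)
  qed
  then have P3: "P3 \<mu> d * (\<Prod>l\<in>{..r} - {j}. if l < j then q (a l - a j) else 1)
     = P3 ?\<mu> ?d * (\<Prod>l\<in>{..r} - {j}. if l < j then q (b l - a j) else q (a j - 1 - a l))"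
  proof (subst (asm) (1 2) prod_triangle_single_index[where j = j])
    assume *: "P3 \<mu> d * (\<Prod>l\<in>{..<Suc r} - {j}. if l < j then t l j else t j l) =
      P3 ?\<mu> ?d * (\<Prod>l\<in>{..<Suc r} - {j}. if l < j then s l j else s j l)"
    have "(\<Prod>l\<in>{..r} - {j}. if l < j then q (a l - a j) else 1)
        = (\<Prod>l\<in>{..<Suc r} - {j}. if l < j then t l j else t j l)"
      by (intro prod.cong) (auto simp: t_def)
    moreover have "(\<Prod>l\<in>{..r} - {j}. if l < j then q (b l - a j) else q (a j - 1 - a l))
        = (\<Prod>l\<in>{..<Suc r} - {j}. if l < j then s l j else s j l)"
      by (intro prod.cong) (auto simp: s_def)
    ultimately show ?thesis using * by simp
  qed (use j in \<open>auto simp: s_def t_def\<close>)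
  have sgn: "(\<Prod>l<r. if l = j then q (a j - b l) else 1) * (\<Prod>l<r. if j < l then q (a j - b l) else 1)
      * (\<Prod>l\<in>{..r} - {j}. if l < j then q (b l - a j) else q (a j - 1 - a l))
    = (\<Prod>l<r. q (b l - a j)) * (\<Prod>l\<in>{..r} - {j}. if l < j then 1 else q (a l - a j + 1))"
  proof -
    have neg: "q (a j - b l) = - q (b l - a j)" "q (a j - 1 - a l) = - q (a l - a j + 1)" for l
      unfolding q_def by (rule qint_neg, simp)+
    define g :: 'r where "g = (- 1) ^ (r - j)"
    define U where "U = (\<Prod>l<r. if l < j then 1 else q (b l - a j))"
    define V where "V = (\<Prod>l<r. if l < j then q (b l - a j) else 1)"
    define D where "D = (\<Prod>l\<in>{..r} - {j}. if l < j then 1 else q (a l - a j + 1))"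
    have g1: "(\<Prod>l<r. if l < j then 1 else - 1 :: 'r) = g"
    proof -
      have "(\<Prod>l<r. if l < j then 1 else - 1 :: 'r) = (\<Prod>l\<in>{j..<r}. - 1)"
        by (intro prod.mono_neutral_cong_right) auto
      then show ?thesis by (simp add: g_def)
    qed
    have g2: "(\<Prod>l\<in>{..r} - {j}. if l < j then 1 else - 1 :: 'r) = g"
    proof -
      have "(\<Prod>l\<in>{..r} - {j}. if l < j then 1 else - 1 :: 'r) = (\<Prod>l\<in>{Suc j..r}. - 1)"
        by (intro prod.mono_neutral_cong_right) auto
      then show ?thesis by (simp add: g_def)
    qed
    have e1: "(\<Prod>l<r. if l = j then q (a j - b l) else 1) * (\<Prod>l<r. if j < l then q (a j - b l) else 1)
        = U * g"
      unfolding U_def g1[symmetric] prod.distrib[symmetric] neg by (intro prod.cong) auto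
    have "(\<Prod>l\<in>{..r} - {j}. if l < j then q (b l - a j) else q (a j - 1 - a l))
        = (\<Prod>l\<in>{..r} - {j}. if l < j then q (b l - a j) else 1) * D * g"
      unfolding D_def g2[symmetric] prod.distrib[symmetric] neg by (intro prod.cong) auto
    also have "(\<Prod>l\<in>{..r} - {j}. if l < j then q (b l - a j) else 1) = V"
      unfolding V_def using j by (intro prod.mono_neutral_cong) auto
    finally have e2: "(\<Prod>l\<in>{..r} - {j}. if l < j then q (b l - a j) else q (a j - 1 - a l)) = V * D * g" .
    have "g * g = 1"
      by (simp add: g_def flip: power_mult_distrib)
    then have "U * g * (V * D * g) = U * V * D"
      by (simp add: mult_ac)
    also have "U * V = (\<Prod>l<r. q (b l - a j))"
      unfolding U_def V_def prod.distrib[symmetric] by (intro prod.cong) auto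
    finally show ?thesis unfolding e1 e2 D_def .
  qed
  define X where "X = (\<Prod>l\<in>{..r} - {j}. if l < j then q (a l - a j) else 1)"
  define Y where "Y = (\<Prod>l<r. q (b l - a j)) * (\<Prod>l\<in>{..r} - {j}. if l < j then 1 else q (a l - a j + 1))"
  have X0: "X \<noteq> 0" and Y0: "Y \<noteq> 0"
    using nz nz' by (auto simp: X_def Y_def q_def)
  have "P1 d * P2 d * (P3 \<mu> d * X) = P1 ?d * P2 ?d * P3 ?\<mu> ?d * Y"
    unfolding P1 P2 X_def P3 Y_def sgn[symmetric] by (simp only: mult_ac)
  then have P: "P1 d * P2 d * P3 \<mu> d = P1 ?d * P2 ?d * P3 ?\<mu> ?d * Y / X"
    using X0 by (simp add: field_simps)
  have "A_square vp r \<mu> \<nu> d = 1 / (P1 d * P2 d * P3 \<mu> d)"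
    unfolding A by simp
  then have "A_square vp r \<mu> \<nu> d * Y = A_square vp r ?\<mu> \<nu> ?d * X"
    unfolding P using Y0 by (simp add: A)
  then show ?thesis unfolding X_def Y_def q_def by (simp only: mult.assoc)
qed

lemma A_square_cong:
  assumes "\<And>k. k \<le> i \<Longrightarrow> \<mu> k = \<mu>' k" "\<And>k. k < i \<Longrightarrow> \<nu> k = \<nu>' k" "\<And>k. k < i \<Longrightarrow> d k = d' k"
  shows "A_square vp i \<mu> \<nu> d = A_square vp i \<mu>' \<nu>' d'"
proof -
  have "(\<Prod>k<i. qfact vp (d k)) = (\<Prod>k<i. qfact vp (d' k))"
    using assms by (intro prod.cong) auto
  moreover have "(\<Prod>l<i. \<Prod>k<l. qpoch vp (\<nu> k - \<nu> l - of_nat k + of_nat l + 1) (d k))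
      = (\<Prod>l<i. \<Prod>k<l. qpoch vp (\<nu>' k - \<nu>' l - of_nat k + of_nat l + 1) (d' k))"
    using assms by (intro prod.cong) auto
  moreover have "(\<Prod>l\<le>i. \<Prod>k<l. qpoch vp (\<nu> k - \<mu> l - of_nat k + of_nat l) (d k))
      = (\<Prod>l\<le>i. \<Prod>k<l. qpoch vp (\<nu>' k - \<mu>' l - of_nat k + of_nat l) (d' k))"
    using assms by (intro prod.cong) auto
  ultimately show ?thesis by (simp only: A_square_def)
qed

end

lemma p_exp_cong:
  assumes "\<And>k. k \<le> i \<Longrightarrow> \<mu> k = \<mu>' k" "\<And>k. k < i \<Longrightarrow> \<nu> k = \<nu>' k"
  shows "p_exp i \<mu> \<nu> = p_exp i \<mu>' \<nu>'"
proof -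
  have "(\<Sum>k<i. \<nu> k) = (\<Sum>k<i. \<nu>' k)" "(\<Sum>k\<le>i. \<mu> k) = (\<Sum>k\<le>i. \<mu>' k)"
    using assms by (auto intro!: sum.cong)
  moreover have "(\<Sum>l<i. \<Sum>k<l. \<nu> k * \<nu> l) = (\<Sum>l<i. \<Sum>k<l. \<nu>' k * \<nu>' l)"
    using assms by (intro sum.cong) auto
  moreover have "(\<Sum>l\<le>i. \<Sum>k<l. \<mu> k * \<mu> l) = (\<Sum>l\<le>i. \<Sum>k<l. \<mu>' k * \<mu>' l)"
    using assms by (intro sum.cong) auto
  moreover have "(\<Sum>k=1..<i. of_nat (k * (i - k)) * (\<nu> k - \<mu> k)) = (\<Sum>k=1..<i. of_nat (k * (i - k)) * (\<nu>' k - \<mu>' k))"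
    using assms by (intro sum.cong) auto
  ultimately show ?thesis by (simp only: p_exp_def)
qed

section \<open>Moves of Gelfand patterns\<close>

lemma shift_apply: "shift d k r m l s = (if l = k \<and> s = r then m l s - d else m l s)"
  by (simp add: shift_def)

lemma shift_shift: "d + d' = 0 \<Longrightarrow> shift d k r (shift d' k r m) = m"
  by (auto simp: shift_def fun_eq_iff)

lemma shift_commute: "shift d k r (shift d' l s m) = shift d' l s (shift d k r m)"
  by (auto simp: shift_def fun_eq_iff)

lemma shift_back [simp]:
  "shift 1 k r (shift (- 1) k r m) = m" "shift (- 1) k r (shift 1 k r m) = m"
  by (simp_all add: shift_shift)

lemma pattern_outside: "m \<in> patterns n \<Longrightarrow> \<not> (k \<le> i \<and> i < n) \<Longrightarrow> m k i = 0"
  by (simp add: patterns_def)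

lemma pattern_step: "m \<in> patterns n \<Longrightarrow> k \<le> i \<Longrightarrow> i < n \<Longrightarrow> m k (Suc i) \<le> m k i"
  by (simp add: patterns_def)

lemma pattern_antimono:
  assumes "m \<in> patterns n" "k \<le> i" "i \<le> j" "j \<le> n"
  shows "m k j \<le> m k i"
  using assms(3,4)
proof (induction j rule: dec_induct)
  case (step j)
  then show ?case using pattern_step[OF assms(1), of k j] assms(2) by simp
qed simp

lemma pattern_nonneg:
  assumes "m \<in> patterns n" shows "0 \<le> m k i"
proof (cases "k \<le> i \<and> i < n")
  case True
  then show ?thesis using pattern_antimono[OF assms, of k i n] pattern_outside[OF assms, of k n] by simp
qed (simp add: pattern_outside[OF assms])

lemma zero_pattern: "(\<lambda>k i. 0) \<in> patterns n"
  by (simp add: patterns_def)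

definition removable :: "nat \<Rightarrow> pattern \<Rightarrow> nat \<Rightarrow> nat \<Rightarrow> bool" where
  "removable n m k r \<longleftrightarrow> k \<le> r \<and> r < n \<and> m k (Suc r) < m k r"

lemma removable_raise:
  assumes "m \<in> patterns n" "removable n m k r"
  shows "shift 1 k r m \<in> patterns n"
proof -
  have "shift 1 k r m l (Suc s) \<le> shift 1 k r m l s" if "l \<le> s" "s < n" for l s
    using pattern_step[OF assms(1) that] assms(2) that by (auto simp: shift_apply removable_def)
  then show ?thesis
    using assms by (auto simp: patterns_def shift_apply removable_def)
qed

lemma raise_removable:
  assumes "m \<in> patterns n" "shift 1 k r m \<in> patterns n" "k \<le> r" "r < n"
  shows "removable n m k r"
  using pattern_step[OF assms(2), of k r] assms(3,4) by (simp add: removable_def shift_apply)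

lemma lower_removable:
  assumes "m \<in> patterns n" "shift (- 1) k r m \<in> patterns n" "k \<le> r" "r < n"
  shows "removable n (shift (- 1) k r m) k r"
  using assms by (intro raise_removable) simp_all

lemma lower_pattern_iff:
  assumes "m \<in> patterns n" "k \<le> r" "r < n"
  shows "shift (- 1) k r m \<in> patterns n \<longleftrightarrow> (k < r \<longrightarrow> m k r < m k (r - 1))"
proof
  assume *: "shift (- 1) k r m \<in> patterns n"
  show "k < r \<longrightarrow> m k r < m k (r - 1)"
  proof
    assume "k < r"
    then have "r - Suc 0 \<noteq> r" "Suc (r - 1) = r" "k \<le> r - 1" "r - 1 < n" using assms(3) by simp_all
    then show "m k r < m k (r - 1)"
      using pattern_step[OF *, of k "r - 1"] by (simp add: shift_apply)
  qed
next
  assume *: "k < r \<longrightarrow> m k r < m k (r - 1)"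
  have "shift (- 1) k r m l (Suc s) \<le> shift (- 1) k r m l s" if "l \<le> s" "s < n" for l s
    using pattern_step[OF assms(1) that] * that by (auto simp: shift_apply)
  then show "shift (- 1) k r m \<in> patterns n"
    using assms by (auto simp: patterns_def shift_apply)
qed

lemma removable_other:
  assumes "m \<in> patterns n" "removable n m k r" "removable n m l s" "(k, r) \<noteq> (l, s)"
  shows "removable n (shift 1 k r m) l s"
  using assms unfolding removable_def shift_apply by auto

text \<open>
If \<open>m k\<close> is not zero, then its last nonzero value can be diminished.
\<close>

lemma nonzero_pattern_removable:
  assumes m: "m \<in> patterns n" and "m \<noteq> (\<lambda>k i. 0)"
  shows "\<exists>k r. removable n m k r"
proof (rule ccontr)
  assume none: "\<nexists>k r. removable n m k r"
  have "m k i = 0" for k i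
  proof (cases "k \<le> i \<and> i < n")
    case True
    then have "i \<le> n" by simp
    then show "m k i = 0" using True
    proof (induction i rule: inc_induct)
      case (step i)
      have "m k (Suc i) = 0"
        using step pattern_outside[OF m, of k "Suc i"] by (cases "Suc i < n") auto
      moreover have "\<not> removable n m k i" using none by blast
      ultimately show ?case
        using step pattern_step[OF m, of k i] pattern_nonneg[OF m, of k i] by (auto simp: removable_def)
    qed simp
  qed (simp add: pattern_outside[OF m])
  with assms(2) show False by (simp add: fun_eq_iff)
qed

lemma ht_shift:
  assumes "k \<le> r" "r < n"
  shows "ht n (shift d k r m) = ht n m - d"
proof -
  have inner: "(\<Sum>l\<le>i. shift d k r m l i - shift d k r m l n)
      = (\<Sum>l\<le>i. m l i - m l n) - (if i = r then d else 0)" if "i < n" for i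
  proof -
    have "(\<Sum>l\<le>i. shift d k r m l i - shift d k r m l n)
        = (\<Sum>l\<le>i. (m l i - m l n) - (if l = k then if i = r then d else 0 else 0))"
      using assms that by (intro sum.cong) (auto simp: shift_apply)
    also have "\<dots> = (\<Sum>l\<le>i. m l i - m l n) - (\<Sum>l\<le>i. if l = k then if i = r then d else 0 else 0)"
      by (rule sum_subtractf)
    also have "(\<Sum>l\<le>i. if l = k then if i = r then d else 0 else 0) = (if i = r then d else 0)"
      using assms by auto
    finally show ?thesis .
  qed
  have "ht n (shift d k r m) = (\<Sum>i<n. (\<Sum>l\<le>i. m l i - m l n) - (if i = r then d else 0))"
    unfolding ht_def using inner by (intro sum.cong) auto
  then show ?thesis using assms by (simp add: ht_def sum_subtractf)
qed

lemma ht_nonneg: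
  assumes "m \<in> patterns n" shows "0 \<le> ht n m"
  unfolding ht_def using pattern_nonneg[OF assms] pattern_outside[OF assms, of _ n]
  by (intro sum_nonneg) simp

lemma ht_eq_0:
  assumes m: "m \<in> patterns n" and "ht n m = 0"
  shows "m = (\<lambda>k i. 0)"
proof (rule ccontr)
  assume "m \<noteq> (\<lambda>k i. 0)"
  then obtain k r where kr: "removable n m k r"
    using nonzero_pattern_removable[OF m] by blast
  have "0 \<le> ht n (shift 1 k r m)"
    by (rule ht_nonneg[OF removable_raise[OF m kr]])
  with kr assms(2) show False by (simp add: ht_shift removable_def)
qed

text \<open>
A function with prescribed ratios along the moves exists as soon as the two ways around each square of moves
agree: two removable cells can be removed in either order, so any two descending paths to the top pattern are
connected through such squares.
\<close>

lemma pattern_potential: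
  fixes g :: "nat \<Rightarrow> nat \<Rightarrow> pattern \<Rightarrow> 'a::comm_monoid_mult"
  assumes square: "\<And>m k r l s. m \<in> patterns n \<Longrightarrow> removable n m k r \<Longrightarrow> removable n m l s \<Longrightarrow>
      (k, r) \<noteq> (l, s) \<Longrightarrow> g k r m * g l s (shift 1 k r m) = g l s m * g k r (shift 1 l s m)"
  shows "\<exists>y. y (\<lambda>k i. 0) = y0 \<and>
    (\<forall>m\<in>patterns n. \<forall>k r. removable n m k r \<longrightarrow> y m = g k r m * y (shift 1 k r m))"
proof -
  define sel where "sel m = (SOME kr. removable n m (fst kr) (snd kr))" for m
  have sel: "removable n m (fst (sel m)) (snd (sel m))" if "removable n m k r" for m k r
    unfolding sel_def by (rule someI[of _ "(k, r)"]) (use that in simp)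
  define Y where "Y = rec_nat (\<lambda>m. y0) (\<lambda>_ Y m. g (fst (sel m)) (snd (sel m)) m * Y (shift 1 (fst (sel m)) (snd (sel m)) m))"
  define y where "y m = Y (nat (ht n m)) m" for m
  have Y_Suc: "Y (Suc N) m = g (fst (sel m)) (snd (sel m)) m * Y N (shift 1 (fst (sel m)) (snd (sel m)) m)" for N m
    by (simp add: Y_def)
  have y_sel: "y m = g (fst (sel m)) (snd (sel m)) m * y (shift 1 (fst (sel m)) (snd (sel m)) m)"
    if m: "m \<in> patterns n" and "removable n m k r" for m k r
  proof -
    define m' where "m' = shift 1 (fst (sel m)) (snd (sel m)) m"
    have "m' \<in> patterns n"
      unfolding m'_def using removable_raise[OF m sel[OF that(2)]] .
    then have "nat (ht n m) = Suc (nat (ht n m'))"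
      using sel[OF that(2)] ht_nonneg[of m' n] by (simp add: m'_def ht_shift removable_def)
    then show ?thesis unfolding y_def m'_def[symmetric] by (simp add: Y_Suc m'_def)
  qed
  have step: "y m = g k r m * y (shift 1 k r m)"
    if "m \<in> patterns n" "removable n m k r" "nat (ht n m) = N" for m k r N
    using that
  proof (induction N arbitrary: m k r)
    case 0
    then have "m = (\<lambda>k i. 0)" using ht_eq_0 ht_nonneg[of m n] by simp
    with 0 show ?case by (simp add: removable_def)
  next
    case (Suc N)
    obtain l s where ls: "sel m = (l, s)" by (cases "sel m")
    have rls: "removable n m l s" using sel[OF Suc.prems(2)] ls by simp
    have ym: "y m = g l s m * y (shift 1 l s m)"
      using y_sel[OF Suc.prems(1,2)] ls by simp
    show ?case
    proof (cases "(k, r) = (l, s)")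
      case False
      have N: "nat (ht n (shift 1 k r m)) = N" "nat (ht n (shift 1 l s m)) = N"
        using Suc.prems rls by (auto simp: ht_shift removable_def)
      have "y (shift 1 l s m) = g k r (shift 1 l s m) * y (shift 1 k r (shift 1 l s m))"
        using Suc.prems rls N False
        by (intro Suc.IH) (auto intro: removable_raise removable_other)
      moreover have "y (shift 1 k r m) = g l s (shift 1 k r m) * y (shift 1 l s (shift 1 k r m))"
        using Suc.prems rls N False
        by (intro Suc.IH) (auto intro: removable_raise removable_other)
      ultimately show ?thesis
        using square[OF Suc.prems(1,2) rls False]
        by (simp add: ym mult.assoc[symmetric] shift_commute[of 1 l s 1 k r])
    qed (use ym in simp)
  qed
  have "y (\<lambda>k i. 0) = y0"
    by (simp add: y_def Y_def ht_def)
  with step show ?thesis by blast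
qed

section \<open>Weights of patterns\<close>

text \<open>
The ket of \<open>m\<close> has weight \<open>\<lambda> - \<Sum>\<^sub>i pattern_degree n m i \<alpha>\<^sub>i\<close> (\<open>pattern_weight_eq\<close>).
\<close>

definition pattern_degree :: "nat \<Rightarrow> pattern \<Rightarrow> nat \<Rightarrow> nat" where
  "pattern_degree n m i = nat (\<Sum>k<i. m k (i - 1))"

lemma int_pattern_degree:
  assumes "m \<in> patterns n"
  shows "int (pattern_degree n m i) = (\<Sum>k<i. m k (i - 1))"
  unfolding pattern_degree_def using pattern_nonneg[OF assms] by (simp add: sum_nonneg)

lemma pattern_degree_Qplus:
  assumes "m \<in> patterns n" shows "pattern_degree n m \<in> Qplus n"
  unfolding Qplus_def
proof (intro CollectI allI impI)
  fix i assume "i \<notin> {1..n}"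
  have "m k (i - 1) = 0" if "k < i" for k
  proof -
    have "n < i" using \<open>i \<notin> {1..n}\<close> that by simp
    then have "\<not> i - 1 < n" by linarith
    then show ?thesis by (simp add: pattern_outside[OF assms])
  qed
  then show "pattern_degree n m i = 0"
    unfolding pattern_degree_def by (subst sum.neutral) auto
qed

lemma pattern_degree_shift:
  assumes "m \<in> patterns n" "shift (- 1) k r m \<in> patterns n" "k \<le> r"
  shows "pattern_degree n (shift (- 1) k r m) = (pattern_degree n m)(Suc r := Suc (pattern_degree n m (Suc r)))"
proof
  fix i
  have "(\<Sum>l<i. shift (- 1) k r m l (i - 1)) = (\<Sum>l<i. m l (i - 1) + (if l = k then if i = Suc r then 1 else 0 else 0))"
    by (intro sum.cong) (auto simp: shift_apply)
  also have "\<dots> = (\<Sum>l<i. m l (i - 1)) + (if i = Suc r then 1 else 0)"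
    unfolding sum.distrib using assms(3) by auto
  finally have "int (pattern_degree n (shift (- 1) k r m) i) = int (((pattern_degree n m)(Suc r := Suc (pattern_degree n m (Suc r)))) i)"
    using assms by (auto simp: int_pattern_degree)
  then show "pattern_degree n (shift (- 1) k r m) i = ((pattern_degree n m)(Suc r := Suc (pattern_degree n m (Suc r)))) i"
    by simp
qed

lemma qcoord_eq:
  assumes "\<beta> \<in> Qplus n"
  shows "qcoord n \<beta> j = (of_nat (\<beta> (Suc j)) - of_nat (\<beta> j) :: 'l::comm_ring_1)"
proof -
  have out: "\<beta> i = 0" if "i \<notin> {1..n}" for i using assms that by (simp add: Qplus_def)
  have "qcoord n \<beta> j = (\<Sum>i=1..n. (if i = Suc j then of_nat (\<beta> i) else 0) - (if i = j then of_nat (\<beta> i) else 0) :: 'l)"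
    unfolding qcoord_def by (intro sum.cong) (auto simp: alpha_def)
  also have "\<dots> = of_nat (\<beta> (Suc j)) - of_nat (\<beta> j)"
    unfolding sum_subtractf using out[of j] out[of "Suc j"] by auto
  finally show ?thesis .
qed

lemma pattern_weight_eq:
  fixes lam :: "nat \<Rightarrow> 'l::comm_ring_1"
  assumes m: "m \<in> patterns n"
  shows "pattern_weight lam m j = lam j - qcoord n (pattern_degree n m) j"
proof -
  have h: "hsum lam m j = (\<Sum>k\<le>j. lam k) - of_nat (pattern_degree n m (Suc j))" for j
  proof -
    have "of_nat (pattern_degree n m (Suc j)) = (of_int (int (pattern_degree n m (Suc j))) :: 'l)" by simp
    then show ?thesis
      unfolding int_pattern_degree[OF m] by (simp add: hsum_def entry_def sum_subtractf lessThan_Suc_atMost del: sum.lessThan_Suc of_int_of_nat_eq)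
  qed
  show ?thesis
  proof (cases j)
    case 0
    then show ?thesis by (simp add: pattern_weight_def h qcoord_eq pattern_degree_Qplus[OF m] pattern_degree_def)
  next
    case (Suc i)
    then show ?thesis by (simp add: pattern_weight_def h qcoord_eq pattern_degree_Qplus[OF m])
  qed
qed

lemma patterns_at_eq:
  fixes lam :: "nat \<Rightarrow> 'l::{comm_ring_1, ring_char_0}"
  assumes \<beta>: "\<beta> \<in> Qplus n"
  shows "patterns_at n lam \<beta> = {m \<in> patterns n. pattern_degree n m = \<beta>}"
proof -
  have "pattern_degree n m = \<beta>" if m: "m \<in> patterns n" and w: "\<And>j. j \<le> n \<Longrightarrow> pattern_weight lam m j = lam j - qcoord n \<beta> j" for m
  proof -
    have eq: "pattern_degree n m j = \<beta> j" if "j \<le> Suc n" for j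
      using that
    proof (induction j)
      case 0
      then show ?case using pattern_degree_Qplus[OF m] \<beta> by (simp add: Qplus_def)
    next
      case (Suc j)
      have "(of_nat (pattern_degree n m (Suc j)) :: 'l) - of_nat (pattern_degree n m j) = of_nat (\<beta> (Suc j)) - of_nat (\<beta> j)"
        using w[of j] Suc.prems unfolding pattern_weight_eq[OF m] qcoord_eq[OF pattern_degree_Qplus[OF m]] qcoord_eq[OF \<beta>]
        by (metis Suc_le_mono add_diff_cancel_left' diff_add_cancel)
      with Suc have "(of_nat (pattern_degree n m (Suc j)) :: 'l) = of_nat (\<beta> (Suc j))" by simp
      then show ?case by (simp only: of_nat_eq_iff)
    qed
    show ?thesis
    proof
      fix j show "pattern_degree n m j = \<beta> j"
        using eq[of j] pattern_degree_Qplus[OF m] \<beta> by (cases "j \<le> n") (auto simp: Qplus_def)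
    qed
  qed
  then show ?thesis
    by (auto simp: patterns_at_def pattern_weight_eq)
qed

lemma finite_patterns_pattern_degree: "finite {m \<in> patterns n. pattern_degree n m = \<beta>}"
proof -
  define M where "M = int (Max (\<beta> ` {..n}))"
  define S where "S = {f. \<forall>x. (x \<in> {..n} \<times> {..n} \<longrightarrow> f x \<in> {0..M}) \<and> (x \<notin> {..n} \<times> {..n} \<longrightarrow> f x = (0::int))}"
  have "finite S"
    unfolding S_def by (intro finite_set_of_finite_funs) auto
  moreover have "m \<in> curry ` S" if m: "m \<in> patterns n" and c: "pattern_degree n m = \<beta>" for m
  proof
    have bound: "m k i \<le> M" if "k \<le> i" "i < n" for k i
    proof -
      have "m k i \<le> (\<Sum>k<Suc i. m k (Suc i - 1))"
        using that pattern_nonneg[OF m] by (simp only: diff_Suc_1) (intro member_le_sum, auto)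
      also have "\<dots> = int (\<beta> (Suc i))"
        using int_pattern_degree[OF m, of "Suc i"] c by simp
      also have "\<dots> \<le> M"
        unfolding M_def using that by (intro of_nat_mono Max_ge) auto
      finally show ?thesis .
    qed
    have "0 \<le> M" by (simp add: M_def)
    have bound': "m k i \<le> M" for k i
      using bound[of k i] pattern_outside[OF m, of k i] \<open>0 \<le> M\<close> by (cases "k \<le> i \<and> i < n") auto
    have outside: "m k i = 0" if "(k, i) \<notin> {..n} \<times> {..n}" for k i
      using pattern_outside[OF m, of k i] that by auto
    show "case_prod m \<in> S"
      unfolding S_def using bound' pattern_nonneg[OF m] outside by auto
  qed simp
  ultimately show ?thesis
    by (rule_tac finite_subset[of _ "curry ` S"]) auto
qed

text \<open>
Injectivity of the Cartan matrix: a sequence with vanishing second differences is linear, and it vanishes at both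
ends.  This recovers \<open>\<beta>\<close> from the eigenvalues of the \<open>K\<^sub>i\<close> alone.
\<close>

lemma cartan_injective:
  fixes d :: "nat \<Rightarrow> int"
  assumes "d 0 = 0" "d (Suc n) = 0" and rec: "\<And>i. 1 \<le> i \<Longrightarrow> i \<le> n \<Longrightarrow> 2 * d i = d (i - 1) + d (Suc i)"
    and "i \<le> Suc n"
  shows "d i = 0"
proof -
  have lin: "d i = int i * d 1 \<and> d (Suc i) = int (Suc i) * d 1" if "i \<le> n" for i
    using that
  proof (induction i)
    case (Suc i)
    then show ?case using rec[of "Suc i"] by (simp add: algebra_simps)
  qed (simp add: assms)
  from lin[of n] have "d 1 = 0" using assms(2) by simp
  then show ?thesis using lin[of "i - 1"] assms(1,4) by (cases i) auto
qed

section \<open>Action of the free algebra\<close>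

lemma letter_times_single [simp]:
  "letter g * Poly_Mapping.single w a = Poly_Mapping.single (Word [g] + w) (a :: 'r::field)"
  by (simp add: letter_def mult_single)

lemma word_plus [simp]: "Word xs + Word ys = Word (xs @ ys)"
  by (simp add: plus_word_def)

lemma scalar_times_single: "scalar (k :: 'r::field) * Poly_Mapping.single w a = Poly_Mapping.single w (k * a)"
  by (simp add: scalar_def mult_single)

context vector_space
begin

lemma act_eq_sum:
  assumes "finite S" "Poly_Mapping.keys p \<subseteq> S"
  shows "act scale \<rho> p x = (\<Sum>w\<in>S. scale (Poly_Mapping.lookup p w) (foldr \<rho> (letters w) x))"
  unfolding act_def using assms
  by (intro sum.mono_neutral_left) (auto simp: in_keys_iff)

lemma act_diff: "act scale \<rho> (p - q) x = act scale \<rho> p x - act scale \<rho> q x"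
proof -
  let ?S = "Poly_Mapping.keys p \<union> Poly_Mapping.keys q \<union> Poly_Mapping.keys (p - q)"
  have "act scale \<rho> r x = (\<Sum>w\<in>?S. scale (Poly_Mapping.lookup r w) (foldr \<rho> (letters w) x))"
    if "r \<in> {p, q, p - q}" for r
    using that by (intro act_eq_sum) auto
  then show ?thesis by (simp add: lookup_minus scale_left_diff_distrib sum_subtractf)
qed

lemma act_0 [simp]: "act scale \<rho> 0 x = 0"
  by (simp add: act_def)

lemma act_single [simp]: "act scale \<rho> (Poly_Mapping.single w a) x = scale a (foldr \<rho> (letters w) x)"
  by (cases "a = 0") (simp_all add: act_def)

lemma act_1 [simp]: "act scale \<rho> 1 x = x"
proof -
  have "act scale \<rho> 1 x = scale 1 (foldr \<rho> (letters 0) x)"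
    by (metis act_single single_one)
  then show ?thesis by (simp add: zero_word_def)
qed

lemma act_letter [simp]: "act scale \<rho> (letter g) x = \<rho> g x"
  by (simp add: letter_def)

end

lemma K_pos_eq: "K_pos i = Poly_Mapping.single (Word [Vpos (i - 1), Vneg i]) (1 :: 'r::field)"
  and K_neg_eq: "K_neg i = Poly_Mapping.single (Word [Vneg (i - 1), Vpos i]) (1 :: 'r::field)"
  by (simp_all add: K_pos_def K_neg_def letter_def mult_single)

lemma K_pos_power: "K_pos i ^ j = Poly_Mapping.single (Word (concat (replicate j [Vpos (i - 1), Vneg i]))) (1 :: 'r::field)"
proof (induction j)
  case 0
  show ?case by (simp add: zero_word_def[symmetric])
next
  case (Suc j)
  then show ?case by (simp add: K_pos_eq mult_single)
qed

lemma relator_Vneg_Vpos: "i \<le> n \<Longrightarrow> letter (Vneg i) * letter (Vpos i) - 1 \<in> relators n v"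
  unfolding relators_def
  by (rule UnI1, rule UnI1, rule UnI1, rule UnI1, rule UnI1, rule UnI1, rule UnI2) blast

lemma relator_commutator:
  assumes "i \<in> {1..n}" "j \<in> {1..n}"
  shows "letter (Egen i) * letter (Fgen j) - letter (Fgen j) * letter (Egen i)
      - (if i = j then scalar (1 / (v - inverse v)) * (K_pos i - K_neg i) else 0) \<in> relators n v"
  unfolding relators_def using assms
  by - (rule UnI1, rule UnI1, rule UnI2, rule CollectI, rule exI[of _ i], rule exI[of _ j], simp)

section \<open>Modules with a Gelfand--Zetlin basis\<close>

text \<open>
The shifted entries, in which all quantum integers of the Gelfand--Zetlin formulas are differences.
\<close>

definition node :: "(nat \<Rightarrow> 'l::comm_ring_1) \<Rightarrow> pattern \<Rightarrow> nat \<Rightarrow> nat \<Rightarrow> 'l" where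
  "node lam m k r = entry lam m k r - of_nat k"

lemma node_shift: "node lam (shift d k r m) l s = node lam m l s + (if l = k \<and> s = r then of_int d else 0)"
  by (simp add: node_def entry_def shift_apply)

lemma c_num_eq: "c_num vp lam k (Suc r) m
    = (\<Prod>l<r. qint vp (node lam m l (r - 1) - node lam m k r - 1))
      * (\<Prod>l\<le>Suc r. qint vp (node lam m l (Suc r) - node lam m k r))"
  unfolding c_num_def node_def by (simp add: algebra_simps)

lemma c_den_eq: "c_den vp lam k (Suc r) m
    = (\<Prod>l\<in>{..r} - {k}. qint vp (node lam m l r - node lam m k r - 1) * qint vp (node lam m l r - node lam m k r))"
  unfolding c_den_def node_def by (simp add: algebra_simps lessThan_Suc_atMost del: lessThan_Suc)

text \<open>
A cyclic module with a Gelfand--Zetlin basis and a fixed choice of the square roots \<open>c\<close>.  Moves in row \<open>r\<close>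
belong to \<open>E\<close> and \<open>F\<close> with index \<open>Suc r\<close>.
\<close>

locale gz_module = quantum_exponent vp + vector_space sc
  for vp :: "'l::{comm_ring_1, ring_char_0} \<Rightarrow> 'r::field"
    and sc :: "'r \<Rightarrow> 'm::ab_group_add \<Rightarrow> 'm" +
  fixes n :: nat and lam :: "nat \<Rightarrow> 'l" and \<rho> :: "gen \<Rightarrow> 'm \<Rightarrow> 'm" and u :: 'm
    and b :: "pattern \<Rightarrow> 'm" and c :: "nat \<Rightarrow> nat \<Rightarrow> pattern \<Rightarrow> 'r"
  assumes linear_gen: "g \<in> gens n \<Longrightarrow> Vector_Spaces.linear sc sc (\<rho> g)"
    and relation: "p \<in> relators n (vp 1) \<Longrightarrow> act sc \<rho> p x = 0"
    and generated: "\<exists>p\<in>free_alg n. act sc \<rho> p u = x"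
    and inj_b: "inj_on b (patterns n)"
    and independent_b: "\<not> dependent (b ` patterns n)"
    and span_b: "span (b ` patterns n) = UNIV"
    and b_top: "b (\<lambda>k i. 0) = u \<or> b (\<lambda>k i. 0) = - u"
    and c_den_nonzero: "m \<in> patterns n \<Longrightarrow> k \<le> r \<Longrightarrow> r < n \<Longrightarrow> c_den vp lam k (Suc r) m \<noteq> 0"
    and c_square: "m \<in> patterns n \<Longrightarrow> k \<le> r \<Longrightarrow> r < n \<Longrightarrow>
      (c k r m)\<^sup>2 = - (c_num vp lam k (Suc r) m / c_den vp lam k (Suc r) m)"
    and V_b: "m \<in> patterns n \<Longrightarrow> i \<le> n \<Longrightarrow> \<rho> (Vpos i) (b m) = sc (vp (pattern_weight lam m i)) (b m)"
    and E_b: "m \<in> patterns n \<Longrightarrow> r < n \<Longrightarrow>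
      \<rho> (Egen (Suc r)) (b m) = (\<Sum>k\<le>r. sc (c k r m) (ket n b (shift 1 k r m)))"
    and F_b: "m \<in> patterns n \<Longrightarrow> r < n \<Longrightarrow>
      \<rho> (Fgen (Suc r)) (b m) = (\<Sum>k\<le>r. sc (c k r (shift (- 1) k r m)) (ket n b (shift (- 1) k r m)))"
begin

lemma gen_add: "g \<in> gens n \<Longrightarrow> \<rho> g (x + y) = \<rho> g x + \<rho> g y"
  and gen_scale: "g \<in> gens n \<Longrightarrow> \<rho> g (sc a x) = sc a (\<rho> g x)"
  using linear_gen[of g] by (simp_all add: Vector_Spaces.linear_iff)

lemma gen_0: "g \<in> gens n \<Longrightarrow> \<rho> g 0 = 0"
  using gen_scale[of g 0 0] by simp

lemma gen_sum: "g \<in> gens n \<Longrightarrow> \<rho> g (\<Sum>i\<in>S. f i) = (\<Sum>i\<in>S. \<rho> g (f i))"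
  by (induction S rule: infinite_finite_induct) (simp_all add: gen_0 gen_add)

lemma gens_simps [simp]:
  "r < n \<Longrightarrow> Egen (Suc r) \<in> gens n" "r < n \<Longrightarrow> Fgen (Suc r) \<in> gens n"
  "i \<le> n \<Longrightarrow> Vpos i \<in> gens n" "i \<le> n \<Longrightarrow> Vneg i \<in> gens n"
  by (auto simp: gens_def)

lemma Vneg_b:
  assumes "m \<in> patterns n" "i \<le> n"
  shows "\<rho> (Vneg i) (b m) = sc (vp (- pattern_weight lam m i)) (b m)"
proof -
  have "act sc \<rho> (letter (Vneg i) * letter (Vpos i) - 1) (b m) = 0"
    using relator_Vneg_Vpos[OF assms(2)] by (rule relation)
  then have "\<rho> (Vneg i) (\<rho> (Vpos i) (b m)) = b m"
    unfolding act_diff by (simp add: letter_def mult_single)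
  then have "sc (vp (pattern_weight lam m i)) (\<rho> (Vneg i) (b m)) = b m"
    using assms by (simp add: V_b gen_scale)
  then have "sc (vp (- pattern_weight lam m i)) (sc (vp (pattern_weight lam m i)) (\<rho> (Vneg i) (b m)))
      = sc (vp (- pattern_weight lam m i)) (b m)" by simp
  then show ?thesis by (simp add: vp_minus)
qed

abbreviation K_exp :: "pattern \<Rightarrow> nat \<Rightarrow> 'l" where
  "K_exp m i \<equiv> pattern_weight lam m (i - 1) - pattern_weight lam m i"

lemma K_pos_b:
  assumes "m \<in> patterns n" "i \<le> n"
  shows "act sc \<rho> (K_pos i) (b m) = sc (vp (K_exp m i)) (b m)"
  using assms by (simp add: K_pos_eq Vneg_b V_b gen_scale vp_diff vp_minus divide_inverse mult.commute)

lemma K_neg_b: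
  assumes "m \<in> patterns n" "i \<le> n"
  shows "act sc \<rho> (K_neg i) (b m) = sc (vp (- K_exp m i)) (b m)"
  using assms by (simp add: K_neg_eq Vneg_b V_b gen_scale vp_diff vp_minus divide_inverse mult.commute)

lemma commutator:
  assumes "i \<in> {1..n}" "j \<in> {1..n}"
  shows "\<rho> (Egen i) (\<rho> (Fgen j) x) - \<rho> (Fgen j) (\<rho> (Egen i) x)
    = (if i = j then sc (1 / (vp 1 - inverse (vp 1))) (act sc \<rho> (K_pos i) x - act sc \<rho> (K_neg i) x) else 0)"
proof -
  have "act sc \<rho> (letter (Egen i) * letter (Fgen j) - letter (Fgen j) * letter (Egen i)
      - (if i = j then scalar (1 / (vp 1 - inverse (vp 1))) * (K_pos i - K_neg i) else 0)) x = 0"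
    using relator_commutator[OF assms] by (rule relation)
  moreover have "act sc \<rho> (scalar k * (K_pos i - K_neg i)) x
      = sc k (act sc \<rho> (K_pos i) x - act sc \<rho> (K_neg i) x)" for k
    by (simp add: right_diff_distrib act_diff K_pos_eq K_neg_eq scalar_times_single scale_right_diff_distrib)
  moreover have "act sc \<rho> (letter g * letter h) x = \<rho> g (\<rho> h x)" for g h
    by (simp add: letter_def mult_single)
  ultimately show ?thesis
    unfolding act_diff by (cases "i = j") simp_all
qed

definition coord :: "pattern \<Rightarrow> 'm \<Rightarrow> 'r" where
  "coord m w = representation (b ` patterns n) w (b m)"

lemma in_span_b: "w \<in> span (b ` patterns n)"
  by (simp add: span_b)

lemma coord_add: "coord m (w + w') = coord m w + coord m w'"
  unfolding coord_def by (simp add: representation_add[OF independent_b in_span_b in_span_b])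

lemma coord_diff: "coord m (w - w') = coord m w - coord m w'"
  unfolding coord_def by (simp add: representation_diff[OF independent_b in_span_b in_span_b])

lemma coord_scale: "coord m (sc a w) = a * coord m w"
  unfolding coord_def by (simp add: representation_scale[OF independent_b in_span_b])

lemma coord_0 [simp]: "coord m 0 = 0"
  using coord_scale[of m 0 0] by simp

lemma coord_sum: "coord m (\<Sum>i\<in>S. f i) = (\<Sum>i\<in>S. coord m (f i))"
  by (induction S rule: infinite_finite_induct) (simp_all add: coord_add)

lemma coord_b: "m \<in> patterns n \<Longrightarrow> p \<in> patterns n \<Longrightarrow> coord p (b m) = (if m = p then 1 else 0)"
  unfolding coord_def using inj_onD[OF inj_b, of m p]
  by (auto simp: representation_basis[OF independent_b])

lemma coord_ket: "p \<in> patterns n \<Longrightarrow> coord p (ket n b m) = (if m = p then 1 else 0)"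
  by (auto simp: ket_def coord_b)

lemma expansion:
  assumes "finite S" "S \<subseteq> patterns n" "\<And>m. m \<in> patterns n \<Longrightarrow> coord m w \<noteq> 0 \<Longrightarrow> m \<in> S"
  shows "w = (\<Sum>m\<in>S. sc (coord m w) (b m))"
proof -
  have nz: "{v. representation (b ` patterns n) w v \<noteq> 0} \<subseteq> b ` S"
  proof
    fix v assume v: "v \<in> {v. representation (b ` patterns n) w v \<noteq> 0}"
    then have "v \<in> b ` patterns n" using representation_ne_zero by auto
    then obtain m where "m \<in> patterns n" "v = b m" by auto
    with v assms(3)[of m] show "v \<in> b ` S" by (auto simp: coord_def)
  qed
  have "w = (\<Sum>v | representation (b ` patterns n) w v \<noteq> 0. sc (representation (b ` patterns n) w v) v)"
    using sum_nonzero_representation_eq[OF independent_b in_span_b] by simp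
  also have "\<dots> = (\<Sum>v\<in>b ` S. sc (representation (b ` patterns n) w v) v)"
    using nz assms(1) by (intro sum.mono_neutral_left) auto
  also have "\<dots> = (\<Sum>m\<in>S. sc (coord m w) (b m))"
    using assms(2) by (subst sum.reindex) (auto simp: coord_def intro: inj_on_subset[OF inj_b])
  finally show ?thesis .
qed

lemma span_induct_b [case_names zero add scale basis]:
  assumes "P 0" "\<And>x y. P x \<Longrightarrow> P y \<Longrightarrow> P (x + y)" "\<And>a x. P x \<Longrightarrow> P (sc a x)" "\<And>m. m \<in> patterns n \<Longrightarrow> P (b m)"
  shows "P w"
  using in_span_b[of w]
  by (rule span_induct) (use assms in \<open>auto simp: subspace_def\<close>)

text \<open>
Together with \<open>coord_F\<close> this is the symmetry of the basis: \<open>E\<close> and \<open>F\<close> have transposed matrices.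
\<close>

lemma coord_E:
  assumes "r < n" "m \<in> patterns n"
  shows "coord m (\<rho> (Egen (Suc r)) w)
    = (\<Sum>k\<le>r. if shift (- 1) k r m \<in> patterns n then c k r (shift (- 1) k r m) * coord (shift (- 1) k r m) w else 0)"
proof (induction w rule: span_induct_b)
  case zero
  then show ?case using assms by (auto simp: gen_0 intro!: sum.neutral)
next
  case (add x y)
  then show ?case using assms
    by (auto simp: gen_add coord_add sum.distrib[symmetric] distrib_left intro!: sum.cong)
next
  case (scale a x)
  then show ?case using assms
    by (auto simp: gen_scale coord_scale sum_distrib_left intro!: sum.cong)
next
  case (basis p)
  have "coord m (\<rho> (Egen (Suc r)) (b p)) = (\<Sum>k\<le>r. c k r p * (if shift 1 k r p = m then 1 else 0))"
    using assms basis by (simp add: E_b coord_sum coord_scale coord_ket)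
  also have "\<dots> = (\<Sum>k\<le>r. if shift (- 1) k r m \<in> patterns n then c k r (shift (- 1) k r m) * coord (shift (- 1) k r m) (b p) else 0)"
  proof (intro sum.cong refl)
    fix k
    have "shift 1 k r p = m \<longleftrightarrow> p = shift (- 1) k r m" by auto
    then show "c k r p * (if shift 1 k r p = m then 1 else 0)
      = (if shift (- 1) k r m \<in> patterns n then c k r (shift (- 1) k r m) * coord (shift (- 1) k r m) (b p) else 0)"
      using basis by (auto simp: coord_b)
  qed
  finally show ?case .
qed

end

section \<open>Genericity and the relations between the roots\<close>

text \<open>
The only way from one lower corner of a square of moves to the other by one move down and one move up; it isolates a
single term in the matrix entries of \<open>E F\<close> and \<open>F E\<close>.
\<close>

lemma swap_moves_unique:
  assumes "(k, r) \<noteq> (l, s)"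
  shows "shift 1 l' s (shift (- 1) k' r (shift 1 k r m)) = shift 1 l s m \<longleftrightarrow> k' = k \<and> l' = l"
proof
  assume *: "shift 1 l' s (shift (- 1) k' r (shift 1 k r m)) = shift 1 l s m"
  from fun_cong[OF fun_cong[OF *], of k r] assms have "k' = k"
    by (auto simp: shift_apply split: if_splits)
  with fun_cong[OF fun_cong[OF *], of l s] assms show "k' = k \<and> l' = l"
    by (auto simp: shift_apply split: if_splits)
qed (simp add: shift_commute)

context gz_module
begin

lemma node_diff: "node lam m l s - node lam m k r = lam l - lam k + of_int (m k r - m l s + int k - int l)"
  by (simp add: node_def entry_def)

text \<open>
The nonvanishing denominators force \<open>\<lambda>\<^sub>0, \<dots>, \<lambda>\<^bsub>n-1\<^esub>\<close> to be generic: every integer \<open>j\<close> occurs as the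
difference of two entries of row \<open>n - 1\<close>, already for patterns in which \<open>m k\<close> is nonzero for a single \<open>k\<close> only.
\<close>

lemma qint_generic:
  assumes "k \<noteq> l" "k < n" "l < n"
  shows "qint vp (lam l - lam k + of_int j) \<noteq> 0"
proof -
  define t where "t = j + int l - int k"
  define m :: pattern where "m i s = (if i \<le> s \<and> s < n then if i = k then max t 0 else if i = l then max (- t) 0 else 0 else 0)" for i s
  have m: "m \<in> patterns n"
    by (auto simp: patterns_def m_def)
  have n: "Suc (n - 1) = n" using assms by simp
  have "c_den vp lam k (Suc (n - 1)) m \<noteq> 0"
    using assms by (intro c_den_nonzero m) auto
  then have "qint vp (node lam m l (n - 1) - node lam m k (n - 1)) \<noteq> 0"
    using assms unfolding c_den_eq by (auto simp: prod_zero_iff)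
  then have "qint vp (lam l - lam k + of_int (m k (n - 1) - m l (n - 1) + int k - int l)) \<noteq> 0"
    by (simp only: node_diff not_False_eq_True)
  moreover have "m k (n - 1) - m l (n - 1) + int k - int l = j"
  proof -
    have "k \<le> n - 1" "l \<le> n - 1" "n - 1 < n" using assms by simp_all
    then show ?thesis using assms(1) by (simp add: m_def t_def max_def)
  qed
  ultimately show ?thesis by metis
qed

lemma qint_node_generic:
  assumes "k \<noteq> l" "k < n" "l < n"
  shows "qint vp (node lam m l s - node lam m k r + of_int j) \<noteq> 0"
  using qint_generic[OF assms, of "m k r - m l s + int k - int l + j"] unfolding node_diff
  by (simp only: of_int_add add.assoc not_False_eq_True)

lemma qint_node_same: "qint vp (node lam m k s - node lam m k r + of_int j) = 0 \<longleftrightarrow> m k r - m k s + j = 0"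
proof -
  have "node lam m k s - node lam m k r + of_int j = of_int (m k r - m k s + j)"
    by (simp add: node_diff)
  then show ?thesis by (simp only: qint_of_int_eq_0_iff)
qed

lemma coord_F:
  assumes "r < n" "m \<in> patterns n"
  shows "coord m (\<rho> (Fgen (Suc r)) w)
    = (\<Sum>k\<le>r. if shift 1 k r m \<in> patterns n then c k r m * coord (shift 1 k r m) w else 0)"
proof (induction w rule: span_induct_b)
  case zero
  then show ?case using assms by (auto simp: gen_0 intro!: sum.neutral)
next
  case (add x y)
  then show ?case using assms
    by (auto simp: gen_add coord_add sum.distrib[symmetric] distrib_left intro!: sum.cong)
next
  case (scale a x)
  then show ?case using assms
    by (auto simp: gen_scale coord_scale sum_distrib_left intro!: sum.cong)
next
  case (basis p)
  have "coord m (\<rho> (Fgen (Suc r)) (b p)) = (\<Sum>k\<le>r. c k r (shift (- 1) k r p) * (if shift (- 1) k r p = m then 1 else 0))"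
    using assms basis by (simp add: F_b coord_sum coord_scale coord_ket)
  also have "\<dots> = (\<Sum>k\<le>r. if shift 1 k r m \<in> patterns n then c k r m * coord (shift 1 k r m) (b p) else 0)"
  proof (intro sum.cong refl)
    fix k
    have "shift (- 1) k r p = m \<longleftrightarrow> p = shift 1 k r m" by auto
    then show "c k r (shift (- 1) k r p) * (if shift (- 1) k r p = m then 1 else 0)
      = (if shift 1 k r m \<in> patterns n then c k r m * coord (shift 1 k r m) (b p) else 0)"
      using basis by (auto simp: coord_b)
  qed
  finally show ?case .
qed

lemma coord_F_nonzeroE:
  assumes "r < n" "m \<in> patterns n" "coord m (\<rho> (Fgen (Suc r)) w) \<noteq> 0"
  obtains k where "k \<le> r" "shift 1 k r m \<in> patterns n" "c k r m \<noteq> 0" "coord (shift 1 k r m) w \<noteq> 0"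
proof -
  from assms(3) obtain k where "k \<in> {..r}"
    "(if shift 1 k r m \<in> patterns n then c k r m * coord (shift 1 k r m) w else 0) \<noteq> 0"
    unfolding coord_F[OF assms(1,2)] by (rule sum.not_neutral_contains_not_neutral)
  then show ?thesis by (intro that[of k]) (auto split: if_splits)
qed

inductive F_monomial :: "(nat \<Rightarrow> nat) \<Rightarrow> 'm \<Rightarrow> bool" where
  top: "F_monomial (\<lambda>_. 0) u"
| lower: "F_monomial \<beta> w \<Longrightarrow> r < n \<Longrightarrow> F_monomial (\<beta>(Suc r := Suc (\<beta> (Suc r)))) (\<rho> (Fgen (Suc r)) w)"

lemma coord_u: "m \<in> patterns n \<Longrightarrow> m \<noteq> (\<lambda>k i. 0) \<Longrightarrow> coord m u = 0"
proof -
  assume m: "m \<in> patterns n" "m \<noteq> (\<lambda>k i. 0)"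
  have "coord m (b (\<lambda>k i. 0)) = 0"
    using m by (simp add: coord_b zero_pattern)
  then show ?thesis
    using b_top coord_scale[of m "- 1" u] by auto
qed

lemma F_monomial_degree:
  assumes "F_monomial \<beta> w" "m \<in> patterns n" "coord m w \<noteq> 0"
  shows "pattern_degree n m = \<beta>"
  using assms
proof (induction arbitrary: m rule: F_monomial.induct)
  case top
  then have "m = (\<lambda>k i. 0)" using coord_u by blast
  then show ?case by (simp add: pattern_degree_def fun_eq_iff)
next
  case (lower \<beta> w r)
  from lower.hyps(2) lower.prems obtain k where k: "k \<le> r" "shift 1 k r m \<in> patterns n"
      "coord (shift 1 k r m) w \<noteq> 0"
    by (rule coord_F_nonzeroE)
  then show ?case
    using lower.IH[OF k(2,3)] pattern_degree_shift[OF k(2), of k r] lower.prems(1) by simp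
qed

lemma F_monomial_expansion:
  assumes "F_monomial \<beta> w"
  shows "w = (\<Sum>m | m \<in> patterns n \<and> pattern_degree n m = \<beta>. sc (coord m w) (b m))"
  using F_monomial_degree[OF assms] by (intro expansion finite_patterns_pattern_degree) auto

lemma eigenvector_on_degree:
  assumes g: "g \<in> gens n"
    and eq: "\<And>m. m \<in> patterns n \<Longrightarrow> pattern_degree n m = \<beta> \<Longrightarrow> \<rho> g (b m) = sc a (b m)"
    and w: "w = (\<Sum>m | m \<in> patterns n \<and> pattern_degree n m = \<beta>. sc (coord m w) (b m))"
  shows "\<rho> g w = sc a w"
proof -
  have "\<rho> g w = (\<Sum>m | m \<in> patterns n \<and> pattern_degree n m = \<beta>. sc (coord m w) (\<rho> g (b m)))"
    by (subst w) (simp add: gen_sum[OF g] gen_scale[OF g])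
  also have "\<dots> = (\<Sum>m | m \<in> patterns n \<and> pattern_degree n m = \<beta>. sc a (sc (coord m w) (b m)))"
    by (intro sum.cong) (auto simp: eq mult.commute)
  also have "\<dots> = sc a w"
    by (subst (2) w) (simp add: scale_sum_right)
  finally show ?thesis .
qed

lemma Vpos_F_monomial:
  assumes "F_monomial \<beta> w" "i \<le> n"
  shows "\<rho> (Vpos i) w = sc (vp (lam i - qcoord n \<beta> i)) w"
  by (rule eigenvector_on_degree[OF _ _ F_monomial_expansion[OF assms(1)]])
    (use assms(2) in \<open>auto simp: V_b pattern_weight_eq\<close>)

lemma Vneg_F_monomial:
  assumes "F_monomial \<beta> w" "i \<le> n"
  shows "\<rho> (Vneg i) w = sc (vp (- (lam i - qcoord n \<beta> i))) w"
  by (rule eigenvector_on_degree[OF _ _ F_monomial_expansion[OF assms(1)]])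
    (use assms(2) in \<open>auto simp: Vneg_b pattern_weight_eq\<close>)

lemma E_u: "r < n \<Longrightarrow> \<rho> (Egen (Suc r)) u = 0"
proof -
  assume r: "r < n"
  have "shift 1 k r (\<lambda>k i. 0) \<notin> patterns n" if "k \<le> r" for k
    using raise_removable[OF zero_pattern, of k r n] that r by (auto simp: removable_def)
  then have "\<rho> (Egen (Suc r)) (b (\<lambda>k i. 0)) = 0"
    using r zero_pattern[of n] by (auto simp: E_b ket_def intro!: sum.neutral)
  then show ?thesis
    using b_top gen_scale[of "Egen (Suc r)" "- 1" u] r by auto
qed

text \<open>
The part of the triangular decomposition that is needed.  An \<open>E\<close> is commuted to the right through a monomial; the
commutator only produces weight operators, for which monomials are eigenvectors.
\<close>

lemma span_F_monomials: "span {w. \<exists>\<beta>. F_monomial \<beta> w} = UNIV"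
proof -
  define S where "S = span {w. \<exists>\<beta>. F_monomial \<beta> w}"
  have mono: "w \<in> S" if "F_monomial \<beta> w" for \<beta> w
    unfolding S_def by (rule span_base) (use that in blast)
  have sub: "subspace S" by (simp add: S_def)
  have extend: "\<rho> g x \<in> S"
    if g: "g \<in> gens n" and gS: "\<And>\<beta> w. F_monomial \<beta> w \<Longrightarrow> \<rho> g w \<in> S" and x: "x \<in> S" for g x
    using x unfolding S_def
  proof (rule span_induct)
    show "subspace {x. \<rho> g x \<in> span {w. \<exists>\<beta>. F_monomial \<beta> w}}"
      unfolding subspace_def
      using gen_0[OF g] gen_add[OF g] gen_scale[OF g] by (auto intro: span_add span_scale span_zero)
  qed (use gS S_def in auto)
  have F: "\<rho> (Fgen (Suc r)) x \<in> S" if "r < n" "x \<in> S" for r x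
    using gens_simps(2)[OF that(1)] mono[OF F_monomial.lower[OF _ that(1)]] that(2) by (rule extend)
  have E_mono: "\<rho> (Egen (Suc r)) w \<in> S" if "F_monomial \<beta> w" "r < n" for r \<beta> w
    using that
  proof (induction rule: F_monomial.induct)
    case top
    then show ?case using E_u[of r] by (simp add: S_def span_zero)
  next
    case (lower \<beta> w s)
    have "\<rho> (Egen (Suc r)) (\<rho> (Fgen (Suc s)) w) = \<rho> (Fgen (Suc s)) (\<rho> (Egen (Suc r)) w)
      + (if Suc r = Suc s then sc (1 / (vp 1 - inverse (vp 1))) (act sc \<rho> (K_pos (Suc r)) w - act sc \<rho> (K_neg (Suc r)) w) else 0)"
      using commutator[of "Suc r" "Suc s" w] lower.prems lower.hyps by (simp add: algebra_simps split: if_splits)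
    moreover have "act sc \<rho> (K_pos (Suc r)) w \<in> S" "act sc \<rho> (K_neg (Suc r)) w \<in> S"
      using lower.prems lower.hyps mono
      by (auto simp: K_pos_eq K_neg_eq Vpos_F_monomial Vneg_F_monomial gen_scale intro!: subspace_scale[OF sub])
    ultimately show ?case
      using lower F by (auto intro!: subspace_add[OF sub] subspace_scale[OF sub] subspace_diff[OF sub] subspace_0[OF sub])
  qed
  have gen: "\<rho> g x \<in> S" if "g \<in> gens n" "x \<in> S" for g x
  proof (rule extend[OF that(1) _ that(2)])
    have g: "g \<in> gens n" by (rule that(1))
    fix \<beta> w assume w: "F_monomial \<beta> w"
    consider r where "g = Egen (Suc r)" "r < n" | r where "g = Fgen (Suc r)" "r < n"
      | i where "g = Vpos i" "i \<le> n" | i where "g = Vneg i" "i \<le> n"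
      using g unfolding gens_def image_Suc_lessThan[symmetric] by auto
    then show "\<rho> g w \<in> S"
      by cases (use w mono F E_mono Vpos_F_monomial Vneg_F_monomial subspace_scale[OF sub] in auto)
  qed
  have word: "foldr \<rho> gs u \<in> S" if "set gs \<subseteq> gens n" for gs
    using that by (induction gs) (auto intro: gen mono F_monomial.top)
  have "x \<in> S" for x
  proof -
    obtain p where p: "p \<in> free_alg n" "act sc \<rho> p u = x" using generated by blast
    have "act sc \<rho> p u \<in> S"
      unfolding act_def using p(1)
      by (intro subspace_sum[OF sub] subspace_scale[OF sub] word) (auto simp: free_alg_def)
    with p show ?thesis by simp
  qed
  then show ?thesis by (auto simp: S_def)
qed

lemma coord_zero_on_F_monomials:
  assumes "\<And>\<beta> w. F_monomial \<beta> w \<Longrightarrow> coord m w = 0"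
  shows "coord m x = 0"
proof -
  have "x \<in> span {w. \<exists>\<beta>. F_monomial \<beta> w}" by (simp add: span_F_monomials)
  then show ?thesis
    by (rule span_induct) (use assms in \<open>auto simp: subspace_def coord_add coord_scale\<close>)
qed

text \<open>
The denominators say nothing about \<open>\<lambda>\<^sub>n\<close>.  If \<open>[\<lambda>\<^sub>n - \<lambda>\<^sub>k + s + k - n]\<close> were \<open>0\<close>, then the coefficient \<open>c\<close>
of every move that brings \<open>m k (n - 1)\<close> to \<open>s\<close> would vanish.  All monomials in the \<open>F\<^sub>i\<close> would then remain in
the span of the kets with \<open>m k (n - 1) < s\<close>, although they span the module.
\<close>

lemma qint_last_generic:
  assumes k: "k < n" and s: "0 < s"
  shows "qint vp (lam n - lam k + of_int (s + int k - int n)) \<noteq> 0"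
proof
  assume zero: "qint vp (lam n - lam k + of_int (s + int k - int n)) = 0"
  define m :: pattern where "m l i = (if l \<le> i \<and> i < n \<and> l = k then s else 0)" for l i
  have m: "m \<in> patterns n"
    using s by (auto simp: patterns_def m_def)
  have n: "Suc (n - 1) = n" using k by simp
  have c0: "c k (n - 1) p = 0" if p: "p \<in> patterns n" "p k (n - 1) = s" for p
  proof -
    have "node lam p n n - node lam p k (n - 1) = lam n - lam k + of_int (s + int k - int n)"
      using pattern_outside[OF p(1), of n n] p(2) by (simp add: node_diff)
    then have "qint vp (node lam p n (Suc (n - 1)) - node lam p k (n - 1)) = 0"
      unfolding n by (simp only: zero)
    then have "(\<Prod>l\<le>Suc (n - 1). qint vp (node lam p l (Suc (n - 1)) - node lam p k (n - 1))) = 0"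
      by (intro prod_zero bexI[of _ n]) (simp_all add: n)
    then have "c_num vp lam k (Suc (n - 1)) p = 0"
      unfolding c_num_eq by (simp only: mult_zero_right)
    moreover have "k \<le> n - 1" "n - 1 < n" using k by simp_all
    ultimately have "(c k (n - 1) p)\<^sup>2 = 0"
      by (simp only: c_square[OF p(1)] div_0 minus_zero)
    then show ?thesis by simp
  qed
  have below: "p k (n - 1) < s" if "F_monomial \<beta> w" "p \<in> patterns n" "coord p w \<noteq> 0" for \<beta> w p
    using that
  proof (induction arbitrary: p rule: F_monomial.induct)
    case top
    then have "p = (\<lambda>k i. 0)" using coord_u by blast
    then show ?case using s by simp
  next
    case (lower \<beta> w r)
    from lower.hyps(2) lower.prems obtain l where l: "l \<le> r" "shift 1 l r p \<in> patterns n"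
        "c l r p \<noteq> 0" "coord (shift 1 l r p) w \<noteq> 0"
      by (rule coord_F_nonzeroE)
    have "shift 1 l r p k (n - 1) < s" by (rule lower.IH[OF l(2,4)])
    show ?case
    proof (cases "l = k \<and> r = n - 1")
      case True
      then have "p k (n - 1) \<noteq> s" "p k (n - 1) - 1 < s"
        using c0[OF lower.prems(1)] l(3) \<open>shift 1 l r p k (n - 1) < s\<close> by (auto simp: shift_apply)
      then show ?thesis by linarith
    next
      case False
      then show ?thesis
        using \<open>shift 1 l r p k (n - 1) < s\<close> by (auto simp: shift_apply)
    qed
  qed
  have "m k (n - 1) = s" using k by (simp add: m_def)
  then have "coord m w = 0" if "F_monomial \<beta> w" for \<beta> w
    using below[OF that m] by (metis less_irrefl)
  then have "coord m (b m) = 0" by (rule coord_zero_on_F_monomials)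
  then show False by (simp add: coord_b m)
qed

lemma qint_node_last:
  assumes "k < n" "m \<in> patterns n" "0 < m k r + j"
  shows "qint vp (node lam m n n - node lam m k r + of_int j) \<noteq> 0"
  using qint_last_generic[OF assms(1,3)] pattern_outside[OF assms(2), of n n]
  by (simp add: node_diff algebra_simps)

lemma c_num_upper_nonzero:
  assumes m: "m \<in> patterns n" and rem: "removable n m k r" and l: "l \<le> Suc r"
  shows "qint vp (node lam m l (Suc r) - node lam m k r) \<noteq> 0"
proof -
  have kr: "k < n" "r < n" "k \<le> r" and lt: "m k (Suc r) < m k r" using rem by (auto simp: removable_def)
  consider "l = k" | "l \<noteq> k" "l < n" | "l = n" "Suc r = n" using l kr by linarith
  then show ?thesis
  proof cases
    case 1
    then show ?thesis using qint_node_same[of m k "Suc r" r 0] lt by simp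
  next
    case 2
    then show ?thesis using qint_node_generic[of k l m "Suc r" r 0] kr by simp
  next
    case 3
    then show ?thesis using qint_node_last[OF kr(1) m, of r 0] lt pattern_nonneg[OF m, of k "Suc r"] by simp
  qed
qed

lemma c_num_lower_nonzero:
  assumes m: "m \<in> patterns n" and rem: "removable n m k r" and l: "l < r"
  shows "qint vp (node lam m l (r - 1) - node lam m k r - 1) \<noteq> 0"
proof (cases "l = k")
  case True
  have "m k (Suc (r - 1)) \<le> m k (r - 1)"
    using rem l True by (intro pattern_step[OF m]) (auto simp: removable_def)
  then have "m k r \<le> m k (r - 1)" using l by simp
  then show ?thesis using qint_node_same[of m k "r - 1" r "- 1"] True by simp
next
  case False
  then show ?thesis using qint_node_generic[of k l m "r - 1" r "- 1"] rem l by (simp add: removable_def)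
qed

lemma c_nonzero:
  assumes m: "m \<in> patterns n" and rem: "removable n m k r"
  shows "c k r m \<noteq> 0"
proof -
  have "c_num vp lam k (Suc r) m \<noteq> 0"
    unfolding c_num_eq using c_num_lower_nonzero[OF assms] c_num_upper_nonzero[OF assms]
    by (auto simp: prod_zero_iff)
  moreover have kr: "k \<le> r" "r < n" using rem by (auto simp: removable_def)
  ultimately have "(c k r m)\<^sup>2 \<noteq> 0"
    using c_den_nonzero[OF m kr] by (simp add: c_square[OF m kr])
  then show ?thesis by simp
qed

text \<open>
The entry of \<open>E F - F E\<close> between the two middle patterns of the square.  It vanishes, even if \<open>E\<close> and \<open>F\<close> have the
same index, because the commutator is then diagonal.
\<close>

lemma c_square_relation:
  assumes m: "m \<in> patterns n" and kr: "removable n m k r" and ls: "removable n m l s"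
    and ne: "(k, r) \<noteq> (l, s)"
  shows "c k r m * c l s m = c k r (shift 1 l s m) * c l s (shift 1 k r m)"
proof -
  define p where "p = shift 1 k r m"
  define q where "q = shift 1 l s m"
  have p: "p \<in> patterns n" and q: "q \<in> patterns n"
    using removable_raise[OF m] kr ls by (auto simp: p_def q_def)
  have pq: "p \<noteq> q"
  proof
    assume "p = q"
    from fun_cong[OF fun_cong[OF this], of k r] ne show False
      by (auto simp: p_def q_def shift_apply split: if_splits)
  qed
  have r: "r < n" "k \<le> r" and s: "s < n" "l \<le> s" using kr ls by (auto simp: removable_def)
  have meet: "shift 1 l s p \<in> patterns n"
    unfolding p_def by (rule removable_raise[OF removable_raise[OF m kr] removable_other[OF m kr ls ne]])
  have p_back: "shift (- 1) k r p = m" by (simp add: p_def)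
  have swap: "shift 1 l' s (shift (- 1) k' r p) = q \<longleftrightarrow> k' = k \<and> l' = l" for k' l'
    unfolding p_def q_def by (rule swap_moves_unique[OF ne])
  have swap': "shift (- 1) k' r (shift 1 l' s p) = q \<longleftrightarrow> k' = k \<and> l' = l" for k' l'
    using swap by (simp add: shift_commute)
  have "coord p (\<rho> (Egen (Suc r)) (\<rho> (Fgen (Suc s)) (b q))) = c k r m * c l s m"
  proof -
    have inner: "coord (shift (- 1) k' r p) (\<rho> (Fgen (Suc s)) (b q)) = (if k' = k then c l s m else 0)"
      if x: "shift (- 1) k' r p \<in> patterns n" for k'
    proof -
      have "coord (shift (- 1) k' r p) (\<rho> (Fgen (Suc s)) (b q))
        = (\<Sum>l'\<le>s. if l' = l then if k' = k then c l s m else 0 else 0)"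
        unfolding coord_F[OF s(1) x]
      proof (intro sum.cong refl)
        fix l'
        let ?y = "shift 1 l' s (shift (- 1) k' r p)"
        have "coord ?y (b q) = (if k' = k \<and> l' = l then 1 else 0)" if "?y \<in> patterns n"
          unfolding coord_b[OF q that] eq_commute[of q] swap ..
        moreover have "?y \<in> patterns n" if "k' = k \<and> l' = l"
        proof -
          have "?y = q" using that swap[of l' k'] by blast
          then show ?thesis using q by (simp only:)
        qed
        ultimately show "(if ?y \<in> patterns n then c l' s (shift (- 1) k' r p) * coord ?y (b q) else 0)
            = (if l' = l then if k' = k then c l s m else 0 else 0)"
          using p_back by (cases "k' = k"; cases "l' = l") simp_all
      qed
      then show ?thesis using s by simp
    qed
    have "coord p (\<rho> (Egen (Suc r)) (\<rho> (Fgen (Suc s)) (b q)))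
      = (\<Sum>k'\<le>r. if k' = k then c k r m * c l s m else 0)"
      unfolding coord_E[OF r(1) p]
    proof (intro sum.cong refl)
      fix k'
      show "(if shift (- 1) k' r p \<in> patterns n then c k' r (shift (- 1) k' r p)
          * coord (shift (- 1) k' r p) (\<rho> (Fgen (Suc s)) (b q)) else 0) = (if k' = k then c k r m * c l s m else 0)"
        using inner[of k'] m p_back by (cases "k' = k") simp_all
    qed
    then show ?thesis using r by simp
  qed
  moreover have "coord p (\<rho> (Fgen (Suc s)) (\<rho> (Egen (Suc r)) (b q))) = c k r q * c l s p"
  proof -
    have inner: "coord (shift 1 l' s p) (\<rho> (Egen (Suc r)) (b q)) = (if l' = l then c k r q else 0)"
      if x: "shift 1 l' s p \<in> patterns n" for l'
    proof -
      have "coord (shift 1 l' s p) (\<rho> (Egen (Suc r)) (b q))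
        = (\<Sum>k'\<le>r. if k' = k then if l' = l then c k r q else 0 else 0)"
        unfolding coord_E[OF r(1) x]
      proof (intro sum.cong refl)
        fix k'
        let ?y = "shift (- 1) k' r (shift 1 l' s p)"
        have "coord ?y (b q) = (if k' = k \<and> l' = l then 1 else 0)" if "?y \<in> patterns n"
          unfolding coord_b[OF q that] eq_commute[of q] swap' ..
        moreover have y: "?y = q" if "k' = k \<and> l' = l"
          using that swap'[of k' l'] by blast
        ultimately show "(if ?y \<in> patterns n then c k' r ?y * coord ?y (b q) else 0)
            = (if k' = k then if l' = l then c k r q else 0 else 0)"
          using q by (cases "k' = k"; cases "l' = l") simp_all
      qed
      then show ?thesis using r by simp
    qed
    have "coord p (\<rho> (Fgen (Suc s)) (\<rho> (Egen (Suc r)) (b q)))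
      = (\<Sum>l'\<le>s. if l' = l then c k r q * c l s p else 0)"
      unfolding coord_F[OF s(1) p] using meet
      by (intro sum.cong) (auto simp: inner)
    then show ?thesis using s by simp
  qed
  moreover have "coord p (\<rho> (Egen (Suc r)) (\<rho> (Fgen (Suc s)) (b q)) - \<rho> (Fgen (Suc s)) (\<rho> (Egen (Suc r)) (b q))) = 0"
    using r s q p pq by (auto simp: commutator K_pos_b K_neg_b coord_scale coord_diff coord_b)
  ultimately show ?thesis
    by (simp add: coord_diff p_def q_def)
qed

end

section \<open>The weights of the moves\<close>

lemma prod_change_one:
  fixes f g :: "'a \<Rightarrow> 'b::comm_monoid_mult"
  assumes "finite S" "j \<in> S" "\<And>i. i \<in> S \<Longrightarrow> i \<noteq> j \<Longrightarrow> f i = g i"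
  shows "prod f S * g j = prod g S * f j"
proof -
  have "prod f (S - {j}) = prod g (S - {j})"
    using assms(3) by (intro prod.cong) auto
  then show ?thesis
    using assms(1,2) by (simp add: prod.remove[of S j] mult_ac)
qed

lemma entry_shift: "entry lam (shift d k r m) l s = entry lam m l s + (if l = k \<and> s = r then of_int d else 0)"
  by (simp add: entry_def shift_apply)

lemma sum_entry_lower:
  fixes lam :: "nat \<Rightarrow> 'l::comm_ring_1"
  assumes "finite S"
  shows "(\<Sum>l\<in>S. entry lam (shift (- 1) k r m) l s) = (\<Sum>l\<in>S. entry lam m l s) - (if k \<in> S \<and> s = r then 1 else 0)"
proof -
  have "(\<Sum>l\<in>S. entry lam (shift (- 1) k r m) l s) = (\<Sum>l\<in>S. entry lam m l s - (if l = k then if s = r then 1 else 0 else 0))"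
    by (intro sum.cong) (auto simp: entry_shift)
  with assms show ?thesis by (auto simp: sum_subtractf)
qed

context gz_module
begin

definition kappa :: 'r where "kappa = 1 / (1 - (vp 1)\<^sup>2)"

text \<open>
Minus the exponent of the eigenvalue of \<open>K\<^bsub>r+1\<^esub>\<close> on the weight space one step below the ket of \<open>m\<close>.
In row \<open>0\<close> the middle sum is empty, as it should be.
\<close>

definition step_exponent :: "pattern \<Rightarrow> nat \<Rightarrow> 'l" where
  "step_exponent m r = (\<Sum>l\<le>Suc r. entry lam m l (Suc r)) + (\<Sum>l<r. entry lam m l (r - 1)) - 2 * (\<Sum>l\<le>r. entry lam m l r) + 2"

text \<open>
The summands of \<open>lagrange_sum_eq_1\<close> for the nodes \<open>v\<^bsup>2 a\<^esup>\<close>, \<open>a\<close> a shifted entry of row \<open>r\<close>, and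
\<open>B\<close> given in the same way by row \<open>r - 1\<close>.
\<close>

definition lagrange_weight :: "nat \<Rightarrow> nat \<Rightarrow> pattern \<Rightarrow> 'r" where
  "lagrange_weight k r m = (\<Prod>l<r. e (node lam m k r - node lam m l (r - 1)))
     * (\<Prod>l\<in>{..r} - {k}. inverse (e (node lam m k r - node lam m l r)))"

text \<open>
The value prescribed for \<open>c\<^sub>k y(m lowered at k)\<close> divided by \<open>y m\<close>.
\<close>

definition move_coeff :: "nat \<Rightarrow> nat \<Rightarrow> pattern \<Rightarrow> 'r" where
  "move_coeff k r m = kappa * vp (of_nat r * step_exponent m r) * lagrange_weight k r m"

lemma kappa_nonzero: "kappa \<noteq> 0"
  using vp_1_not_root_of_unity[of 2] by (simp add: kappa_def)

lemma e_conv: "e (x - y) = 1 - vp (2 * x) / vp (2 * y)"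
  by (simp add: e_def right_diff_distrib vp_diff)

lemma e_node_generic:
  assumes "k \<noteq> l" "k < n" "l < n"
  shows "e (node lam m l s - node lam m k r + of_int j) \<noteq> 0"
  using qint_node_generic[OF assms] by (simp only: qint_eq_0_iff not_False_eq_True)

lemma sum_lagrange_weight:
  assumes "r < n"
  shows "(\<Sum>k\<le>r. lagrange_weight k r m) = 1"
proof -
  have "inj_on (\<lambda>k. vp (2 * node lam m k r)) {..r}"
  proof (rule inj_onI, rule ccontr)
    fix k l assume k: "k \<in> {..r}" and l: "l \<in> {..r}" and eq: "vp (2 * node lam m k r) = vp (2 * node lam m l r)" and "k \<noteq> l"
    then have "e (node lam m l r - node lam m k r + of_int 0) \<noteq> 0"
      using assms by (intro e_node_generic) auto
    with eq show False by (simp add: e_conv)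
  qed
  then show ?thesis
    using lagrange_sum_eq_1[of "\<lambda>k. vp (2 * node lam m k r)" r "\<lambda>l. vp (2 * node lam m l (r - 1))"]
    by (simp add: lagrange_weight_def e_conv)
qed

text \<open>
Lowering is blocked exactly when the entry equals the one with the same \<open>k\<close> in row \<open>r - 1\<close>, and then one factor
of the weight is \<open>e 0\<close>.
\<close>

lemma lagrange_weight_boundary:
  assumes m: "m \<in> patterns n" and kr: "k \<le> r" "r < n" and "shift (- 1) k r m \<notin> patterns n"
  shows "lagrange_weight k r m = 0"
proof -
  have k: "k < r" "\<not> m k r < m k (r - 1)"
    using assms by (auto simp: lower_pattern_iff)
  then have "m k r = m k (r - 1)"
    using pattern_step[OF m, of k "r - 1"] kr by simp
  then have "e (node lam m k r - node lam m k (r - 1)) = 0"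
    by (simp add: node_diff)
  then have "(\<Prod>l<r. e (node lam m k r - node lam m l (r - 1))) = 0"
    using k by (intro prod_zero) auto
  then show ?thesis by (simp add: lagrange_weight_def)
qed

lemma recurrence_from_moves:
  assumes m: "m \<in> patterns n" and r: "r < n"
    and y: "\<And>k. k \<le> r \<Longrightarrow> shift (- 1) k r m \<in> patterns n \<Longrightarrow>
      c k r (shift (- 1) k r m) * y (shift (- 1) k r m) = move_coeff k r m * y m"
  shows "(\<Sum>k\<le>r. if shift (- 1) k r m \<in> patterns n then c k r (shift (- 1) k r m) * y (shift (- 1) k r m) else 0)
    = kappa * vp (of_nat r * step_exponent m r) * y m"
proof -
  have "(\<Sum>k\<le>r. if shift (- 1) k r m \<in> patterns n then c k r (shift (- 1) k r m) * y (shift (- 1) k r m) else 0)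
     = (\<Sum>k\<le>r. kappa * vp (of_nat r * step_exponent m r) * y m * lagrange_weight k r m)"
    using lagrange_weight_boundary[OF m _ r] y by (intro sum.cong) (auto simp: move_coeff_def)
  also have "\<dots> = kappa * vp (of_nat r * step_exponent m r) * y m"
    unfolding sum_distrib_left[symmetric] sum_lagrange_weight[OF r] by simp
  finally show ?thesis .
qed

lemma step_exponent_lower: "step_exponent (shift (- 1) k r m) s = step_exponent m s
    - (if k \<le> Suc s \<and> Suc s = r then 1 else 0) - (if k < s \<and> s - 1 = r then 1 else 0)
    + (if k \<le> s \<and> s = r then 2 else 0)"
  unfolding step_exponent_def sum_entry_lower[OF finite_atMost] sum_entry_lower[OF finite_lessThan]
  by (auto simp: algebra_simps simp del: sum.atMost_Suc)

lemma step_exponent_lower_same: "k \<le> r \<Longrightarrow> step_exponent (shift (- 1) k r m) r = step_exponent m r + 2"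
  unfolding step_exponent_lower by auto

lemma step_exponent_lower_above: "k \<le> Suc r \<Longrightarrow> step_exponent (shift (- 1) k (Suc r) m) r = step_exponent m r - 1"
  unfolding step_exponent_lower by auto

lemma step_exponent_lower_below: "k \<le> r \<Longrightarrow> step_exponent (shift (- 1) k r m) (Suc r) = step_exponent m (Suc r) - 1"
  unfolding step_exponent_lower by auto

lemma step_exponent_lower_far: "Suc s < r \<or> Suc r < s \<Longrightarrow> step_exponent (shift (- 1) k r m) s = step_exponent m s"
  unfolding step_exponent_lower by auto

lemma qint_conv_e': "qint vp x = - vp (- x) * e x / (vp 1 - vp (- 1))"
  unfolding qint_conv_e using e_minus[of x]
  by (simp add: vp_double vp_minus vp_diff vp_add divide_inverse)

lemma e_qint_ratio_same: "e x * qint vp (x + 1) * e (1 - x) = e (- x) * qint vp (x - 1) * e (x + 1)"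
proof -
  have 1: "qint vp (x + 1) = - vp (- (x + 1)) * e (x + 1) / (vp 1 - vp (- 1))"
    by (rule qint_conv_e')
  have 2: "qint vp (x - 1) = vp (x - 1) * e (1 - x) / (vp 1 - vp (- 1))"
    unfolding qint_conv_e by simp
  have 3: "e x = - vp (2 * x) * e (- x)" by (rule e_minus)
  show ?thesis
    unfolding 1 2 3 by (simp add: vp_double vp_minus vp_diff vp_add divide_inverse)
qed

lemma e_qint_ratio_adjacent: "vp (- of_nat (Suc r)) * e (x + 1) * qint vp x = vp (- of_nat r) * e x * qint vp (x + 1)"
proof -
  have "vp (- of_nat (Suc r)) * vp (- x) = vp (- of_nat r) * vp (- (x + 1))"
    unfolding vp_add[symmetric] by (simp add: algebra_simps)
  then show ?thesis unfolding qint_conv_e' by (simp add: mult_ac)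
qed

lemma lagrange_weight_lower_same:
  assumes "k \<noteq> l" "k \<le> r" "l \<le> r" "r < n"
  shows "lagrange_weight k r (shift (- 1) l r m) * e (node lam m k r - node lam m l r + 1)
    = lagrange_weight k r m * e (node lam m k r - node lam m l r)"
proof -
  let ?x = "node lam m k r - node lam m l r"
  have nz: "e (?x + 1) \<noteq> 0" "e ?x \<noteq> 0"
    using e_node_generic[of l k m r r 1] e_node_generic[of l k m r r 0] assms by auto
  have "(\<Prod>j\<in>{..r} - {k}. inverse (e (node lam (shift (- 1) l r m) k r - node lam (shift (- 1) l r m) j r))) * inverse (e ?x)
      = (\<Prod>j\<in>{..r} - {k}. inverse (e (node lam m k r - node lam m j r))) * inverse (e (?x + 1))"
    using prod_change_one[of "{..r} - {k}" l "\<lambda>j. inverse (e (node lam (shift (- 1) l r m) k r - node lam (shift (- 1) l r m) j r))"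
        "\<lambda>j. inverse (e (node lam m k r - node lam m j r))"] assms
    by (simp add: node_shift algebra_simps)
  then have "(\<Prod>j\<in>{..r} - {k}. inverse (e (node lam (shift (- 1) l r m) k r - node lam (shift (- 1) l r m) j r))) * e (?x + 1)
      = (\<Prod>j\<in>{..r} - {k}. inverse (e (node lam m k r - node lam m j r))) * e ?x"
    using nz by (simp add: field_simps)
  moreover have "(\<Prod>j<r. e (node lam (shift (- 1) l r m) k r - node lam (shift (- 1) l r m) j (r - 1)))
      = (\<Prod>j<r. e (node lam m k r - node lam m j (r - 1)))"
    using assms by (intro prod.cong) (auto simp: node_shift)
  ultimately show ?thesis by (simp add: lagrange_weight_def mult.assoc)
qed

lemma lagrange_weight_lower_below:
  assumes "k \<le> Suc r" "l \<le> r"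
  shows "lagrange_weight k (Suc r) (shift (- 1) l r m) * e (node lam m k (Suc r) - node lam m l r)
    = lagrange_weight k (Suc r) m * e (node lam m k (Suc r) - node lam m l r + 1)"
proof -
  have "(\<Prod>j<Suc r. e (node lam (shift (- 1) l r m) k (Suc r) - node lam (shift (- 1) l r m) j r))
      * e (node lam m k (Suc r) - node lam m l r)
    = (\<Prod>j<Suc r. e (node lam m k (Suc r) - node lam m j r)) * e (node lam m k (Suc r) - node lam m l r + 1)"
    using prod_change_one[of "{..<Suc r}" l "\<lambda>j. e (node lam (shift (- 1) l r m) k (Suc r) - node lam (shift (- 1) l r m) j r)"
        "\<lambda>j. e (node lam m k (Suc r) - node lam m j r)"] assms
    by (simp add: node_shift algebra_simps del: prod.lessThan_Suc)
  then show ?thesis by (simp add: lagrange_weight_def node_shift mult_ac del: prod.lessThan_Suc)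
qed

lemma lagrange_weight_lower_other:
  assumes "s \<noteq> r" "Suc s \<noteq> r"
  shows "lagrange_weight k r (shift (- 1) l s m) = lagrange_weight k r m"
proof -
  have "(\<Prod>j<r. e (node lam (shift (- 1) l s m) k r - node lam (shift (- 1) l s m) j (r - 1)))
      = (\<Prod>j<r. e (node lam m k r - node lam m j (r - 1)))"
    using assms by (intro prod.cong) (auto simp: node_shift)
  then show ?thesis using assms by (simp add: lagrange_weight_def node_shift)
qed

text \<open>
Independence of the order of two moves, once the roots \<open>c\<close> have been eliminated by \<open>c_square_relation\<close>.  Apart from
powers of \<open>v\<close>, only the factors with the difference \<open>x\<close> of the two moved nodes change, and only if the rows are equal or adjacent.
\<close>

lemma move_square_identity:
  assumes N: "N \<in> patterns n" and Na: "shift (- 1) k r N \<in> patterns n" and Nb: "shift (- 1) l s N \<in> patterns n"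
    and Nab: "shift (- 1) k r (shift (- 1) l s N) \<in> patterns n"
    and kr: "k \<le> r" "r < n" and ls: "l \<le> s" "s < n" and ne: "(k, r) \<noteq> (l, s)" and sr: "s \<le> r"
  shows "move_coeff k r (shift (- 1) l s N) * move_coeff l s N * (c l s (shift (- 1) k r (shift (- 1) l s N)))\<^sup>2
    = move_coeff l s (shift (- 1) k r N) * move_coeff k r N * (c l s (shift (- 1) l s N))\<^sup>2"
proof -
  define a where "a = shift (- 1) k r N"
  define b' where "b' = shift (- 1) l s N"
  define ab where "ab = shift (- 1) k r b'"
  define num where "num p = c_num vp lam l (Suc s) p" for p
  define den where "den p = c_den vp lam l (Suc s) p" for p
  have cab: "(c l s ab)\<^sup>2 = - (num ab / den ab)" and cb: "(c l s b')\<^sup>2 = - (num b' / den b')"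
    using c_square[OF Nab ls] c_square[OF Nb ls] by (simp_all add: num_def den_def ab_def b'_def)
  have den0: "den ab \<noteq> 0" "den b' \<noteq> 0"
    using c_den_nonzero[OF Nab ls] c_den_nonzero[OF Nb ls] by (simp_all add: den_def ab_def b'_def)
  define x where "x = node lam N k r - node lam N l s"
  consider (same) "s = r" "k \<noteq> l" | (adj) "r = Suc s" | (far) "Suc s < r" using sr ne by force
  then have "move_coeff k r b' * move_coeff l s N * (c l s ab)\<^sup>2 = move_coeff l s a * move_coeff k r N * (c l s b')\<^sup>2"
  proof cases
    case same
    have k: "k < n" "l < n" using kr ls by auto
    have nz: "e (x + 1) \<noteq> 0" "e (1 - x) \<noteq> 0" "qint vp (x - 1) \<noteq> 0" "qint vp x \<noteq> 0"
      using e_node_generic[of l k N r r 1] e_node_generic[of k l N r r 1]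
        qint_node_generic[of l k N r r "- 1"] qint_node_generic[of l k N r r 0] k same
      by (simp_all add: x_def algebra_simps)
    have Rk: "move_coeff k r b' * e (x + 1) = move_coeff k r N * vp (of_nat r * 2) * e x"
      using lagrange_weight_lower_same[of k l r N] same kr ls step_exponent_lower_same[of l r N]
      by (simp add: move_coeff_def b'_def x_def distrib_left vp_add)
    have Rl: "move_coeff l s a * e (1 - x) = move_coeff l s N * vp (of_nat r * 2) * e (- x)"
      using lagrange_weight_lower_same[of l k r N] same kr ls step_exponent_lower_same[of k r N]
      by (simp add: move_coeff_def a_def x_def distrib_left vp_add algebra_simps)
    have num: "num ab = num b'"
    proof -
      have "(\<Prod>j<r. qint vp (node lam ab j (r - 1) - node lam ab l r - 1))
          = (\<Prod>j<r. qint vp (node lam b' j (r - 1) - node lam b' l r - 1))"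
        using same by (intro prod.cong) (auto simp: node_shift ab_def)
      then show ?thesis
        using same by (simp add: num_def c_num_eq node_shift ab_def)
    qed
    have xb: "node lam b' k r - node lam b' l r = x + 1"
      using same by (simp add: b'_def node_shift x_def)
    have xab: "node lam ab k r - node lam ab l r = x"
      using same by (simp add: ab_def b'_def node_shift x_def)
    have "den ab * (qint vp x * qint vp (x + 1)) = den b' * (qint vp (x - 1) * qint vp x)"
      using prod_change_one[of "{..r} - {l}" k
          "\<lambda>j. qint vp (node lam ab j r - node lam ab l r - 1) * qint vp (node lam ab j r - node lam ab l r)"
          "\<lambda>j. qint vp (node lam b' j r - node lam b' l r - 1) * qint vp (node lam b' j r - node lam b' l r)"]
        same kr unfolding den_def xb xab same(1) c_den_eq by (simp add: ab_def node_shift)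
    then have den: "den ab * qint vp (x + 1) = den b' * qint vp (x - 1)"
      using nz by simp
    have "(c l s ab)\<^sup>2 * qint vp (x - 1) = (c l s b')\<^sup>2 * qint vp (x + 1)"
      unfolding cab cb num using den den0 by (simp add: field_simps)
    then have C: "(c l s ab)\<^sup>2 = (c l s b')\<^sup>2 * qint vp (x + 1) / qint vp (x - 1)"
      using nz by (simp add: field_simps)
    have Rk': "move_coeff k r b' = move_coeff k r N * vp (of_nat r * 2) * e x / e (x + 1)"
      using Rk nz by (simp add: field_simps)
    have Rl': "move_coeff l s a = move_coeff l s N * vp (of_nat r * 2) * e (- x) / e (1 - x)"
      using Rl nz by (simp add: field_simps)
    have id: "e x * qint vp (x + 1) / (e (x + 1) * qint vp (x - 1)) = e (- x) / e (1 - x)"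
      using e_qint_ratio_same[of x] nz by (simp add: field_simps)
    have "move_coeff k r b' * move_coeff l s N * (c l s ab)\<^sup>2 = move_coeff k r N * move_coeff l s N * vp (of_nat r * 2) * (c l s b')\<^sup>2
        * (e x * qint vp (x + 1) / (e (x + 1) * qint vp (x - 1)))"
      unfolding C Rk' by simp
    also have "\<dots> = move_coeff l s a * move_coeff k r N * (c l s b')\<^sup>2"
      unfolding id Rl' by simp
    finally show ?thesis .
  next
    case adj
    \<comment> \<open>For \<open>k = l\<close> the genericity says nothing; instead \<open>N l r + 1\<close> is at most \<open>N l s\<close>, since the array lowered at \<open>(k, r)\<close> is a pattern.\<close>
    have nz: "e x \<noteq> 0 \<and> qint vp (x + 1) \<noteq> 0"
    proof (cases "k = l")
      case True
      have "N l r + 1 \<le> N l s"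
        using pattern_step[OF Na, of l s] adj ls kr True by (simp add: shift_apply)
      then show ?thesis
        using qint_node_same[of N l r s 0] qint_node_same[of N l r s 1] True
        by (simp add: x_def qint_eq_0_iff)
    next
      case False
      then show ?thesis
        using e_node_generic[of l k N r s 0] qint_node_generic[of l k N r s 1] kr ls by (simp add: x_def)
    qed
    have Rk: "move_coeff k r b' * e x = move_coeff k r N * vp (- of_nat (Suc s)) * e (x + 1)"
    proof -
      have "vp (of_nat r * step_exponent b' r) = vp (of_nat r * step_exponent N r) * vp (- of_nat (Suc s))"
      proof -
        have "step_exponent b' r = step_exponent N r - 1"
          using adj ls step_exponent_lower_below[of l s N] by (simp only: b'_def)
        then have "of_nat r * step_exponent b' r = of_nat r * step_exponent N r + - of_nat (Suc s)"
          using adj by (simp only:) (simp add: algebra_simps)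
        then show ?thesis by (simp only: vp_add)
      qed
      moreover have "lagrange_weight k r b' * e x = lagrange_weight k r N * e (x + 1)"
        using lagrange_weight_lower_below[of k s l N] adj kr ls by (simp add: b'_def x_def)
      moreover have "move_coeff k r b' * e x = kappa * vp (of_nat r * step_exponent b' r) * (lagrange_weight k r b' * e x)"
        by (simp only: move_coeff_def mult.assoc)
      ultimately show ?thesis by (simp add: move_coeff_def mult_ac)
    qed
    have Rl: "move_coeff l s a = move_coeff l s N * vp (- of_nat s)"
      using adj kr step_exponent_lower_above[of k s N]
      by (simp add: move_coeff_def a_def lagrange_weight_lower_other right_diff_distrib vp_diff vp_minus divide_inverse)
    have den: "den ab = den b'"
      unfolding den_def c_den_eq using adj by (simp add: ab_def node_shift)
    have xb: "node lam b' k r - node lam b' l s = x + 1"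
      using adj by (simp add: b'_def node_shift x_def)
    have xab: "node lam ab k r - node lam ab l s = x"
      using adj by (simp add: ab_def b'_def node_shift x_def)
    have "(\<Prod>j\<le>Suc s. qint vp (node lam ab j (Suc s) - node lam ab l s)) * qint vp (x + 1)
        = (\<Prod>j\<le>Suc s. qint vp (node lam b' j (Suc s) - node lam b' l s)) * qint vp x"
      using prod_change_one[of "{..Suc s}" k
          "\<lambda>j. qint vp (node lam ab j (Suc s) - node lam ab l s)"
          "\<lambda>j. qint vp (node lam b' j (Suc s) - node lam b' l s)"]
        kr unfolding xb[unfolded adj] xab[unfolded adj] using adj by (simp add: ab_def node_shift del: prod.atMost_Suc)
    moreover have "(\<Prod>j<s. qint vp (node lam ab j (s - 1) - node lam ab l s - 1))
        = (\<Prod>j<s. qint vp (node lam b' j (s - 1) - node lam b' l s - 1))"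
      using adj by (intro prod.cong) (auto simp: node_shift ab_def)
    ultimately have "num ab * qint vp (x + 1) = num b' * qint vp x"
      by (simp add: num_def c_num_eq mult_ac del: prod.atMost_Suc)
    then have "(c l s ab)\<^sup>2 * qint vp (x + 1) = (c l s b')\<^sup>2 * qint vp x"
      unfolding cab cb den by simp
    then have C: "(c l s ab)\<^sup>2 = (c l s b')\<^sup>2 * qint vp x / qint vp (x + 1)"
      using nz by (simp add: field_simps)
    have Rk': "move_coeff k r b' = move_coeff k r N * vp (- of_nat (Suc s)) * e (x + 1) / e x"
      using Rk nz by (simp add: field_simps)
    have id: "vp (- of_nat (Suc s)) * e (x + 1) * qint vp x / (e x * qint vp (x + 1)) = vp (- of_nat s)"
      using e_qint_ratio_adjacent[of s x] nz by (simp add: field_simps)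
    have "move_coeff k r b' * move_coeff l s N * (c l s ab)\<^sup>2 = move_coeff k r N * move_coeff l s N * (c l s b')\<^sup>2
        * (vp (- of_nat (Suc s)) * e (x + 1) * qint vp x / (e x * qint vp (x + 1)))"
      unfolding C Rk' by simp
    also have "\<dots> = move_coeff l s a * move_coeff k r N * (c l s b')\<^sup>2"
      unfolding id Rl by simp
    finally show ?thesis .
  next
    case far
    have "move_coeff k r b' = move_coeff k r N" "move_coeff l s a = move_coeff l s N"
      using far by (simp_all add: move_coeff_def a_def b'_def lagrange_weight_lower_other step_exponent_lower_far)
    moreover have "den ab = den b'"
      unfolding den_def c_den_eq using far by (simp add: ab_def node_shift)
    moreover have "num ab = num b'"
    proof -
      have "s - Suc 0 \<noteq> r" "s \<noteq> r" "Suc s \<noteq> r" using far by linarith+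
      then show ?thesis by (simp add: num_def c_num_eq ab_def node_shift)
    qed
    ultimately show ?thesis unfolding cab cb by simp
  qed
  then show ?thesis by (simp add: a_def b'_def ab_def)
qed


section \<open>The square of the claimed coefficient\<close>

text \<open>
The square of the factor \<open>C\<^sub>i\<close> of the claimed coefficient.  Rows with index \<open>0\<close> are harmless: the factor for
\<open>i = 0\<close> is \<open>1\<close>, whatever \<open>i - 1\<close> is, so that the product may start at \<open>0\<close>.
\<close>

definition row_coeff_square :: "nat \<Rightarrow> pattern \<Rightarrow> 'r" where
  "row_coeff_square i m = (vp (p_exp i (row lam m i) (row lam m (i - 1))))\<^sup>2
     * A_square vp i (row lam m i) (row lam m (i - 1)) (\<lambda>k. nat (m k (i - 1) - m k i))"

lemma row_coeff_square_0: "row_coeff_square 0 m = 1"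
  by (simp add: row_coeff_square_def p_exp_def A_square_def)

lemma row_lower_other: "i \<noteq> r \<Longrightarrow> row lam (shift (- 1) k r m) i = row lam m i"
  by (auto simp: row_def entry_shift)

lemma row_lower: "k \<le> r \<Longrightarrow> row lam (shift (- 1) k r m) r = (row lam m r)(k := row lam m r k - 1)"
  by (auto simp: row_def entry_shift fun_eq_iff)

lemma row_coeff_square_lower_other:
  assumes "i \<noteq> r" "i \<noteq> Suc r"
  shows "row_coeff_square i (shift (- 1) k r m) = row_coeff_square i m"
proof (cases i)
  case (Suc i')
  then have "row lam (shift (- 1) k r m) i = row lam m i" "row lam (shift (- 1) k r m) (i - 1) = row lam m (i - 1)"
    "(\<lambda>l. nat (shift (- 1) k r m l (i - 1) - shift (- 1) k r m l i)) = (\<lambda>l. nat (m l (i - 1) - m l i))"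
    using assms by (auto simp: row_lower_other shift_apply)
  then show ?thesis by (simp only: row_coeff_square_def)
qed (simp add: row_coeff_square_0)

lemma prod_qint_e:
  assumes "finite S"
  shows "(\<Prod>l\<in>S. qint vp (f l)) = vp (\<Sum>l\<in>S. f l) * (\<Prod>l\<in>S. e (- f l)) / (vp 1 - vp (- 1)) ^ card S"
  unfolding qint_conv_e prod_dividef prod.distrib vp_sum using assms by simp

text \<open>
Numerator and denominator have the same number \<open>r\<close> of factors, so passing from \<open>[x]\<close> to \<open>e x\<close> costs only a power
of \<open>v\<close>.
\<close>

lemma qint_quotient_lagrange_weight:
  assumes "k \<le> r"
  shows "(\<Prod>l<r. qint vp (node lam m l (r - 1) - node lam m k r)) / (\<Prod>l\<in>{..r} - {k}. qint vp (node lam m l r - node lam m k r))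
    = vp ((\<Sum>l<r. node lam m l (r - 1)) - (\<Sum>l\<le>r. node lam m l r) + node lam m k r) * lagrange_weight k r m"
proof -
  have card: "card ({..r} - {k}) = r" using assms by simp
  have "(\<Sum>l\<in>{..r} - {k}. node lam m l r) = (\<Sum>l\<le>r. node lam m l r) - node lam m k r"
    using assms by (subst sum.remove[of "{..r}" k]) auto
  then have ex: "(\<Sum>l<r. node lam m l (r - 1) - node lam m k r) - (\<Sum>l\<in>{..r} - {k}. node lam m l r - node lam m k r)
      = (\<Sum>l<r. node lam m l (r - 1)) - (\<Sum>l\<le>r. node lam m l r) + node lam m k r"
    by (simp only: sum_subtractf sum_constant card card_lessThan) simp
  have inv: "(\<Prod>l\<in>{..r} - {k}. inverse (e (node lam m k r - node lam m l r)))
      = inverse (\<Prod>l\<in>{..r} - {k}. e (node lam m k r - node lam m l r))"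
    using prod_inversef[of "\<lambda>l. e (node lam m k r - node lam m l r)"] by (simp add: o_def)
  have "(vp 1 - vp (- 1)) ^ r \<noteq> 0"
    using vp_1_minus_inverse_nonzero by simp
  then show ?thesis
    unfolding prod_qint_e[OF finite_lessThan] prod_qint_e[OF finite_Diff[OF finite_atMost]] card card_lessThan
      ex[symmetric] vp_diff[of "sum _ _" "sum _ _"] lagrange_weight_def inv minus_diff_eq
    by (simp add: divide_simps)
qed

text \<open>
The exponents \<open>p\<^sub>i\<close> are made for this identity: they turn the power of \<open>v\<close> from
\<open>qint_quotient_lagrange_weight\<close> into the one required by the recurrence.
\<close>

lemma p_exp_step:
  assumes k: "k \<le> r"
  shows "p_exp (Suc r) (row lam m (Suc r)) ((row lam m r)(k := row lam m r k - 1))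
      + p_exp r ((row lam m r)(k := row lam m r k - 1)) (row lam m (r - 1))
      + ((\<Sum>l<r. node lam m l (r - 1)) - (\<Sum>l\<le>r. node lam m l r) + node lam m k r)
    = p_exp (Suc r) (row lam m (Suc r)) (row lam m r) + p_exp r (row lam m r) (row lam m (r - 1)) + of_nat r * step_exponent m r"
proof -
  define \<tau> where "\<tau> = (\<Sum>l\<le>Suc r. entry lam m l (Suc r))"
  define \<sigma> where "\<sigma> = (\<Sum>l\<le>r. entry lam m l r)"
  define \<rho>' where "\<rho>' = (\<Sum>l<r. entry lam m l (r - 1))"
  have s: "(\<Sum>l\<le>Suc r. row lam m (Suc r) l) = \<tau>" "(\<Sum>l\<le>r. row lam m r l) = \<sigma>" "(\<Sum>l<r. row lam m (r - 1) l) = \<rho>'"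
    unfolding \<tau>_def \<sigma>_def \<rho>'_def by (auto simp: row_def intro!: sum.cong)
  have row_k: "row lam m r k = node lam m k r + of_nat k"
    using k by (simp add: row_def node_def)
  have n1: "(\<Sum>l<r. node lam m l (r - 1)) = \<rho>' - of_nat (\<Sum>l<r. l)"
    by (simp add: \<rho>'_def node_def sum_subtractf)
  have n2: "(\<Sum>l\<le>r. node lam m l r) = \<sigma> - of_nat (\<Sum>l<r. l) - of_nat r"
    by (simp add: \<sigma>_def node_def sum_subtractf atMost_Suc_eq_insert_0 lessThan_Suc_atMost[symmetric])
  have kk: "of_nat (k * (Suc r - k)) = (of_nat (k * (r - k)) + of_nat k :: 'l)"
  proof -
    have "k * (Suc r - k) = k * (r - k) + k" using k by (simp add: Suc_diff_le)
    then show ?thesis by (simp only: of_nat_add)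
  qed
  have w: "step_exponent m r = \<tau> + \<rho>' - 2 * \<sigma> + 2"
    by (simp only: step_exponent_def \<tau>_def \<sigma>_def \<rho>'_def)
  show ?thesis
    unfolding p_exp_lower_snd[OF k] p_exp_lower_fst[OF k] unfolding s n1 n2 kk w row_k
    by (simp add: algebra_simps)
qed

text \<open>
In the product of the two affected factors with \<open>c\<^sup>2\<close>, the quantum integers that involve row \<open>r + 1\<close> cancel, and the
others combine to the square of the quotient in \<open>qint_quotient_lagrange_weight\<close>.
\<close>

lemma row_coeff_square_step:
  assumes m: "m \<in> patterns n" and m': "shift (- 1) k r m \<in> patterns n" and kr: "k \<le> r" "r < n"
  shows "(c k r (shift (- 1) k r m))\<^sup>2 * (row_coeff_square (Suc r) (shift (- 1) k r m) * row_coeff_square r (shift (- 1) k r m))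
    = (vp (of_nat r * step_exponent m r) * lagrange_weight k r m)\<^sup>2 * (row_coeff_square (Suc r) m * row_coeff_square r m)"
proof -
  define m' where "m' = shift (- 1) k r m"
  define a where "a l = node lam m l r" for l
  define bb where "bb l = node lam m l (r - 1)" for l
  define cc where "cc l = node lam m l (Suc r)" for l
  define x where "x = a k"
  have pm': "m' \<in> patterns n" using m' by (simp add: m'_def)
  have rem: "removable n m' k r"
    unfolding m'_def by (rule lower_removable[OF m m' kr])
  have node': "node lam m' k r = x - 1" "node lam m' l (Suc r) = cc l" "l < r \<Longrightarrow> node lam m' l (r - 1) = bb l"
    "l \<noteq> k \<Longrightarrow> node lam m' l r = a l" for l
    by (auto simp: m'_def node_shift x_def a_def bb_def cc_def)
  have nzc: "qint vp (cc l - x + 1) \<noteq> 0" if "l \<le> Suc r" for l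
    using c_num_upper_nonzero[OF pm' rem that] by (simp add: node' algebra_simps)
  have nzb: "qint vp (bb l - x) \<noteq> 0" if "l < r" for l
    using c_num_lower_nonzero[OF pm' rem that] unfolding node'(1) node'(3)[OF that] by simp
  have nza: "qint vp (a l - x) \<noteq> 0" "qint vp (a l - x + 1) \<noteq> 0" if "l \<le> r" "l \<noteq> k" for l
    using qint_node_generic[of k l m r r 0] qint_node_generic[of k l m r r 1] that kr
    by (auto simp: a_def x_def)
  define C where "C = (\<Prod>l\<le>Suc r. qint vp (cc l - x + 1))"
  define B where "B = (\<Prod>l<r. qint vp (bb l - x))"
  define D where "D = (\<Prod>l\<in>{..r} - {k}. qint vp (a l - x))"
  define D1 where "D1 = (\<Prod>l\<in>{..r} - {k}. qint vp (a l - x + 1))"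
  define Y where "Y = (\<Prod>l\<in>{..r} - {k}. if l < k then 1 else qint vp (a l - x))"
  define Y2 where "Y2 = (\<Prod>l\<in>{..r} - {k}. if l < k then qint vp (a l - x) else 1)"
  define Z where "Z = (\<Prod>l\<in>{..r} - {k}. if l < k then qint vp (a l - x + 1) else 1)"
  define Z2 where "Z2 = (\<Prod>l\<in>{..r} - {k}. if l < k then 1 else qint vp (a l - x + 1))"
  have YY: "D = Y * Y2" and ZZ: "D1 = Z * Z2"
    unfolding D_def D1_def Y_def Y2_def Z_def Z2_def prod.distrib[symmetric]
    by (rule prod.cong, simp, simp)+
  have nz: "C \<noteq> 0" "B \<noteq> 0" "D \<noteq> 0" "D1 \<noteq> 0"
    using nza nzb nzc by (auto simp: C_def B_def D_def D1_def)
  then have nz2: "Y \<noteq> 0" "Y2 \<noteq> 0" "Z \<noteq> 0" "Z2 \<noteq> 0" by (auto simp: YY ZZ)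
  have c2: "(c k r m')\<^sup>2 = - (B * C / (D * D1))"
  proof -
    have "c_num vp lam k (Suc r) m' = B * C"
      unfolding c_num_eq B_def C_def
      by (intro arg_cong2[of _ _ _ _ "(*)"] prod.cong) (auto simp: node' node'(3)[unfolded One_nat_def] algebra_simps)
    moreover have "c_den vp lam k (Suc r) m' = D * D1"
      unfolding c_den_eq D_def D1_def prod.distrib[symmetric] by (intro prod.cong) (auto simp: node' algebra_simps)
    ultimately show ?thesis using c_square[OF pm' kr] by simp
  qed
  define \<mu> where "\<mu> = row lam m (Suc r)"
  define \<nu> where "\<nu> = row lam m r"
  define \<eta> where "\<eta> = row lam m (r - 1)"
  define \<nu>' where "\<nu>' = \<nu>(k := \<nu> k - 1)"
  define d1 where "d1 l = nat (m l r - m l (Suc r))" for l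
  define d0 where "d0 l = nat (m l (r - 1) - m l r)" for l
  define AS1 where "AS1 = A_square vp (Suc r) \<mu> \<nu> d1"
  define AS0 where "AS0 = A_square vp r \<nu> \<eta> d0"
  define AS1' where "AS1' = A_square vp (Suc r) \<mu> \<nu>' (d1(k := Suc (d1 k)))"
  define AS0' where "AS0' = A_square vp r \<nu>' \<eta> (d0(k := d0 k - 1))"
  have a_eq: "\<nu> l - of_nat l = a l" if "l \<le> r" for l using that by (simp add: \<nu>_def a_def row_def node_def)
  have c_eq: "\<mu> l - of_nat l = cc l" if "l \<le> Suc r" for l using that by (simp add: \<mu>_def cc_def row_def node_def)
  have b_eq: "\<eta> l - of_nat l = bb l" if "l < r" for l using that by (auto simp add: \<eta>_def bb_def row_def node_def)
  have snd: "AS1' * C * Y = - AS1 * Z"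
  proof -
    have "\<mu> l - \<nu> l = of_nat (d1 l)" if "l \<le> r" for l
    proof -
      have "m l (Suc r) \<le> m l r" using that kr by (intro pattern_step[OF m]) auto
      then have "of_nat (d1 l) = (of_int (m l r - m l (Suc r)) :: 'l)" by (simp add: d1_def of_nat_nat)
      then show ?thesis using that by (simp add: \<mu>_def \<nu>_def row_def entry_def)
    qed
    note * = A_square_lower_snd[where \<mu> = \<mu> and \<nu> = \<nu> and d = d1 and j = k and r = r, OF kr(1) this]
    have "AS1' * (\<Prod>l\<le>Suc r. qint vp (\<mu> l - of_nat l - (\<nu> k - of_nat k) + 1))
        * (\<Prod>l\<in>{..r} - {k}. if l < k then 1 else qint vp (\<nu> l - of_nat l - (\<nu> k - of_nat k)))
      = - AS1 * (\<Prod>l\<in>{..r} - {k}. if l < k then qint vp (\<nu> l - of_nat l - (\<nu> k - of_nat k) + 1) else 1)"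
      unfolding AS1'_def AS1_def \<nu>'_def
      using nza nzc kr by (intro *) (auto simp: a_eq c_eq x_def)
    moreover have "(\<Prod>l\<le>Suc r. qint vp (\<mu> l - of_nat l - (\<nu> k - of_nat k) + 1)) = C"
      unfolding C_def using kr by (intro prod.cong) (auto simp: a_eq c_eq x_def)
    moreover have "(\<Prod>l\<in>{..r} - {k}. if l < k then 1 else qint vp (\<nu> l - of_nat l - (\<nu> k - of_nat k))) = Y"
      unfolding Y_def using kr by (intro prod.cong) (auto simp: a_eq x_def)
    moreover have "(\<Prod>l\<in>{..r} - {k}. if l < k then qint vp (\<nu> l - of_nat l - (\<nu> k - of_nat k) + 1) else 1) = Z"
      unfolding Z_def using kr by (intro prod.cong) (auto simp: a_eq x_def)
    ultimately show ?thesis by simp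
  qed
  have fst: "AS0' * Y2 = AS0 * B * Z2"
  proof -
    have d: "\<nu> l - \<eta> l = of_nat (d0 l)" if "l < r" for l
    proof -
      have "m l (Suc (r - 1)) \<le> m l (r - 1)" using that kr by (intro pattern_step[OF m]) auto
      then have "of_nat (d0 l) = (of_int (m l (r - 1) - m l r) :: 'l)" using that by (simp add: d0_def of_nat_nat)
      then show ?thesis using that by (auto simp add: \<eta>_def \<nu>_def row_def entry_def)
    qed
    have d0: "k < r \<Longrightarrow> 0 < d0 k"
      using m' lower_pattern_iff[OF m kr] by (simp add: d0_def)
    note * = A_square_lower_fst[where \<mu> = \<nu> and \<nu> = \<eta> and d = d0 and j = k and r = r, OF kr(1) d d0]
    have "AS0' * (\<Prod>l\<in>{..r} - {k}. if l < k then qint vp (\<nu> l - of_nat l - (\<nu> k - of_nat k)) else 1)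
      = AS0 * (\<Prod>l<r. qint vp (\<eta> l - of_nat l - (\<nu> k - of_nat k)))
         * (\<Prod>l\<in>{..r} - {k}. if l < k then 1 else qint vp (\<nu> l - of_nat l - (\<nu> k - of_nat k) + 1))"
      unfolding AS0'_def AS0_def \<nu>'_def
      using nza nzb kr by (intro *) (auto simp: a_eq b_eq x_def)
    moreover have "(\<Prod>l<r. qint vp (\<eta> l - of_nat l - (\<nu> k - of_nat k))) = B"
      unfolding B_def using kr by (intro prod.cong) (auto simp: a_eq b_eq x_def)
    moreover have "(\<Prod>l\<in>{..r} - {k}. if l < k then qint vp (\<nu> l - of_nat l - (\<nu> k - of_nat k)) else 1) = Y2"
      unfolding Y2_def using kr by (intro prod.cong) (auto simp: a_eq x_def)
    moreover have "(\<Prod>l\<in>{..r} - {k}. if l < k then 1 else qint vp (\<nu> l - of_nat l - (\<nu> k - of_nat k) + 1)) = Z2"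
      unfolding Z2_def using kr by (intro prod.cong) (auto simp: a_eq x_def)
    ultimately show ?thesis by simp
  qed
  have A: "(c k r m')\<^sup>2 * (AS1' * AS0') = (B / D)\<^sup>2 * (AS1 * AS0)"
  proof -
    have AS1': "AS1' = - AS1 * Z / (C * Y)" and AS0': "AS0' = AS0 * B * Z2 / Y2"
      using snd fst nz nz2 by (simp_all add: field_simps)
    show ?thesis
      unfolding c2 AS1' AS0' YY ZZ using nz nz2 by (simp add: field_simps power2_eq_square)
  qed
  have T1: "row_coeff_square (Suc r) m = (vp (p_exp (Suc r) \<mu> \<nu>))\<^sup>2 * AS1" and T0: "row_coeff_square r m = (vp (p_exp r \<nu> \<eta>))\<^sup>2 * AS0"
    by (simp_all add: row_coeff_square_def AS1_def AS0_def \<mu>_def \<nu>_def \<eta>_def d1_def[abs_def] d0_def[abs_def])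
  have T1': "row_coeff_square (Suc r) m' = (vp (p_exp (Suc r) \<mu> \<nu>'))\<^sup>2 * AS1'"
  proof -
    have "row lam m' (Suc r) = \<mu>" "row lam m' r = \<nu>'"
      using kr by (simp_all add: m'_def \<mu>_def \<nu>_def \<nu>'_def row_lower_other row_lower)
    moreover have "(\<lambda>l. nat (m' l r - m' l (Suc r))) = d1(k := Suc (d1 k))"
      using pattern_step[OF m kr] by (auto simp: m'_def shift_apply d1_def fun_eq_iff)
    ultimately show ?thesis by (simp only: row_coeff_square_def AS1'_def diff_Suc_1)
  qed
  have T0': "row_coeff_square r m' = (vp (p_exp r \<nu>' \<eta>))\<^sup>2 * AS0'"
  proof -
    have 1: "row lam m' r = \<nu>'"
      using kr by (simp add: m'_def \<nu>_def \<nu>'_def row_lower)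
    have 2: "row lam m' (r - 1) l = \<eta> l" if "l < r" for l
      using that by (simp add: m'_def \<eta>_def row_lower_other)
    have 3: "nat (m' l (r - 1) - m' l r) = (d0(k := d0 k - 1)) l" if "l < r" for l
      using that by (auto simp: m'_def d0_def shift_apply)
    show ?thesis
      unfolding row_coeff_square_def 1 AS0'_def
      using p_exp_cong[of r \<nu>' \<nu>' "row lam m' (r - 1)" \<eta>]
        A_square_cong[of r \<nu>' \<nu>' "row lam m' (r - 1)" \<eta> "\<lambda>l. nat (m' l (r - 1) - m' l r)" "d0(k := d0 k - 1)"] 2 3
      by simp
  qed
  have BD: "B / D = vp ((\<Sum>l<r. bb l) - (\<Sum>l\<le>r. a l) + x) * lagrange_weight k r m"
    using qint_quotient_lagrange_weight[OF kr(1), of m] by (simp add: B_def D_def bb_def a_def x_def)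
  have V: "vp (p_exp (Suc r) \<mu> \<nu>') * vp (p_exp r \<nu>' \<eta>) * vp ((\<Sum>l<r. bb l) - (\<Sum>l\<le>r. a l) + x)
      = vp (p_exp (Suc r) \<mu> \<nu>) * vp (p_exp r \<nu> \<eta>) * vp (of_nat r * step_exponent m r)"
    using arg_cong[OF p_exp_step[OF kr(1), of m], where f = vp]
    by (simp only: vp_add mult.assoc \<mu>_def \<nu>_def \<nu>'_def \<eta>_def bb_def a_def x_def)
  have "(c k r m')\<^sup>2 * (row_coeff_square (Suc r) m' * row_coeff_square r m')
      = (vp (p_exp (Suc r) \<mu> \<nu>') * vp (p_exp r \<nu>' \<eta>))\<^sup>2 * ((c k r m')\<^sup>2 * (AS1' * AS0'))"
    unfolding T1' T0' by (simp add: power_mult_distrib mult_ac)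
  also have "\<dots> = (vp (p_exp (Suc r) \<mu> \<nu>') * vp (p_exp r \<nu>' \<eta>) * vp ((\<Sum>l<r. bb l) - (\<Sum>l\<le>r. a l) + x))\<^sup>2
      * (lagrange_weight k r m)\<^sup>2 * (AS1 * AS0)"
    unfolding A BD by (simp add: power_mult_distrib mult_ac)
  also have "\<dots> = (vp (of_nat r * step_exponent m r) * lagrange_weight k r m)\<^sup>2 * (row_coeff_square (Suc r) m * row_coeff_square r m)"
    unfolding V T1 T0 by (simp add: power_mult_distrib mult_ac)
  finally show ?thesis unfolding m'_def .
qed

definition coeff_square :: "pattern \<Rightarrow> 'r" where
  "coeff_square m = (kappa powi ht n m)\<^sup>2 * (\<Prod>i\<le>n. row_coeff_square i m)"

lemma coeff_square_step:
  assumes m: "m \<in> patterns n" and m': "shift (- 1) k r m \<in> patterns n" and kr: "k \<le> r" "r < n"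
  shows "(c k r (shift (- 1) k r m))\<^sup>2 * coeff_square (shift (- 1) k r m) = (move_coeff k r m)\<^sup>2 * coeff_square m"
proof -
  have split: "(\<Prod>i\<le>n. row_coeff_square i p) = (row_coeff_square (Suc r) p * row_coeff_square r p) * (\<Prod>i\<in>{..n} - {r} - {Suc r}. row_coeff_square i p)" for p
    using kr by (subst prod.remove[of _ r], simp, simp, subst prod.remove[of _ "Suc r"]) (simp_all add: mult_ac)
  have other: "(\<Prod>i\<in>{..n} - {r} - {Suc r}. row_coeff_square i (shift (- 1) k r m)) = (\<Prod>i\<in>{..n} - {r} - {Suc r}. row_coeff_square i m)"
    by (intro prod.cong) (auto simp: row_coeff_square_lower_other)
  have ht: "kappa powi ht n (shift (- 1) k r m) = kappa * kappa powi ht n m"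
    using kr kappa_nonzero by (simp add: ht_shift power_int_add)
  show ?thesis
    unfolding coeff_square_def split other ht move_coeff_def power_mult_distrib
    using row_coeff_square_step[OF assms] by (simp add: power_mult_distrib mult_ac)
qed

lemma coeff_square_top: "coeff_square (\<lambda>k i. 0) = 1"
proof -
  have "row_coeff_square i (\<lambda>k i. 0) = 1" for i
  proof -
    define \<mu> where "\<mu> = row lam (\<lambda>k i. 0) i"
    have 1: "p_exp i \<mu> (row lam (\<lambda>k i. 0) (i - 1)) = p_exp i \<mu> \<mu>"
      by (rule p_exp_cong) (auto simp: \<mu>_def row_def entry_def)
    have "(\<Sum>l\<le>i. \<Sum>k<l. \<mu> k * \<mu> l) = (\<Sum>l<i. \<Sum>k<l. \<mu> k * \<mu> l) + (\<Sum>k<i. \<mu> k) * \<mu> i"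
      by (simp add: lessThan_Suc_atMost[symmetric] sum_distrib_right)
    moreover have "(\<Sum>k\<le>i. \<mu> k) = (\<Sum>k<i. \<mu> k) + \<mu> i"
      by (simp add: lessThan_Suc_atMost[symmetric])
    ultimately have "p_exp i \<mu> \<mu> = 0"
      by (simp add: p_exp_def algebra_simps)
    then show ?thesis
      using 1 by (simp add: row_coeff_square_def \<mu>_def A_square_def qfact_def)
  qed
  then show ?thesis by (simp add: coeff_square_def ht_def)
qed

lemma whittaker_coeff_square:
  assumes m: "m \<in> patterns n" and A: "A_roots n vp A"
  shows "(whittaker_coeff n vp lam A m)\<^sup>2 = coeff_square m"
proof -
  have "(C_coeff vp A i (row lam m i) (row lam m (i - 1)))\<^sup>2 = row_coeff_square i m" if i: "i \<in> {1..n}" for i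
  proof -
    have *: "row lam m i k - row lam m (i - 1) k = of_nat (nat (m k (i - 1) - m k i))" if "k < i" for k
    proof -
      have "m k (Suc (i - 1)) \<le> m k (i - 1)"
        using that i by (intro pattern_step[OF m]) auto
      then have "m k i \<le> m k (i - 1)" using that by simp
      then show ?thesis using that by (auto simp: row_def entry_def of_nat_nat)
    qed
    have "(A i (row lam m i) (row lam m (i - 1)))\<^sup>2
        = A_square vp i (row lam m i) (row lam m (i - 1)) (\<lambda>k. nat (m k (i - 1) - m k i))"
      by (rule A[unfolded A_roots_def, rule_format, OF i *])
    then show ?thesis by (simp add: C_coeff_def row_coeff_square_def power_mult_distrib)
  qed
  then have "(\<Prod>i=1..n. C_coeff vp A i (row lam m i) (row lam m (i - 1)))\<^sup>2 = (\<Prod>i=1..n. row_coeff_square i m)"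
    unfolding prod_power_distrib by (intro prod.cong) auto
  also have "\<dots> = (\<Prod>i\<le>n. row_coeff_square i m)"
    by (intro prod.mono_neutral_left) (auto simp: row_coeff_square_0 Suc_le_eq)
  finally show ?thesis
    unfolding whittaker_coeff_def coeff_square_def kappa_def power_mult_distrib by simp
qed


section \<open>Existence and uniqueness of solutions of the recurrence\<close>

text \<open>
By symmetry the first of the two moves may be assumed to lie in the row with the smaller index.
\<close>

lemma move_order_irrelevant:
  assumes m: "m \<in> patterns n" and kr: "removable n m k r" and ls: "removable n m l s" and ne: "(k, r) \<noteq> (l, s)"
  shows "move_coeff k r (shift 1 k r m) / c k r m * (move_coeff l s (shift 1 l s (shift 1 k r m)) / c l s (shift 1 k r m))
    = move_coeff l s (shift 1 l s m) / c l s m * (move_coeff k r (shift 1 k r (shift 1 l s m)) / c k r (shift 1 l s m))"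
  using kr ls ne
proof (induction r s arbitrary: k l rule: linorder_wlog)
  case (le s r)
  define p where "p = shift 1 k s m"
  define q where "q = shift 1 l r m"
  define N where "N = shift 1 l r p"
  have rem: "removable n p l r" "removable n q k s"
    using removable_other[OF m] le by (auto simp: p_def q_def)
  have pq: "p \<in> patterns n" "q \<in> patterns n"
    using removable_raise[OF m] le by (auto simp: p_def q_def)
  have N: "N \<in> patterns n"
    unfolding N_def by (rule removable_raise[OF pq(1) rem(1)])
  have N_eq: "shift 1 k s q = N"
    by (simp only: N_def p_def q_def shift_commute[of 1 k s 1 l r])
  have undo: "shift (- 1) l r N = p" "shift (- 1) l r q = m"
    by (simp_all add: N_def q_def)
  have undo': "shift (- 1) k s N = q"
    unfolding N_eq[symmetric] by simp
  have nz: "c k s m \<noteq> 0" "c l r m \<noteq> 0" "c l r p \<noteq> 0" "c k s q \<noteq> 0"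
    using c_nonzero m pq rem le by auto
  have sq: "c k s m * c l r m = c k s q * c l r p"
    using c_square_relation[OF m le(2,3,4)] by (simp add: p_def q_def)
  have "move_coeff l r q * move_coeff k s N * (c k s m)\<^sup>2 = move_coeff k s p * move_coeff l r N * (c k s q)\<^sup>2"
    using move_square_identity[of N l r k s] le N pq m undo undo' by (auto simp: removable_def)
  then have A: "move_coeff k s p * move_coeff l r N * (c k s q * c k s q) = move_coeff l r q * move_coeff k s N * (c k s m * c k s m)"
    by (simp add: power2_eq_square)
  have "c k s m * (move_coeff k s p * move_coeff l r N * (c k s q * c l r m)) = move_coeff k s p * move_coeff l r N * c k s q * (c k s m * c l r m)"
    by (simp only: mult_ac)
  also have "\<dots> = move_coeff k s p * move_coeff l r N * (c k s q * c k s q) * c l r p"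
    unfolding sq by (simp only: mult_ac)
  also have "\<dots> = c k s m * (move_coeff l r q * move_coeff k s N * (c k s m * c l r p))"
    unfolding A by (simp only: mult_ac)
  finally have "move_coeff k s p * move_coeff l r N * (c k s q * c l r m) = move_coeff l r q * move_coeff k s N * (c k s m * c l r p)"
    using nz by simp
  then show ?case
    unfolding p_def[symmetric] q_def[symmetric] N_def[symmetric] N_eq using nz by (simp add: field_simps)
next
  case (sym r s)
  then show ?case by (metis)
qed

text \<open>
The solution of the recurrence built move by move.  Its values depend on the choice of the roots \<open>c\<close>, but their
squares do not: these are the squares of the claimed coefficients.
\<close>

lemma move_potential:
  assumes "y0\<^sup>2 = 1"
  shows "\<exists>y. y (\<lambda>k i. 0) = y0
    \<and> (\<forall>m\<in>patterns n. \<forall>k r. removable n m k r \<longrightarrow> c k r m * y m = move_coeff k r (shift 1 k r m) * y (shift 1 k r m))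
    \<and> (\<forall>m\<in>patterns n. (y m)\<^sup>2 = coeff_square m)"
proof -
  obtain y where y0: "y (\<lambda>k i. 0) = y0"
    and y: "\<And>m k r. m \<in> patterns n \<Longrightarrow> removable n m k r \<Longrightarrow> y m = move_coeff k r (shift 1 k r m) / c k r m * y (shift 1 k r m)"
    using pattern_potential[of n "\<lambda>k r m. move_coeff k r (shift 1 k r m) / c k r m" y0] move_order_irrelevant by blast
  have move: "c k r m * y m = move_coeff k r (shift 1 k r m) * y (shift 1 k r m)" if "m \<in> patterns n" "removable n m k r" for m k r
    using y[OF that] c_nonzero[OF that] by simp
  have "(y m)\<^sup>2 = coeff_square m" if "m \<in> patterns n" "nat (ht n m) = N" for m N
    using that
  proof (induction N arbitrary: m)
    case 0
    then have "m = (\<lambda>k i. 0)" using ht_eq_0 ht_nonneg[of m n] by simp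
    then show ?case using y0 assms coeff_square_top by simp
  next
    case (Suc N)
    then have "m \<noteq> (\<lambda>k i. 0)" by (auto simp: ht_def)
    then obtain k r where kr: "removable n m k r" using nonzero_pattern_removable Suc.prems(1) by blast
    define p where "p = shift 1 k r m"
    have p: "p \<in> patterns n" unfolding p_def by (rule removable_raise[OF Suc.prems(1) kr])
    have krn: "k \<le> r" "r < n" using kr by (auto simp: removable_def)
    have IH: "(y p)\<^sup>2 = coeff_square p"
      using Suc p krn by (simp add: p_def ht_shift)
    have m: "shift (- 1) k r p = m" by (simp add: p_def)
    have "(c k r m)\<^sup>2 * (y m)\<^sup>2 = (move_coeff k r p)\<^sup>2 * (y p)\<^sup>2"
      using move[OF Suc.prems(1) kr] by (simp add: p_def flip: power_mult_distrib)
    also have "\<dots> = (c k r m)\<^sup>2 * coeff_square m"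
      using coeff_square_step[OF p _ krn] Suc.prems(1) IH by (simp add: m)
    finally show ?case using c_nonzero[OF Suc.prems(1) kr] by simp
  qed
  with y0 move show ?thesis by blast
qed

definition recurrence :: "(pattern \<Rightarrow> 'r) \<Rightarrow> bool" where
  "recurrence x \<longleftrightarrow> (\<forall>m\<in>patterns n. \<forall>r<n.
     (\<Sum>k\<le>r. if shift (- 1) k r m \<in> patterns n then c k r (shift (- 1) k r m) * x (shift (- 1) k r m) else 0)
       = kappa * vp (of_nat r * step_exponent m r) * x m)"

lemma step_exponent_eq:
  assumes m: "m \<in> patterns n" and r: "r < n"
  shows "step_exponent m r = 2 - (pattern_weight lam m r - pattern_weight lam m (Suc r)) "
proof -
  have "(\<Sum>l<r. entry lam m l (r - 1)) = (if r = 0 then 0 else hsum lam m (r - 1))"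
    by (cases r) (auto simp: hsum_def lessThan_Suc_atMost)
  then show ?thesis by (simp add: step_exponent_def pattern_weight_def hsum_def)
qed

lemma step_exponent_degree:
  assumes "m \<in> patterns n" "m' \<in> patterns n" "r < n" "pattern_degree n m = pattern_degree n m'"
  shows "step_exponent m r = step_exponent m' r"
  using assms by (simp add: step_exponent_eq pattern_weight_eq)

text \<open>
A solution \<open>d\<close> defines the functional \<open>D\<close> on the module; \<open>D \<beta>\<close> is its restriction to the weight space of degree
\<open>\<beta>\<close>, which is a finite sum.  The recurrence says that \<open>F\<close> multiplies \<open>D\<close> by a factor that depends only on the
degree, so \<open>D\<close> vanishes on all monomials in the \<open>F\<^sub>i\<close>, and these span the module.
\<close>

lemma recurrence_vanishes:
  assumes d: "recurrence d" and "d (\<lambda>k i. 0) = 0" and p: "p \<in> patterns n"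
  shows "d p = 0"
proof -
  define PA where "PA \<beta> = {m \<in> patterns n. pattern_degree n m = \<beta>}" for \<beta>
  have fin: "finite (PA \<beta>)" for \<beta> unfolding PA_def by (rule finite_patterns_pattern_degree)
  define D where "D \<beta> w = (\<Sum>m\<in>PA \<beta>. d m * coord m w)" for \<beta> w
  have D_sum: "D \<beta> (\<Sum>i\<in>S. sc (a i) (f i)) = (\<Sum>i\<in>S. a i * D \<beta> (f i))" for \<beta> a and f :: "pattern \<Rightarrow> 'm" and S
    unfolding D_def coord_sum coord_scale sum_distrib_left by (subst sum.swap) (simp add: mult_ac)
  have D_ket: "D \<beta> (ket n b m) = (if m \<in> patterns n then d m else 0)" if "m \<in> patterns n \<Longrightarrow> pattern_degree n m = \<beta>" for \<beta> m
  proof (cases "m \<in> patterns n")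
    case True
    have "D \<beta> (ket n b m) = (\<Sum>p\<in>PA \<beta>. if p = m then d m else 0)"
      unfolding D_def by (intro sum.cong) (auto simp: PA_def coord_ket)
    then show ?thesis using True that fin by (simp add: PA_def)
  qed (simp add: D_def ket_def)
  have zero: "D \<gamma> w = 0" if "F_monomial \<beta> w" for \<beta> \<gamma> w
    using that
  proof (induction arbitrary: \<gamma> rule: F_monomial.induct)
    case top
    show ?case
      unfolding D_def
    proof (intro sum.neutral ballI)
      fix m assume "m \<in> PA \<gamma>"
      then show "d m * coord m u = 0"
        using assms(2) coord_u[of m] by (cases "m = (\<lambda>k i. 0)") (auto simp: PA_def)
    qed
  next
    case (lower \<beta> w r)
    have F: "F_monomial (\<beta>(Suc r := Suc (\<beta> (Suc r)))) (\<rho> (Fgen (Suc r)) w)"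
      using lower.hyps by (rule F_monomial.lower)
    show ?case
    proof (cases "\<gamma> = \<beta>(Suc r := Suc (\<beta> (Suc r)))")
      case False
      have "coord m (\<rho> (Fgen (Suc r)) w) = 0" if "m \<in> PA \<gamma>" for m
        using F_monomial_degree[OF F, of m] that False by (auto simp: PA_def)
      then show ?thesis by (simp add: D_def)
    next
      case True
      have step: "D \<gamma> (\<rho> (Fgen (Suc r)) (b m)) = kappa * vp (of_nat r * step_exponent m r) * d m" if m: "m \<in> PA \<beta>" for m
      proof -
        have m': "m \<in> patterns n" and deg: "pattern_degree n m = \<beta>" using m by (auto simp: PA_def)
        have "D \<gamma> (\<rho> (Fgen (Suc r)) (b m)) = (\<Sum>k\<le>r. c k r (shift (- 1) k r m) * D \<gamma> (ket n b (shift (- 1) k r m)))"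
          unfolding F_b[OF m' lower.hyps(2)] D_def coord_sum coord_scale sum_distrib_left
          by (subst sum.swap) (simp add: mult_ac)
        also have "\<dots> = (\<Sum>k\<le>r. if shift (- 1) k r m \<in> patterns n then c k r (shift (- 1) k r m) * d (shift (- 1) k r m) else 0)"
          using pattern_degree_shift[OF m'] deg True
          by (intro sum.cong) (auto simp: D_ket)
        also have "\<dots> = kappa * vp (of_nat r * step_exponent m r) * d m"
          using d m' lower.hyps(2) unfolding recurrence_def by blast
        finally show ?thesis .
      qed
      show ?thesis
      proof (cases "PA \<beta> = {}")
        case True
        have "w = (\<Sum>m\<in>PA \<beta>. sc (coord m w) (b m))"
          using F_monomial_expansion[OF lower.hyps(1)] by (simp only: PA_def)
        then have "w = 0" by (simp only: True sum.empty)
        then show ?thesis using lower.hyps(2) by (simp add: gen_0 D_def)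
      next
        case False
        then obtain m0 where m0: "m0 \<in> PA \<beta>" by blast
        have w: "w = (\<Sum>m\<in>PA \<beta>. sc (coord m w) (b m))"
          using F_monomial_expansion[OF lower.hyps(1)] by (simp only: PA_def)
        have "\<rho> (Fgen (Suc r)) w = \<rho> (Fgen (Suc r)) (\<Sum>m\<in>PA \<beta>. sc (coord m w) (b m))"
          by (rule arg_cong[OF w])
        also have "\<dots> = (\<Sum>m\<in>PA \<beta>. sc (coord m w) (\<rho> (Fgen (Suc r)) (b m)))"
          using lower.hyps(2) by (simp add: gen_sum gen_scale)
        finally have "D \<gamma> (\<rho> (Fgen (Suc r)) w) = (\<Sum>m\<in>PA \<beta>. coord m w * D \<gamma> (\<rho> (Fgen (Suc r)) (b m)))"
          by (simp only: D_sum)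
        also have "\<dots> = (\<Sum>m\<in>PA \<beta>. kappa * vp (of_nat r * step_exponent m0 r) * (d m * coord m w))"
        proof (intro sum.cong refl)
          fix m assume m: "m \<in> PA \<beta>"
          have "step_exponent m r = step_exponent m0 r"
            using m m0 lower.hyps(2) by (intro step_exponent_degree) (auto simp: PA_def)
          then show "coord m w * D \<gamma> (\<rho> (Fgen (Suc r)) (b m)) = kappa * vp (of_nat r * step_exponent m0 r) * (d m * coord m w)"
            by (simp add: step[OF m])
        qed
        also have "\<dots> = kappa * vp (of_nat r * step_exponent m0 r) * D \<beta> w"
          by (simp add: D_def sum_distrib_left)
        finally show ?thesis using lower.IH by simp
      qed
    qed
  qed
  define \<beta> where "\<beta> = pattern_degree n p"
  have "b p \<in> span {w. \<exists>\<beta>. F_monomial \<beta> w}" by (simp add: span_F_monomials)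
  then have "D \<beta> (b p) = 0"
  proof (rule span_induct)
    show "subspace {w. D \<beta> w = 0}"
      unfolding subspace_def D_def
      by (auto simp: coord_add coord_scale distrib_left sum.distrib mult.left_commute[of _ _ "coord _ _"] sum_distrib_left[symmetric])
  qed (use zero in auto)
  then show ?thesis
    using D_ket[of p \<beta>] p by (simp add: \<beta>_def ket_def)
qed


section \<open>The Whittaker vector\<close>

lemma coord_K_pos:
  assumes i: "i \<in> {1..n}" and m: "m \<in> patterns n"
  shows "coord m (act sc \<rho> (K_pos i) w) = vp (K_exp m i) * coord m w"
proof -
  have g: "Vpos (i - Suc 0) \<in> gens n" "Vneg i \<in> gens n" using i by (auto simp: gens_def)
  show ?thesis
  proof (induction w rule: span_induct_b)
    case zero
    show ?case using g by (simp add: K_pos_eq gen_0)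
  next
    case (add x y)
    then show ?case using g by (simp add: K_pos_eq gen_add coord_add distrib_left)
  next
    case (scale a x)
    then show ?case using g by (simp add: K_pos_eq gen_scale coord_scale)
  next
    case (basis p)
    then show ?case using i m by (simp add: K_pos_b coord_scale coord_b)
  qed
qed

lemma form_alpha:
  fixes x :: "nat \<Rightarrow> 'l"
  assumes "i \<in> {1..n}"
  shows "form n (\<lambda>j. of_int (alpha i j)) x = x (i - 1) - x i"
proof -
  have "form n (\<lambda>j. of_int (alpha i j)) x = (\<Sum>j\<le>n. (if j = i - 1 then x j else 0) - (if j = i then x j else 0))"
    unfolding form_def using assms by (intro sum.cong) (auto simp: alpha_def)
  then show ?thesis using assms by (auto simp: sum_subtractf)
qed

lemma weight_space_coord:
  assumes \<beta>: "\<beta> \<in> Qplus n" and w: "w \<in> weight_space n vp lam sc \<rho> \<beta>"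
    and m: "m \<in> patterns n" and nz: "coord m w \<noteq> 0"
  shows "pattern_degree n m = \<beta>"
proof -
  define d where "d i = int (\<beta> i) - int (pattern_degree n m i)" for i
  note deg = pattern_degree_Qplus[OF m]
  have "2 * d i = d (i - 1) + d (Suc i)" if "1 \<le> i" "i \<le> n" for i
  proof -
    have i: "i \<in> {1..n}" using that by simp
    let ?f = "lam (i - 1) - qcoord n \<beta> (i - 1) - (lam i - qcoord n \<beta> i)"
    have "act sc \<rho> (K_pos i) w = sc (vp ?f) w"
      using w i unfolding weight_space_def by (auto simp: form_alpha)
    then have "vp (K_exp m i) * coord m w = vp ?f * coord m w"
      using coord_K_pos[OF i m, of w] coord_scale by metis
    then have "vp (K_exp m i) = vp ?f" using nz by simp
    then have "vp (K_exp m i - ?f) = 1" unfolding vp_diff[of "K_exp m i" ?f] by simp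
    moreover have "K_exp m i - ?f = of_int (2 * d i - d (i - 1) - d (Suc i))"
      using that by (simp add: pattern_weight_eq[OF m] qcoord_eq[OF \<beta>] qcoord_eq[OF deg] d_def algebra_simps)
    ultimately have "2 * d i - d (i - 1) - d (Suc i) = 0"
      by (simp only: vp_of_int_eq_1_iff)
    then show ?thesis by simp
  qed
  moreover have "d 0 = 0" "d (Suc n) = 0"
    using \<beta> deg by (simp_all add: d_def Qplus_def)
  ultimately have "d i = 0" if "i \<le> Suc n" for i
    using cartan_injective[of d n i] that by blast
  then have "pattern_degree n m i = \<beta> i" for i
    using \<beta> deg by (cases "i \<le> Suc n") (auto simp: d_def Qplus_def)
  then show ?thesis by blast
qed

lemma K_pos_power_eigenvector:
  assumes "i \<in> {1..n}" "act sc \<rho> (K_pos i) w = sc a w"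
  shows "foldr \<rho> (concat (replicate j [Vpos (i - 1), Vneg i])) w = sc (a ^ j) w"
proof (induction j)
  case (Suc j)
  have K: "\<rho> (Vpos (i - 1)) (\<rho> (Vneg i) w) = sc a w"
    using assms(2) by (simp add: K_pos_eq)
  have "foldr \<rho> (concat (replicate (Suc j) [Vpos (i - 1), Vneg i])) w = \<rho> (Vpos (i - 1)) (\<rho> (Vneg i) (sc (a ^ j) w))"
    using Suc by simp
  also have "\<dots> = sc (a ^ j) (sc a w)"
  proof -
    have "Vpos (i - 1) \<in> gens n" "Vneg i \<in> gens n" using assms(1) by (auto simp: gens_def)
    then show ?thesis using K by (simp add: gen_scale)
  qed
  finally show ?case by (simp add: mult.commute)
qed simp

text \<open>
On its weight space \<open>K\<^sub>i\<close> acts by a scalar, which produces the power of \<open>v\<close> on the right hand side of the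
recurrence.
\<close>

lemma whittaker_recurrence:
  assumes \<theta>: "whittaker n vp lam sc \<rho> u \<theta>"
  shows "recurrence (\<lambda>m. coord m (\<theta> (pattern_degree n m)))"
  unfolding recurrence_def
proof (intro ballI allI impI)
  fix m r assume m: "m \<in> patterns n" and r: "r < n"
  define \<beta> where "\<beta> = pattern_degree n m"
  define \<beta>' where "\<beta>' = \<beta>(Suc r := \<beta> (Suc r) + 1)"
  have \<beta>: "\<beta> \<in> Qplus n" using pattern_degree_Qplus[OF m] by (simp add: \<beta>_def)
  then have \<beta>': "\<beta>' \<in> Qplus n" using r by (auto simp: Qplus_def \<beta>'_def)
  have i: "Suc r \<in> {1..n}" using r by simp
  have "act sc \<rho> (K_pos (Suc r)) (\<theta> \<beta>') = sc (vp (form n (\<lambda>j. of_int (alpha (Suc r) j)) (\<lambda>j. lam j - qcoord n \<beta>' j))) (\<theta> \<beta>')"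
    using \<theta> \<beta>' i unfolding whittaker_def weight_space_def by blast
  moreover have "form n (\<lambda>j. of_int (alpha (Suc r) j)) (\<lambda>j. lam j - qcoord n \<beta>' j) = - step_exponent m r"
    unfolding form_alpha[OF i] step_exponent_eq[OF m r] pattern_weight_eq[OF m] \<beta>_def[symmetric] qcoord_eq[OF \<beta>] qcoord_eq[OF \<beta>']
    by (simp add: \<beta>'_def)
  ultimately have K: "act sc \<rho> (K_pos (Suc r)) (\<theta> \<beta>') = sc (vp (- step_exponent m r)) (\<theta> \<beta>')" by simp
  have "act sc \<rho> (letter (Egen (Suc r)) * K_pos (Suc r) ^ (Suc r - 1)) (\<theta> \<beta>') = sc (1 / (1 - (vp 1)\<^sup>2)) (\<theta> \<beta>)"
    using \<theta> \<beta> i unfolding whittaker_def \<beta>'_def by blast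
  then have "\<rho> (Egen (Suc r)) (sc (vp (- step_exponent m r) ^ r) (\<theta> \<beta>')) = sc kappa (\<theta> \<beta>)"
    using K_pos_power_eigenvector[OF i K, of r] by (simp add: K_pos_power kappa_def)
  then have "sc (vp (of_nat r * (- step_exponent m r))) (\<rho> (Egen (Suc r)) (\<theta> \<beta>')) = sc kappa (\<theta> \<beta>)"
    using r by (simp add: gen_scale vp_of_nat_mult del: mult_minus_right)
  then have "coord m (sc (vp (of_nat r * (- step_exponent m r))) (\<rho> (Egen (Suc r)) (\<theta> \<beta>'))) = kappa * coord m (\<theta> \<beta>)"
    by (simp add: coord_scale)
  then have "vp (- (of_nat r * step_exponent m r)) * coord m (\<rho> (Egen (Suc r)) (\<theta> \<beta>')) = kappa * coord m (\<theta> \<beta>)"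
    by (simp add: coord_scale)
  then have "coord m (\<rho> (Egen (Suc r)) (\<theta> \<beta>')) = kappa * vp (of_nat r * step_exponent m r) * coord m (\<theta> \<beta>)"
    by (simp add: vp_minus field_simps)
  moreover have "coord m (\<rho> (Egen (Suc r)) (\<theta> \<beta>')) = (\<Sum>k\<le>r. if shift (- 1) k r m \<in> patterns n
      then c k r (shift (- 1) k r m) * coord (shift (- 1) k r m) (\<theta> (pattern_degree n (shift (- 1) k r m))) else 0)"
    unfolding coord_E[OF r m]
    by (intro sum.cong refl) (auto simp: pattern_degree_shift[OF m] \<beta>'_def \<beta>_def)
  ultimately show "(\<Sum>k\<le>r. if shift (- 1) k r m \<in> patterns n
      then c k r (shift (- 1) k r m) * coord (shift (- 1) k r m) (\<theta> (pattern_degree n (shift (- 1) k r m))) else 0)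
    = kappa * vp (of_nat r * step_exponent m r) * coord m (\<theta> (pattern_degree n m))"
    by (simp add: \<beta>_def)
qed

text \<open>
The coordinates of \<open>\<theta>\<close> and the solution from \<open>move_potential\<close> with the same value at the top satisfy the same
recurrence, so their difference vanishes.
\<close>

lemma whittaker_coord_square:
  assumes \<theta>: "whittaker n vp lam sc \<rho> u \<theta>" and m: "m \<in> patterns n"
  shows "(coord m (\<theta> (pattern_degree n m)))\<^sup>2 = coeff_square m"
proof -
  define x where "x m = coord m (\<theta> (pattern_degree n m))" for m
  have x: "recurrence x" unfolding x_def by (rule whittaker_recurrence[OF \<theta>])
  have "x (\<lambda>k i. 0) = coord (\<lambda>k i. 0) u"
  proof -
    have "pattern_degree n (\<lambda>k i. 0) = (\<lambda>_. 0)" by (simp add: pattern_degree_def fun_eq_iff)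
    then show ?thesis using \<theta> by (simp add: x_def whittaker_def)
  qed
  moreover have "coord (\<lambda>k i. 0) (b (\<lambda>k i. 0)) = 1"
    by (simp add: coord_b zero_pattern)
  ultimately have "(x (\<lambda>k i. 0))\<^sup>2 = 1"
    using b_top coord_scale[of "\<lambda>k i. 0" "- 1" u] by auto (metis power2_minus power_one)
  then obtain y where y0: "y (\<lambda>k i. 0) = x (\<lambda>k i. 0)"
    and move: "\<And>m k r. m \<in> patterns n \<Longrightarrow> removable n m k r \<Longrightarrow> c k r m * y m = move_coeff k r (shift 1 k r m) * y (shift 1 k r m)"
    and sq: "\<And>m. m \<in> patterns n \<Longrightarrow> (y m)\<^sup>2 = coeff_square m"
    using move_potential by metis
  have y: "recurrence y"
    unfolding recurrence_def
  proof (intro ballI allI impI)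
    fix m r assume m: "m \<in> patterns n" and r: "r < n"
    show "(\<Sum>k\<le>r. if shift (- 1) k r m \<in> patterns n then c k r (shift (- 1) k r m) * y (shift (- 1) k r m) else 0)
       = kappa * vp (of_nat r * step_exponent m r) * y m"
    proof (rule recurrence_from_moves[OF m r])
      fix k assume "k \<le> r" "shift (- 1) k r m \<in> patterns n"
      then show "c k r (shift (- 1) k r m) * y (shift (- 1) k r m) = move_coeff k r m * y m"
        using move[of "shift (- 1) k r m" k r] lower_removable[OF m] r by simp
    qed
  qed
  have "recurrence (\<lambda>m. x m - y m)"
    unfolding recurrence_def
  proof (intro ballI allI impI)
    fix m r assume m: "m \<in> patterns n" and r: "r < n"
    have "(\<Sum>k\<le>r. if shift (- 1) k r m \<in> patterns n then c k r (shift (- 1) k r m) * (x (shift (- 1) k r m) - y (shift (- 1) k r m)) else 0)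
      = (\<Sum>k\<le>r. if shift (- 1) k r m \<in> patterns n then c k r (shift (- 1) k r m) * x (shift (- 1) k r m) else 0)
        - (\<Sum>k\<le>r. if shift (- 1) k r m \<in> patterns n then c k r (shift (- 1) k r m) * y (shift (- 1) k r m) else 0)"
      unfolding sum_subtractf[symmetric] by (intro sum.cong) (auto simp: right_diff_distrib)
    also have "\<dots> = kappa * vp (of_nat r * step_exponent m r) * x m - kappa * vp (of_nat r * step_exponent m r) * y m"
      using x y m r unfolding recurrence_def by simp
    finally show "(\<Sum>k\<le>r. if shift (- 1) k r m \<in> patterns n then c k r (shift (- 1) k r m) * (x (shift (- 1) k r m) - y (shift (- 1) k r m)) else 0)
      = kappa * vp (of_nat r * step_exponent m r) * (x m - y m)"
      by (simp only: right_diff_distrib)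
  qed
  then have "x m - y m = 0"
    by (rule recurrence_vanishes) (simp_all add: y0 m)
  then show ?thesis using sq[OF m] by (simp add: x_def)
qed

lemma whittaker_expansion:
  assumes \<theta>: "whittaker n vp lam sc \<rho> u \<theta>" and \<beta>: "\<beta> \<in> Qplus n"
  shows "\<theta> \<beta> = (\<Sum>m\<in>patterns_at n lam \<beta>. sc (coord m (\<theta> (pattern_degree n m))) (b m))"
proof -
  have ws: "\<theta> \<beta> \<in> weight_space n vp lam sc \<rho> \<beta>"
    using \<theta> \<beta> by (simp add: whittaker_def)
  have "\<theta> \<beta> = (\<Sum>m | m \<in> patterns n \<and> pattern_degree n m = \<beta>. sc (coord m (\<theta> \<beta>)) (b m))"
    using weight_space_coord[OF \<beta> ws] by (intro expansion finite_patterns_pattern_degree) auto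
  then show ?thesis
    unfolding patterns_at_eq[OF \<beta>] by (auto intro!: sum.cong elim!: trans)
qed

end

text \<open>
The sign changes of the kets are compensated by those of the roots \<open>c\<close>.  For a label outside the set of patterns the
sign is taken to be \<open>1\<close>, so that the new roots have the same squares there as well.
\<close>

lemma (in vector_space) gz_basis_sign_change:
  assumes gz: "gz_basis n vp lam scale \<rho> u b"
    and lin: "\<And>g a x. g \<in> gens n \<Longrightarrow> \<rho> g (scale a x) = scale a (\<rho> g x)"
    and \<epsilon>: "\<And>m. m \<in> patterns n \<Longrightarrow> \<epsilon> m = 1 \<or> \<epsilon> m = - 1"
  shows "gz_basis n vp lam scale \<rho> u (\<lambda>m. scale (\<epsilon> m) (b m))"
proof -
  define b' where "b' m = scale (\<epsilon> m) (b m)" for m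
  define \<delta> where "\<delta> m = (if m \<in> patterns n then \<epsilon> m else 1)" for m
  have \<delta>2: "\<delta> m * \<delta> m = 1" for m
    using \<epsilon>[of m] by (auto simp: \<delta>_def)
  have \<delta>2': "\<delta> m * (\<delta> m * a) = a" for m a
    using \<delta>2[of m] by (simp flip: mult.assoc)
  have b'_eq: "b' m = scale (\<delta> m) (b m)" and b_eq: "b m = scale (\<delta> m) (b' m)" if "m \<in> patterns n" for m
    using that \<delta>2[of m] by (simp_all add: b'_def \<delta>_def)
  have ket': "ket n b' m = scale (\<delta> m) (ket n b m)" for m
    by (simp add: ket_def b'_eq)
  from gz obtain c where inj: "inj_on b (patterns n)" and ind: "\<not> dependent (b ` patterns n)"
    and span: "span (b ` patterns n) = UNIV"
    and top: "b (\<lambda>k i. 0) = u \<or> b (\<lambda>k i. 0) = - u"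
    and sub: "\<forall>m\<in>patterns n. gz_subspace n vp lam scale \<rho> m = span {b m}"
    and c: "\<forall>m\<in>patterns n. \<forall>i\<in>{1..n}. \<forall>k<i.
           c_den vp lam k i m \<noteq> 0 \<and> (c k (i - 1) m)^2 = - (c_num vp lam k i m / c_den vp lam k i m)"
    and V: "\<forall>m\<in>patterns n. \<forall>i\<le>n. \<rho> (Vpos i) (b m) = scale (vp (pattern_weight lam m i)) (b m)"
    and E: "\<forall>m\<in>patterns n. \<forall>i\<in>{1..n}.
           \<rho> (Egen i) (b m) = (\<Sum>k<i. scale (c k (i - 1) m) (ket n b (shift 1 k (i - 1) m)))"
    and F: "\<forall>m\<in>patterns n. \<forall>i\<in>{1..n}.
           \<rho> (Fgen i) (b m) =
             (\<Sum>k<i. scale (c k (i - 1) (shift (- 1) k (i - 1) m)) (ket n b (shift (- 1) k (i - 1) m)))"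
    unfolding gz_basis_def by blast
  define c' where "c' k r m = c k r m * \<delta> m * \<delta> (shift 1 k r m)" for k r m
  have other: "b' p \<in> span (b ` patterns n - {b m})" if "m \<in> patterns n" "p \<in> patterns n" "m \<noteq> p" for m p
    unfolding b'_eq[OF that(2)] using that inj_onD[OF inj, of m p]
    by (intro span_scale span_base) auto
  have not_in: "b m \<notin> span (b ` patterns n - {b m})" if "m \<in> patterns n" for m
    using ind that unfolding dependent_def by blast
  have not_in': "b' m \<notin> span (b ` patterns n - {b m})" if m: "m \<in> patterns n" for m
  proof
    assume "b' m \<in> span (b ` patterns n - {b m})"
    then have "b m \<in> span (b ` patterns n - {b m})"
      by (subst b_eq[OF m]) (rule span_scale)
    with not_in[OF m] show False ..
  qed
  have "inj_on b' (patterns n)"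
    using other not_in' by (metis inj_onI)
  moreover have "\<not> dependent (b' ` patterns n)"
  proof
    assume "dependent (b' ` patterns n)"
    then obtain m where m: "m \<in> patterns n" "b' m \<in> span (b' ` patterns n - {b' m})"
      unfolding dependent_def by blast
    have "b' ` patterns n - {b' m} \<subseteq> span (b ` patterns n - {b m})"
      using other[OF m(1)] by auto
    then have "span (b' ` patterns n - {b' m}) \<subseteq> span (b ` patterns n - {b m})"
      by (rule span_minimal) simp
    with m not_in' show False by blast
  qed
  moreover have "span (b' ` patterns n) = UNIV"
  proof -
    have "b ` patterns n \<subseteq> span (b' ` patterns n)"
      using b_eq by (metis image_subsetI imageI span_base span_scale)
    then have "span (b ` patterns n) \<subseteq> span (b' ` patterns n)"
      by (rule span_minimal) simp
    then show ?thesis using span by auto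
  qed
  moreover have "b' (\<lambda>k i. 0) = u \<or> b' (\<lambda>k i. 0) = - u"
    using top \<epsilon>[OF zero_pattern] by (auto simp: b'_def)
  moreover have "\<forall>m\<in>patterns n. gz_subspace n vp lam scale \<rho> m = span {b' m}"
  proof
    fix m assume m: "m \<in> patterns n"
    have "span {b m} = span {b' m}"
      unfolding span_eq using b_eq[OF m] b'_eq[OF m]
      by (metis empty_subsetI insert_subset singletonI span_base span_scale)
    then show "gz_subspace n vp lam scale \<rho> m = span {b' m}" using sub m by simp
  qed
  moreover have "\<forall>m\<in>patterns n. \<forall>i\<in>{1..n}. \<forall>k<i.
           c_den vp lam k i m \<noteq> 0 \<and> (c' k (i - 1) m)^2 = - (c_num vp lam k i m / c_den vp lam k i m)"
  proof -
    have "(c' k r m)\<^sup>2 = (c k r m)\<^sup>2" for k r m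
      using \<delta>2 by (simp add: c'_def power_mult_distrib power2_eq_square[of "\<delta> _"])
    then show ?thesis using c by simp
  qed
  moreover have "\<forall>m\<in>patterns n. \<forall>i\<le>n. \<rho> (Vpos i) (b' m) = scale (vp (pattern_weight lam m i)) (b' m)"
    using V by (auto simp: b'_eq lin gens_def mult.commute)
  moreover have "\<forall>m\<in>patterns n. \<forall>i\<in>{1..n}.
           \<rho> (Egen i) (b' m) = (\<Sum>k<i. scale (c' k (i - 1) m) (ket n b' (shift 1 k (i - 1) m)))"
  proof (intro ballI)
    fix m i assume m: "m \<in> patterns n" and i: "i \<in> {1..n}"
    have "\<rho> (Egen i) (b' m) = scale (\<delta> m) (\<rho> (Egen i) (b m))"
      using i by (simp add: b'_eq[OF m] lin gens_def)
    also have "\<dots> = (\<Sum>k<i. scale (\<delta> m * c k (i - 1) m) (ket n b (shift 1 k (i - 1) m)))"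
      using E m i by (simp add: scale_sum_right)
    also have "\<dots> = (\<Sum>k<i. scale (c' k (i - 1) m) (ket n b' (shift 1 k (i - 1) m)))"
      by (intro sum.cong) (simp_all add: ket' c'_def mult_ac \<delta>2 \<delta>2')
    finally show "\<rho> (Egen i) (b' m) = (\<Sum>k<i. scale (c' k (i - 1) m) (ket n b' (shift 1 k (i - 1) m)))" .
  qed
  moreover have "\<forall>m\<in>patterns n. \<forall>i\<in>{1..n}.
           \<rho> (Fgen i) (b' m) =
             (\<Sum>k<i. scale (c' k (i - 1) (shift (- 1) k (i - 1) m)) (ket n b' (shift (- 1) k (i - 1) m)))"
  proof (intro ballI)
    fix m i assume m: "m \<in> patterns n" and i: "i \<in> {1..n}"
    have "\<rho> (Fgen i) (b' m) = scale (\<delta> m) (\<rho> (Fgen i) (b m))"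
      using i by (simp add: b'_eq[OF m] lin gens_def)
    also have "\<dots> = (\<Sum>k<i. scale (\<delta> m * c k (i - 1) (shift (- 1) k (i - 1) m)) (ket n b (shift (- 1) k (i - 1) m)))"
      using F m i by (simp add: scale_sum_right)
    also have "\<dots> = (\<Sum>k<i. scale (c' k (i - 1) (shift (- 1) k (i - 1) m)) (ket n b' (shift (- 1) k (i - 1) m)))"
      by (intro sum.cong) (simp_all add: ket' c'_def mult_ac \<delta>2 \<delta>2')
    finally show "\<rho> (Fgen i) (b' m) = (\<Sum>k<i. scale (c' k (i - 1) (shift (- 1) k (i - 1) m)) (ket n b' (shift (- 1) k (i - 1) m)))" .
  qed
  ultimately have "gz_basis n vp lam scale \<rho> u b'"
    unfolding gz_basis_def by blast
  then show ?thesis unfolding b'_def[abs_def] .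
qed

theorem proposition2p1:
  fixes \<iota> :: "complex poly fract \<Rightarrow> 'r::field"
    and vp :: "'l::{comm_ring_1, ring_char_0} \<Rightarrow> 'r"
    and n :: nat
    and lam :: "nat \<Rightarrow> 'l"
    and sc :: "'r \<Rightarrow> 'm::ab_group_add \<Rightarrow> 'm"
    and \<rho> :: "gen \<Rightarrow> 'm \<Rightarrow> 'm"
    and u :: 'm
    and \<theta> :: "(nat \<Rightarrow> nat) \<Rightarrow> 'm"
    and b :: "pattern \<Rightarrow> 'm"
    and A :: "nat \<Rightarrow> (nat \<Rightarrow> 'l) \<Rightarrow> (nat \<Rightarrow> 'l) \<Rightarrow> 'r"
  assumes "field_hom \<iota>" and "exponential \<iota> vp" and "sqrt_extension \<iota> vp"
    and "verma_module n vp lam sc \<rho> u"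
    and "whittaker n vp lam sc \<rho> u \<theta>"
    and "gz_basis n vp lam sc \<rho> u b"
    and "A_roots n vp A"
  shows "\<exists>\<epsilon> :: pattern \<Rightarrow> 'r.
           (\<forall>m\<in>patterns n. \<epsilon> m = 1 \<or> \<epsilon> m = - 1) \<and>
           gz_basis n vp lam sc \<rho> u (\<lambda>m. sc (\<epsilon> m) (b m)) \<and>
           (\<forall>\<beta>\<in>Qplus n.
              \<theta> \<beta> = (\<Sum>m\<in>patterns_at n lam \<beta>. sc (whittaker_coeff n vp lam A m) (sc (\<epsilon> m) (b m))))"
proof -
  have module: "Uv_module n (vp 1) sc \<rho>" and generated: "\<forall>x. \<exists>p\<in>free_alg n. act sc \<rho> p u = x"
    using assms(4) by (auto simp: verma_module_def)
  from assms(6) obtain c where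
    c: "\<forall>m\<in>patterns n. \<forall>i\<in>{1..n}. \<forall>k<i.
           c_den vp lam k i m \<noteq> 0 \<and> (c k (i - 1) m)^2 = - (c_num vp lam k i m / c_den vp lam k i m)"
    and V: "\<forall>m\<in>patterns n. \<forall>i\<le>n. \<rho> (Vpos i) (b m) = sc (vp (pattern_weight lam m i)) (b m)"
    and E: "\<forall>m\<in>patterns n. \<forall>i\<in>{1..n}.
           \<rho> (Egen i) (b m) = (\<Sum>k<i. sc (c k (i - 1) m) (ket n b (shift 1 k (i - 1) m)))"
    and F: "\<forall>m\<in>patterns n. \<forall>i\<in>{1..n}.
           \<rho> (Fgen i) (b m) =
             (\<Sum>k<i. sc (c k (i - 1) (shift (- 1) k (i - 1) m)) (ket n b (shift (- 1) k (i - 1) m)))"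
    unfolding gz_basis_def by blast
  interpret gz_module vp sc n lam \<rho> u b c
  proof (intro gz_module.intro gz_module_axioms.intro)
    show "quantum_exponent vp" by (rule quantum_exponentI[OF assms(1,2)])
    show "vector_space sc" using module by (simp add: Uv_module_def)
  next
    fix m k r assume *: "m \<in> patterns n" "k \<le> r" "r < n"
    then have "Suc r \<in> {1..n}" "k < Suc r" by auto
    from c[rule_format, OF *(1) this]
    show "c_den vp lam k (Suc r) m \<noteq> 0"
      "(c k r m)\<^sup>2 = - (c_num vp lam k (Suc r) m / c_den vp lam k (Suc r) m)"
      by simp_all
  next
    fix m r assume *: "m \<in> patterns n" "r < n"
    then have i: "Suc r \<in> {1..n}" by auto
    show "\<rho> (Egen (Suc r)) (b m) = (\<Sum>k\<le>r. sc (c k r m) (ket n b (shift 1 k r m)))"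
      using E[rule_format, OF *(1) i] by (simp only: diff_Suc_1 lessThan_Suc_atMost)
    show "\<rho> (Fgen (Suc r)) (b m) = (\<Sum>k\<le>r. sc (c k r (shift (- 1) k r m)) (ket n b (shift (- 1) k r m)))"
      using F[rule_format, OF *(1) i] by (simp only: diff_Suc_1 lessThan_Suc_atMost)
  qed (use module generated V assms(6) in \<open>auto simp: Uv_module_def gz_basis_def\<close>)
  define w where "w = whittaker_coeff n vp lam A"
  define x where "x m = coord m (\<theta> (pattern_degree n m))" for m
  define \<epsilon> where "\<epsilon> m = (if x m = w m then 1 else - 1 :: 'r)" for m
  have x: "x m = w m * \<epsilon> m" if m: "m \<in> patterns n" for m
  proof -
    have "(x m)\<^sup>2 = (w m)\<^sup>2"
      unfolding x_def w_def whittaker_coord_square[OF assms(5) m] whittaker_coeff_square[OF m assms(7)] ..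
    then show ?thesis by (auto simp: \<epsilon>_def power2_eq_iff)
  qed
  show ?thesis
  proof (intro exI[of _ \<epsilon>] conjI ballI)
    show "\<epsilon> m = 1 \<or> \<epsilon> m = - 1" for m by (simp add: \<epsilon>_def)
    show "gz_basis n vp lam sc \<rho> u (\<lambda>m. sc (\<epsilon> m) (b m))"
      by (rule gz_basis_sign_change[OF assms(6)]) (auto simp: gen_scale \<epsilon>_def)
  next
    fix \<beta> assume "\<beta> \<in> Qplus n"
    then have "\<theta> \<beta> = (\<Sum>m\<in>patterns_at n lam \<beta>. sc (x m) (b m))"
      unfolding x_def by (rule whittaker_expansion[OF assms(5)])
    also have "\<dots> = (\<Sum>m\<in>patterns_at n lam \<beta>. sc (w m) (sc (\<epsilon> m) (b m)))"
      by (intro sum.cong) (auto simp: patterns_at_def x)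
    finally show "\<theta> \<beta> = (\<Sum>m\<in>patterns_at n lam \<beta>. sc (whittaker_coeff n vp lam A m) (sc (\<epsilon> m) (b m)))"
      unfolding w_def .
  qed
qed

end
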